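(* Let $s\in(0,1)$, let $N\ge 3$ be an integer, let $\alpha\in(0,N)$, and let $p,q,r\in\left(1+\frac{\alpha}{N},\,1+\frac{\alpha+2s}{N}\right)$. For $i=1,2$ let $V_i:\mathbb{R}^N\to\mathbb{R}$ satisfy $V_i(x)\ge 0$, $V_i\in L^\infty_{loc}(\mathbb{R}^N)$ and $\lim_{|x|\to\infty}V_i(x)=\infty$. Let $\mu_1,\mu_2,\beta,a,b>0$ be fixed. Then the system $$\begin{cases}(-\Delta)^s u+V_1(x)u+\lambda_1u=\mu_1(I_{\alpha}\star |u|^p)|u|^{p-2}u+\beta(I_{\alpha}\star |v|^r)|u|^{r-2}u,\\ (-\Delta)^s v+V_2(x)v+\lambda_2v=\mu_2(I_{\alpha}\star |v|^q)|v|^{q-2}v+\beta(I_{\alpha}\star |u|^r)|v|^{r-2}v,\end{cases}\qquad x\in\mathbb{R}^N,$$ has a solution $(u,v,\lambda_1,\lambda_2)$ with $(u,v)\in S_a\times S_b$, where $u,v$ are nonnegative.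
   Context: $(-\Delta)^s$ is the fractional Laplacian on $\mathbb{R}^N$, $H^s(\mathbb{R}^N)$ is the usual (real-valued) fractional Sobolev space, $I_\alpha(x)=|x|^{\alpha-N}$, and $\star$ denotes convolution. For $c>0$, $S_c=\{u\in H^s(\mathbb{R}^N):\|u\|_2^2=c^2\}$. For $i=1,2$, $H^s_i(\mathbb{R}^N)=\{u\in H^s(\mathbb{R}^N):\int_{\mathbb{R}^N}V_i(x)|u|^2dx<\infty\}$. A solution $(u,v,\lambda_1,\lambda_2)$ consists of $(u,v)\in H^s_1(\mathbb{R}^N)\times H^s_2(\mathbb{R}^N)$ and real numbers $\lambda_1,\lambda_2$ (part of the unknown, arising as Lagrange multipliers) satisfying the system in the weak sense. *)

theory Defs
  imports "HOL-Analysis.Analysis"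
begin

(* Elements of the function spaces are Lebesgue measurable representatives;
   everything below depends on them only up to null sets. *)

definition gagliardo_quotient :: "real \<Rightarrow> ('a::euclidean_space \<Rightarrow> real) \<Rightarrow> ('a \<Rightarrow> real) \<Rightarrow> 'a \<times> 'a \<Rightarrow> real" where
  "gagliardo_quotient s u w = (\<lambda>(x, y).
     (u x - u y) * (w x - w y) / norm (x - y) powr (real DIM('a) + 2 * s))"

definition frac_sobolev :: "real \<Rightarrow> ('a::euclidean_space \<Rightarrow> real) set" where
  "frac_sobolev s = {u. u \<in> borel_measurable lebesgue \<and>
     integrable lebesgue (\<lambda>x. (u x)\<^sup>2) \<and>
     (\<integral>\<^sup>+ z. ennreal (gagliardo_quotient s u u z) \<partial>lebesgue) < \<infinity>}"

definition frac_sobolev_pot :: "real \<Rightarrow> ('a::euclidean_space \<Rightarrow> real) \<Rightarrow> ('a \<Rightarrow> real) set" where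
  "frac_sobolev_pot s V = {u \<in> frac_sobolev s.
     (\<integral>\<^sup>+ x. ennreal (V x * (u x)\<^sup>2) \<partial>lebesgue) < \<infinity>}"

definition mass_sphere :: "real \<Rightarrow> real \<Rightarrow> ('a::euclidean_space \<Rightarrow> real) set" where
  "mass_sphere s c = {u \<in> frac_sobolev s. (\<integral> x. (u x)\<^sup>2 \<partial>lebesgue) = c\<^sup>2}"

(* The constant C for which C * P.V. \<integral> (u x - u y) / |x - y|^(n + 2s) dy
   has Fourier symbol |\<xi>|^(2s) in dimension n. *)
definition frac_laplace_const :: "nat \<Rightarrow> real \<Rightarrow> real" where
  "frac_laplace_const n s =
     4 powr s * Gamma (real n / 2 + s) / (pi powr (real n / 2) * \<bar>Gamma (- s)\<bar>)"

(* The pairing of (-\<Delta>)^s u with w. *)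
definition frac_laplace_form :: "real \<Rightarrow> ('a::euclidean_space \<Rightarrow> real) \<Rightarrow> ('a \<Rightarrow> real) \<Rightarrow> real" where
  "frac_laplace_form s u w =
     frac_laplace_const DIM('a) s / 2 * (\<integral> z. gagliardo_quotient s u w z \<partial>lebesgue)"

definition riesz_kernel :: "real \<Rightarrow> 'a::euclidean_space \<Rightarrow> real" where
  "riesz_kernel \<alpha> x = norm x powr (\<alpha> - real DIM('a))"

definition convolution :: "('a::euclidean_space \<Rightarrow> real) \<Rightarrow> ('a \<Rightarrow> real) \<Rightarrow> 'a \<Rightarrow> real" where
  "convolution f g x = (\<integral> y. f (x - y) * g y \<partial>lebesgue)"

definition convolution_ae_converges :: "('a::euclidean_space \<Rightarrow> real) \<Rightarrow> ('a \<Rightarrow> real) \<Rightarrow> bool" where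
  "convolution_ae_converges f g \<longleftrightarrow>
     (AE x in lebesgue. integrable lebesgue (\<lambda>y. f (x - y) * g y))"

(* For m < 2, |u|^(m-2) u is read as 0 where u = 0; this is what powr gives for m > 1. *)
definition choquard_term :: "real \<Rightarrow> real \<Rightarrow> ('a::euclidean_space \<Rightarrow> real) \<Rightarrow> ('a \<Rightarrow> real) \<Rightarrow> 'a \<Rightarrow> real" where
  "choquard_term \<alpha> m w u x =
     convolution (riesz_kernel \<alpha>) (\<lambda>y. \<bar>w y\<bar> powr m) x * (\<bar>u x\<bar> powr (m - 2) * u x)"

(* u is a weak solution of
     (-\<Delta>)^s u + V u + \<lambda> u = \<mu> (I_\<alpha> * |u|^p) |u|^(p-2) u + \<beta> (I_\<alpha> * |v|^r) |u|^(r-2) u.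
   The convergence conditions rule out solutions by the convention that a
   divergent Bochner integral is 0; the integrals on the left-hand side converge
   for u, \<phi> in the space by the Cauchy-Schwarz inequality. *)
definition weak_choquard_eq ::
  "real \<Rightarrow> real \<Rightarrow> ('a::euclidean_space \<Rightarrow> real) \<Rightarrow> real \<Rightarrow> real \<Rightarrow> real \<Rightarrow> real \<Rightarrow> real \<Rightarrow>
   ('a \<Rightarrow> real) \<Rightarrow> ('a \<Rightarrow> real) \<Rightarrow> bool" where
  "weak_choquard_eq s \<alpha> V lam \<mu> p \<beta> r u v \<longleftrightarrow>
     convolution_ae_converges (riesz_kernel \<alpha>) (\<lambda>y. \<bar>u y\<bar> powr p) \<and>
     convolution_ae_converges (riesz_kernel \<alpha>) (\<lambda>y. \<bar>v y\<bar> powr r) \<and>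
     (\<forall>\<phi> \<in> frac_sobolev_pot s V.
        integrable lebesgue (\<lambda>x. choquard_term \<alpha> p u u x * \<phi> x) \<and>
        integrable lebesgue (\<lambda>x. choquard_term \<alpha> r v u x * \<phi> x) \<and>
        frac_laplace_form s u \<phi> + (\<integral> x. V x * u x * \<phi> x \<partial>lebesgue)
          + lam * (\<integral> x. u x * \<phi> x \<partial>lebesgue)
        = \<mu> * (\<integral> x. choquard_term \<alpha> p u u x * \<phi> x \<partial>lebesgue)
          + \<beta> * (\<integral> x. choquard_term \<alpha> r v u x * \<phi> x \<partial>lebesgue))"

definition choquard_system_solution ::
  "real \<Rightarrow> real \<Rightarrow> ('a::euclidean_space \<Rightarrow> real) \<Rightarrow> ('a \<Rightarrow> real) \<Rightarrow> real \<Rightarrow> real \<Rightarrow> real \<Rightarrow>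
   real \<Rightarrow> real \<Rightarrow> real \<Rightarrow> ('a \<Rightarrow> real) \<Rightarrow> ('a \<Rightarrow> real) \<Rightarrow> real \<Rightarrow> real \<Rightarrow> bool" where
  "choquard_system_solution s \<alpha> V1 V2 \<mu>1 \<mu>2 \<beta> p q r u v lam1 lam2 \<longleftrightarrow>
     u \<in> frac_sobolev_pot s V1 \<and> v \<in> frac_sobolev_pot s V2 \<and>
     weak_choquard_eq s \<alpha> V1 lam1 \<mu>1 p \<beta> r u v \<and>
     weak_choquard_eq s \<alpha> V2 lam2 \<mu>2 q \<beta> r v u"

definition locally_ess_bounded :: "('a::euclidean_space \<Rightarrow> real) \<Rightarrow> bool" where
  "locally_ess_bounded V \<longleftrightarrow> V \<in> borel_measurable lebesgue \<and>
     (\<forall>K. compact K \<longrightarrow> (\<exists>C. AE x in lebesgue. x \<in> K \<longrightarrow> \<bar>V x\<bar> \<le> C))"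

definition trapping_potential :: "('a::euclidean_space \<Rightarrow> real) \<Rightarrow> bool" where
  "trapping_potential V \<longleftrightarrow>
     (\<forall>x. 0 \<le> V x) \<and> locally_ess_bounded V \<and> filterlim V at_top at_infinity"

end

theory Submission
  imports Defs "HOL-Library.Diagonal_Subsequence"
begin

text \<open>
  A solution is a minimiser of the energy
  \<open>E u / 2 + E v / 2 - \<mu>1 / (2 p) D\<^sub>p(u, u) - \<mu>2 / (2 q) D\<^sub>q(v, v) - \<beta> / r D\<^sub>r(u, v)\<close>
  on the product of the two spheres, where \<open>D\<^sub>r(u, v)\<close> is the double integral of
  \<open>\<bar>x - y\<bar>\<^sup>\<alpha>\<^sup>-\<^sup>n \<bar>u x\<bar>\<^sup>r \<bar>v y\<bar>\<^sup>r\<close> and \<open>E\<close> is the quadratic form of \<open>(-\<Delta>)\<^sup>s + V\<close>.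
  Comparing \<open>u x\<close> with its average over a ball gives
  \<open>\<bar>u x\<bar>\<^sup>2\<^sup>+\<^sup>4\<^sup>s\<^sup>/\<^sup>n \<le> C \<parallel>u\<parallel>\<^sup>4\<^sup>s\<^sup>/\<^sup>n \<integral> \<bar>u x - u y\<bar>\<^sup>2 / \<bar>x - y\<bar>\<^sup>n\<^sup>+\<^sup>2\<^sup>s dy\<close>, hence control of all powers between
  \<open>2\<close> and the mass critical exponent \<open>2 + 4 s / n\<close>.  As \<open>p, q, r\<close> are mass subcritical, Young's
  inequality bounds the \<open>D\<close> terms by a sublinear function of the seminorms, so the energy is
  coercive.  Averages over small balls and the growth of the potentials make bounded sequences
  precompact in \<open>L\<^sup>2\<close>.  Along a minimising sequence of nonnegative functions the quadratic part
  is lower semicontinuous by Fatou's lemma and the \<open>D\<close> terms converge, their Young majorants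
  having convergent integrals.  The first variation at the minimiser is the weak
  equation, the multipliers coming from the normalisation of the perturbed function.
\<close>

subsection \<open>Dominated convergence and singular kernels\<close>

text \<open>Coercivity hinges on the growth of a D term in the seminorm E at fixed mass:
  interpolation between the powers 2 and 2 + 4s/n followed by Young's inequality gives the rate
  E^((r - \<rho>) n / (2s)) with \<rho> close to 1 + \<alpha>/n, and the upper bound on the
  exponents says that this power can be made less than 1. The growth of the potentials excludes loss
  of mass at infinity: convergence in L^2 is strong, so the limit stays on the spheres. Replacing u
  by |u| leaves the D terms and the potential terms unchanged and does not increase the seminorm,
  which is why the minimising sequence may be taken nonnegative. The coefficients \<mu>1/(2p) and
  \<beta>/r reflect that D_p(u, u) varies in both arguments and D_r(u, v) in one at a time; by
  symmetry of the kernel one coupling term serves both equations. The analysis is done for Borel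
  functions on \<open>lborel\<close> and its product, where Fubini's theorem applies directly;
  Lebesgue measurable potentials and test functions are exchanged for Borel representatives only at
  the end.\<close>

lemma generalized_dominated_convergence:
  fixes F H :: "nat \<Rightarrow> 'a \<Rightarrow> real"
  assumes [measurable]: "\<And>n. F n \<in> borel_measurable M" "F0 \<in> borel_measurable M"
    and H: "\<And>n. integrable M (H n)" "integrable M H0"
    and Fl: "AE x in M. (\<lambda>n. F n x) \<longlonglongrightarrow> F0 x"
    and Hl: "AE x in M. (\<lambda>n. H n x) \<longlonglongrightarrow> H0 x"
    and FH: "\<And>n x. 0 \<le> F n x" "\<And>n x. F n x \<le> H n x"
    and Hint: "(\<lambda>n. \<integral>x. H n x \<partial>M) \<longlonglongrightarrow> (\<integral>x. H0 x \<partial>M)"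
  shows "integrable M F0" "(\<lambda>n. \<integral>x. F n x \<partial>M) \<longlonglongrightarrow> (\<integral>x. F0 x \<partial>M)"
proof -
  have Hpos: "0 \<le> H n x" for n x using FH[of n x] by linarith
  have Hm[measurable]: "\<And>n. H n \<in> borel_measurable M" "H0 \<in> borel_measurable M"
    using H by auto
  have H0pos: "AE x in M. 0 \<le> H0 x"
    using Hl by eventually_elim (rule LIMSEQ_le_const, auto simp: Hpos)
  have F0b: "AE x in M. 0 \<le> F0 x \<and> F0 x \<le> H0 x"
    using Hl Fl
  proof eventually_elim
    case (elim x)
    show ?case
      using LIMSEQ_le_const[OF elim(2), of 0] LIMSEQ_le[OF elim(2) elim(1)] FH[of _ x] by auto
  qed
  show F0i: "integrable M F0"
    by (rule Bochner_Integration.integrable_bound[OF H(2)]) (use F0b in \<open>simp_all, eventually_elim, auto\<close>)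
  have Fi: "integrable M (F n)" for n
    by (rule Bochner_Integration.integrable_bound[OF H(1)[of n]]) (use FH Hpos in \<open>auto intro!: AE_I2\<close>)
  have L1: "(\<lambda>n. \<integral>\<^sup>+x. norm (H n x - H0 x) \<partial>M) \<longlonglongrightarrow> 0"
  proof (rule Scheffe_lemma1[OF H Hl])
    have "(\<integral>\<^sup>+x. norm (H n x) \<partial>M) = ennreal (\<integral>x. H n x \<partial>M)" for n
      using nn_integral_eq_integral[OF H(1)[of n]] Hpos by simp
    moreover have "(\<integral>\<^sup>+x. norm (H0 x) \<partial>M) = (\<integral>\<^sup>+x. H0 x \<partial>M)"
      by (rule nn_integral_cong_AE) (use H0pos in \<open>auto elim!: eventually_mono\<close>)
    moreover have "(\<integral>\<^sup>+x. H0 x \<partial>M) = ennreal (\<integral>x. H0 x \<partial>M)"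
      using nn_integral_eq_integral[OF H(2) H0pos] by simp
    ultimately show "limsup (\<lambda>n. \<integral>\<^sup>+x. norm (H n x) \<partial>M) \<le> (\<integral>\<^sup>+x. norm (H0 x) \<partial>M)"
      using tendsto_ennrealI[OF Hint] by (simp add: lim_imp_Limsup)
  qed
  have L1': "(\<lambda>n. \<integral>x. norm (H n x - H0 x) \<partial>M) \<longlonglongrightarrow> 0"
  proof -
    have "(\<integral>\<^sup>+x. norm (H n x - H0 x) \<partial>M) = ennreal (\<integral>x. norm (H n x - H0 x) \<partial>M)" for n
      by (rule nn_integral_eq_integral) (use H in auto)
    then show ?thesis using L1
      by (simp flip: ennreal_0 add: tendsto_ennreal_iff integral_nonneg_AE del: ennreal_0)
  qed
  \<comment> \<open>\<open>F n\<close> is cut off at \<open>H0\<close>, one fixed integrable bound.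
    What is cut off is at most |H n - H0| because \<open>F n\<close> lies below \<open>H n\<close>,
    and that tends to 0 in L^1 by Scheffe's lemma. The \<open>max 0\<close> is there because
    \<open>H0\<close> is nonnegative only almost everywhere.\<close>
  have A: "(\<lambda>n. \<integral>x. min (F n x) (max 0 (H0 x)) \<partial>M) \<longlonglongrightarrow> (\<integral>x. F0 x \<partial>M)"
  proof (rule integral_dominated_convergence[where w="\<lambda>x. max 0 (H0 x)"])
    show "AE x in M. (\<lambda>n. min (F n x) (max 0 (H0 x))) \<longlonglongrightarrow> F0 x"
      using Fl F0b
    proof eventually_elim
      case (elim x)
      have "(\<lambda>n. min (F n x) (max 0 (H0 x))) \<longlonglongrightarrow> min (F0 x) (max 0 (H0 x))"
        by (intro tendsto_intros elim)
      then show ?case using elim by (simp add: min_absorb1 max_def)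
    qed
  qed (use FH H(2) in \<open>auto intro!: AE_I2\<close>)
  have mi: "integrable M (\<lambda>x. min (F n x) (max 0 (H0 x)))" for n
    by (rule Bochner_Integration.integrable_bound[OF Fi[of n]]) (use FH in \<open>auto intro!: AE_I2 simp: min_def\<close>)
  have B: "(\<lambda>n. \<integral>x. F n x - min (F n x) (max 0 (H0 x)) \<partial>M) \<longlonglongrightarrow> 0"
  proof (rule tendsto_sandwich[OF _ _ tendsto_const L1'])
    show "\<forall>\<^sub>F n in sequentially. 0 \<le> (\<integral>x. F n x - min (F n x) (max 0 (H0 x)) \<partial>M)"
      by (intro always_eventually allI integral_nonneg_AE AE_I2) auto
    show "\<forall>\<^sub>F n in sequentially. (\<integral>x. F n x - min (F n x) (max 0 (H0 x)) \<partial>M) \<le> (\<integral>x. norm (H n x - H0 x) \<partial>M)"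
    proof (intro always_eventually allI integral_mono)
      fix n x
      show "F n x - min (F n x) (max 0 (H0 x)) \<le> norm (H n x - H0 x)"
        using FH[of n x] by (auto simp: min_def max_def)
    qed (use Fi mi H in auto)
  qed
  have "(\<lambda>n. \<integral>x. F n x \<partial>M) = (\<lambda>n. (\<integral>x. F n x - min (F n x) (max 0 (H0 x)) \<partial>M) + (\<integral>x. min (F n x) (max 0 (H0 x)) \<partial>M))"
    using Fi mi by (subst Bochner_Integration.integral_diff) auto
  then show "(\<lambda>n. \<integral>x. F n x \<partial>M) \<longlonglongrightarrow> (\<integral>x. F0 x \<partial>M)"
    using tendsto_add[OF B A] by simp
qed

section \<open>Radial power integrals by dyadic shells\<close>

lemma suminf_ennreal_geometric_finite:
  fixes c q :: real
  assumes "0 \<le> c" "0 \<le> q" "q < 1"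
  shows "(\<Sum>k. ennreal (c * q ^ k)) < \<infinity>"
proof -
  have "summable (\<lambda>k. c * q ^ k)" using assms by (intro summable_mult summable_geometric) auto
  then show ?thesis using assms by (simp add: suminf_ennreal2)
qed

lemma term_le_suminf_ennreal: "f i \<le> (\<Sum>k. f k)" for f :: "nat \<Rightarrow> ennreal"
  using sum_le_suminf[of f "{i}"] by simp

text \<open>On the shell (1/2)^(i+1) \<le> |x| < (1/2)^i the integrand is at most
  \<open>c i\<close>, and \<open>c i\<close> times the volume of the ball of radius (1/2)^i is
  geometric with ratio (1/2)^(n - max \<kappa> 0). The \<open>max\<close> admits negative \<kappa>,
  for which the integrand is bounded by 1.\<close>

lemma nn_integral_norm_powr_ball:
  assumes "\<kappa> < real DIM('a)"
  shows "(\<integral>\<^sup>+x. ennreal (indicator (ball 0 1) x * norm (x::'a::euclidean_space) powr (- \<kappa>)) \<partial>lborel) < \<infinity>"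
proof -
  let ?n = "real DIM('a)"
  define c where "c k = (1/2) powr (- max \<kappa> 0) * (((1/2) powr (- max \<kappa> 0)) ^ k)" for k :: nat
  have cpos: "0 \<le> c k" for k by (simp add: c_def)
  have "(\<integral>\<^sup>+x. ennreal (indicator (ball 0 1) x * norm (x::'a) powr (- \<kappa>)) \<partial>lborel)
     \<le> (\<integral>\<^sup>+x. (\<Sum>k. ennreal (c k) * indicator (ball 0 ((1/2)^k)) (x::'a)) \<partial>lborel)"
  proof (rule nn_integral_mono)
    fix x :: 'a
    show "ennreal (indicator (ball 0 1) x * norm x powr (- \<kappa>)) \<le> (\<Sum>k. ennreal (c k) * indicator (ball 0 ((1/2)^k)) x)"
    proof (cases "x \<in> ball 0 1 \<and> x \<noteq> 0")
      case True
      obtain k where k: "(1/2::real)^k \<le> norm x" using real_arch_pow_inv[of "norm x" "1/2"] True by (auto intro: less_imp_le)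
      define j where "j = (LEAST k. (1/2::real)^k \<le> norm x)"
      have j: "(1/2)^j \<le> norm x" unfolding j_def by (rule LeastI) (rule k)
      have "j \<noteq> 0" using j True by (intro notI) auto
      then obtain i where i: "j = Suc i" by (cases j) auto
      have i2: "norm x < (1/2)^i" using not_less_Least[of i "\<lambda>k. (1/2::real)^k \<le> norm x"] i unfolding j_def by auto
      have "norm x powr (- \<kappa>) \<le> c i"
      proof (cases "\<kappa> \<ge> 0")
        case True
        have "norm x powr (- \<kappa>) \<le> ((1/2)^j) powr (- \<kappa>)"
          using True j by (intro powr_mono2') auto
        also have "\<dots> = c i" using True
          by (simp add: i c_def powr_power powr_powr powr_add[symmetric] algebra_simps del: power_Suc flip: powr_realpow)
        finally show ?thesis .
      next
        case False
        then have "norm x powr (- \<kappa>) \<le> 1 powr (- \<kappa>)" using True by (intro powr_mono2) auto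
        then show ?thesis using False by (simp add: c_def)
      qed
      then have "ennreal (indicator (ball 0 1) x * norm x powr (- \<kappa>)) \<le> ennreal (c i) * indicator (ball 0 ((1/2)^i)) x"
        using True i2 by (simp add: ennreal_leI)
      also have "\<dots> \<le> (\<Sum>k. ennreal (c k) * indicator (ball 0 ((1/2)^k)) x)"
        by (rule term_le_suminf_ennreal)
      finally show ?thesis .
    qed auto
  qed
  also have "\<dots> = (\<Sum>k. ennreal (c k) * emeasure lborel (ball (0::'a) ((1/2)^k)))"
    by (subst nn_integral_suminf) (auto simp: nn_integral_cmult_indicator intro!: borel_measurable_times_ennreal borel_measurable_indicator)
  also have "\<dots> = (\<Sum>k. ennreal (((1/2) powr (- max \<kappa> 0) * unit_ball_vol ?n) * (((1/2) powr (?n - max \<kappa> 0)) ^ k)))"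
  proof (rule suminf_cong)
    fix k
    have "((1/2::real) powr (?n - max \<kappa> 0)) ^ k = ((1/2) powr (- max \<kappa> 0)) ^ k * ((1/2) ^ k) ^ DIM('a)"
      by (simp add: powr_power powr_powr powr_add[symmetric] algebra_simps flip: powr_realpow)
    then show "ennreal (c k) * emeasure lborel (ball (0::'a) ((1/2)^k)) = ennreal (((1/2) powr (- max \<kappa> 0) * unit_ball_vol ?n) * (((1/2) powr (?n - max \<kappa> 0)) ^ k))"
      by (simp add: emeasure_ball c_def ennreal_mult[symmetric] cpos mult_ac)
  qed
  also have "\<dots> < \<infinity>"
  proof (rule suminf_ennreal_geometric_finite)
    show "(1/2::real) powr (?n - max \<kappa> 0) < 1" using assms by (auto simp: powr_def mult_less_0_iff ln_div max_def)
  qed auto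
  finally show ?thesis .
qed

text \<open>The shells are now 2^i \<le> |x| < 2^(i+1), each enclosed in the ball of radius 2 * 2^i,
  and the ratio of the series is 2^(n - \<kappa>).\<close>

lemma nn_integral_norm_powr_outside_ball:
  assumes "real DIM('a) < \<kappa>"
  shows "(\<integral>\<^sup>+x. ennreal (indicator (- ball 0 1) x * norm (x::'a::euclidean_space) powr (- \<kappa>)) \<partial>lborel) < \<infinity>"
proof -
  let ?n = "real DIM('a)"
  define c where "c k = (2 powr (- \<kappa>)) ^ k" for k :: nat
  have cpos: "0 \<le> c k" for k by (simp add: c_def)
  have kp: "0 < \<kappa>" using assms by (smt (verit) of_nat_0_le_iff)
  have "(\<integral>\<^sup>+x. ennreal (indicator (- ball 0 1) x * norm (x::'a) powr (- \<kappa>)) \<partial>lborel)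
     \<le> (\<integral>\<^sup>+x. (\<Sum>k. ennreal (c k) * indicator (ball 0 (2 * 2^k)) (x::'a)) \<partial>lborel)"
  proof (rule nn_integral_mono)
    fix x :: 'a
    show "ennreal (indicator (- ball 0 1) x * norm x powr (- \<kappa>)) \<le> (\<Sum>k. ennreal (c k) * indicator (ball 0 (2 * 2^k)) x)"
    proof (cases "x \<in> - ball 0 1")
      case True
      obtain k where k: "norm x < 2^k" using real_arch_pow[of 2 "norm x"] by auto
      define j where "j = (LEAST k. norm x < (2::real)^k)"
      have j: "norm x < 2^j" unfolding j_def by (rule LeastI) (rule k)
      have "j \<noteq> 0" using j True by (intro notI) auto
      then obtain i where i: "j = Suc i" by (cases j) auto
      have i2: "2^i \<le> norm x" using not_less_Least[of i "\<lambda>k. norm x < (2::real)^k"] i unfolding j_def by auto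
      have "norm x powr (- \<kappa>) \<le> (2^i) powr (- \<kappa>)"
        using kp i2 by (intro powr_mono2') auto
      also have "\<dots> = c i"
        by (simp add: c_def powr_power powr_powr mult_ac flip: powr_realpow)
      finally have "ennreal (indicator (- ball 0 1) x * norm x powr (- \<kappa>)) \<le> ennreal (c i) * indicator (ball 0 (2 * 2^i)) x"
        using True j i by (simp add: ennreal_leI)
      also have "\<dots> \<le> (\<Sum>k. ennreal (c k) * indicator (ball 0 (2*2^k)) x)"
        by (rule term_le_suminf_ennreal)
      finally show ?thesis .
    qed auto
  qed
  also have "\<dots> = (\<Sum>k. ennreal (c k) * emeasure lborel (ball (0::'a) (2*2^k)))"
    by (subst nn_integral_suminf) (auto simp: nn_integral_cmult_indicator intro!: borel_measurable_times_ennreal borel_measurable_indicator)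
  also have "\<dots> = (\<Sum>k. ennreal ((unit_ball_vol ?n * 2 ^ DIM('a)) * ((2 powr (?n - \<kappa>)) ^ k)))"
  proof (rule suminf_cong)
    fix k
    have "(2 powr (?n - \<kappa>)) ^ k = (2 powr (- \<kappa>)) ^ k * (2 ^ k) ^ DIM('a)"
      by (simp add: powr_power powr_powr powr_add[symmetric] algebra_simps flip: powr_realpow)
    then show "ennreal (c k) * emeasure lborel (ball (0::'a) (2*2^k)) = ennreal ((unit_ball_vol ?n * 2 ^ DIM('a)) * ((2 powr (?n - \<kappa>)) ^ k))"
      by (simp add: emeasure_ball c_def ennreal_mult[symmetric] cpos mult_ac power_mult_distrib)
  qed
  also have "\<dots> < \<infinity>"
  proof (rule suminf_ennreal_geometric_finite)
    show "2 powr (?n - \<kappa>) < 1" using assms by (auto simp: powr_def mult_less_0_iff)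
  qed auto
  finally show ?thesis .
qed

text \<open>Young's convolution inequality with the exponents \<open>1 / (2 - \<rho>)\<close>, \<open>2 / \<rho>\<close>, \<open>2 / \<rho>\<close>, before integration.\<close>

lemma young_pointwise:
  fixes K f g \<rho> :: real
  assumes "1 < \<rho>" "\<rho> < 2" "0 \<le> K" "0 \<le> f" "0 \<le> g"
  shows "K * f * g \<le> f powr (2/\<rho>) * g powr (2/\<rho>) + K powr (1/(2-\<rho>)) * (f powr (2/\<rho>) + g powr (2/\<rho>))"
proof (cases "K = 0 \<or> f = 0 \<or> g = 0")
  case True
  then show ?thesis using assms by auto
next
  case False
  then have pos: "K > 0" "f > 0" "g > 0" using assms by auto
  define X where "X = f powr (2/\<rho>) * g powr (2/\<rho>)"
  define Y where "Y = K powr (1/(2-\<rho>)) * f powr (2/\<rho>)"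
  define Z where "Z = K powr (1/(2-\<rho>)) * g powr (2/\<rho>)"
  define S where "S = X + Y + Z"
  have XYZ: "X > 0" "Y > 0" "Z > 0" using pos by (auto simp: X_def Y_def Z_def)
  \<comment> \<open>The weights \<rho> - 1, 1 - \<rho>/2, 1 - \<rho>/2 are positive and add up to 1,
    so the product is a weighted geometric mean of \<open>X\<close>, \<open>Y\<close>,
    \<open>Z\<close>. Each of these is at most their sum \<open>S\<close>, hence so is the
    mean.\<close>
  have "ln (K * f * g) = (\<rho> - 1) * ln X + (1 - \<rho>/2) * ln Y + (1 - \<rho>/2) * ln Z"
  proof -
    have l: "ln X = 2/\<rho> * (ln f + ln g)" "ln Y = 1/(2-\<rho>) * ln K + 2/\<rho> * ln f" "ln Z = 1/(2-\<rho>) * ln K + 2/\<rho> * ln g"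
      using pos by (auto simp: X_def Y_def Z_def ln_mult ln_powr distrib_left)
    have "(\<rho> - 1) * ln X + (1 - \<rho>/2) * ln Y + (1 - \<rho>/2) * ln Z = ((2-\<rho>) * (1/(2-\<rho>))) * ln K + (\<rho> / 2 * (2/\<rho>)) * (ln f + ln g)"
      unfolding l by algebra
    also have "\<dots> = ln K + ln f + ln g" using assms by simp
    finally show ?thesis using pos by (simp add: ln_mult)
  qed
  also have "\<dots> \<le> (\<rho> - 1) * ln S + (1 - \<rho>/2) * ln S + (1 - \<rho>/2) * ln S"
    using XYZ assms by (intro add_mono mult_left_mono) (auto simp: S_def)
  also have "\<dots> = ln S" by (simp add: algebra_simps)
  finally have "K * f * g \<le> S" using pos XYZ by (subst (asm) ln_le_cancel_iff) (auto simp: S_def add_pos_pos)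
  then show ?thesis by (simp add: S_def X_def Y_def Z_def algebra_simps)
qed

subsection \<open>The Gagliardo-Nirenberg inequality\<close>

lemma nn_integral_lborel_shift:
  fixes f :: "'a::euclidean_space \<Rightarrow> ennreal"
  assumes [measurable]: "f \<in> borel_measurable borel"
  shows "(\<integral>\<^sup>+x. f (x - t) \<partial>lborel) = (\<integral>\<^sup>+x. f x \<partial>lborel)"
proof -
  have "(\<integral>\<^sup>+x. f (x - t) \<partial>lborel) = (\<integral>\<^sup>+x. f (x - t) \<partial>distr lborel borel ((+) t))"
    by (simp add: lborel_distr_plus)
  then show ?thesis by (simp add: nn_integral_distr)
qed

lemma nn_integral_lborel_reflect:
  fixes f :: "'a::euclidean_space \<Rightarrow> ennreal"
  assumes [measurable]: "f \<in> borel_measurable borel"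
  shows "(\<integral>\<^sup>+x. f (t - x) \<partial>lborel) = (\<integral>\<^sup>+x. f x \<partial>lborel)"
proof -
  have "lborel = distr lborel borel (\<lambda>x. t - x)"
    using lborel_affine[of "-1" t] by (simp add: density_1)
  then have "(\<integral>\<^sup>+x. f (t - x) \<partial>lborel) = (\<integral>\<^sup>+x. f (t - x) \<partial>distr lborel borel (\<lambda>x. t - x))"
    by simp
  then show ?thesis by (simp add: nn_integral_distr)
qed

text \<open>Below the threshold \<Lambda> one has t^(m-2) \<le> \<Lambda>^(m-2), above it t^(m-M)
  \<le> \<Lambda>^(m-M). The threshold stays free so that it can be tuned to the energy or to a
  prescribed error.\<close>

lemma interpolation_powr:
  fixes t \<Lambda> m M :: real
  assumes "0 \<le> t" "0 < \<Lambda>" "2 \<le> m" "m \<le> M"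
  shows "t powr m \<le> \<Lambda> powr (m - 2) * t\<^sup>2 + \<Lambda> powr (m - M) * t powr M"
proof (cases "t = 0")
  case False
  then have t: "t > 0" using assms by auto
  show ?thesis
  proof (cases "t \<le> \<Lambda>")
    case True
    have "t powr m = t powr (m - 2) * t\<^sup>2"
      using t by (simp add: powr_diff)
    also have "\<dots> \<le> \<Lambda> powr (m - 2) * t\<^sup>2"
      using True t assms by (intro mult_right_mono powr_mono2) auto
    finally show ?thesis using t by (smt (verit) mult_nonneg_nonneg powr_ge_zero)
  next
    case F: False
    have "t powr m = t powr (m - M) * t powr M"
      using t by (simp add: powr_diff)
    also have "\<dots> \<le> \<Lambda> powr (m - M) * t powr M"
      using F t assms by (intro mult_right_mono powr_mono2') auto
    finally show ?thesis using t by (smt (verit) mult_nonneg_nonneg powr_ge_zero zero_le_power2)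
  qed
qed auto

text \<open>Valued in \<open>ennreal\<close>, so that bounds by the energy can be stated before it
  is known to be finite.\<close>

definition gagliardo_energy :: "real \<Rightarrow> ('a::euclidean_space \<Rightarrow> real) \<Rightarrow> ennreal" where
  "gagliardo_energy s u = (\<integral>\<^sup>+z. ennreal (gagliardo_quotient s u u z) \<partial>(lborel \<Otimes>\<^sub>M lborel))"

lemma gagliardo_quotient_nonneg: "0 \<le> gagliardo_quotient s u u z"
  by (auto simp: gagliardo_quotient_def split_beta)

lemma gagliardo_quotient_measurable[measurable (raw)]:
  fixes u w :: "'a::euclidean_space \<Rightarrow> real"
  assumes [measurable]: "u \<in> borel_measurable borel" "w \<in> borel_measurable borel"
  shows "gagliardo_quotient s u w \<in> borel_measurable (lborel \<Otimes>\<^sub>M lborel)"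
  unfolding gagliardo_quotient_def by measurable

lemma gagliardo_energy_iterated:
  fixes u :: "'a::euclidean_space \<Rightarrow> real"
  assumes [measurable]: "u \<in> borel_measurable borel"
  shows "gagliardo_energy s u =
    (\<integral>\<^sup>+x. \<integral>\<^sup>+y. ennreal ((u x - u y)\<^sup>2 / norm (x - y) powr (real DIM('a) + 2 * s)) \<partial>lborel \<partial>lborel)"
  unfolding gagliardo_energy_def
  by (subst lborel.nn_integral_fst[symmetric]) (simp_all add: gagliardo_quotient_def power2_eq_square)

text \<open>Compare \<open>u x\<close> with the average of \<open>u\<close> over a ball around \<open>x\<close> whose radius is
  so large that the average is at most half of \<open>\<bar>u x\<bar>\<close>.\<close>

lemma gagliardo_nirenberg_pointwise:
  fixes u :: "'a::euclidean_space \<Rightarrow> real" and x :: 'a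
  defines "n \<equiv> real DIM('a)"
  defines "\<omega> \<equiv> unit_ball_vol n"
  assumes [measurable]: "u \<in> borel_measurable borel"
    and s: "0 < s" and c: "0 < c" and mass: "(\<integral>\<^sup>+y. ennreal ((u y)\<^sup>2) \<partial>lborel) \<le> ennreal c"
  shows "ennreal (\<bar>u x\<bar> powr (2 + 4 * s / n)) \<le>
     ennreal (4 / \<omega> * (4 * c / \<omega>) powr (2 * s / n)) *
       (\<integral>\<^sup>+y. ennreal ((u x - u y)\<^sup>2 / norm (x - y) powr (n + 2 * s)) \<partial>lborel)"
    (is "_ \<le> ennreal ?C * ?G")
proof (cases "u x = 0")
  case False
  define h where "h = \<bar>u x\<bar>"
  have h: "h > 0" using False by (simp add: h_def)
  have n: "n > 0" by (simp add: n_def)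
  have \<omega>: "\<omega> > 0" unfolding \<omega>_def n_def by simp
  \<comment> \<open>The radius is chosen so that h^2 times the volume of the ball equals 4c. After
    h^2 \<le> 2 (u x - u y)^2 + 2 (u y)^2 the mass absorbs at most 2c of this, and the difference
    quotients must account for the rest.\<close>
  define \<delta> where "\<delta> = (4 * c / (\<omega> * h\<^sup>2)) powr (1 / n)"
  have \<delta>: "\<delta> > 0" using c \<omega> h by (simp add: \<delta>_def)
  have \<delta>n: "\<delta> powr n = 4 * c / (\<omega> * h\<^sup>2)" using n c \<omega> h by (simp add: \<delta>_def powr_powr)
  have em: "emeasure lborel (ball x \<delta>) = ennreal (\<omega> * \<delta> powr n)"
    using \<delta> by (simp add: emeasure_ball \<omega>_def n_def powr_realpow)
  have "ennreal (4 * c) = ennreal (h\<^sup>2) * emeasure lborel (ball x \<delta>)"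
    unfolding em using \<delta>n \<omega> h c by (simp flip: ennreal_mult)
  also have "\<dots> = (\<integral>\<^sup>+y. ennreal (h\<^sup>2) * indicator (ball x \<delta>) y \<partial>lborel)"
    by (simp add: nn_integral_cmult_indicator)
  also have "\<dots> \<le> (\<integral>\<^sup>+y. ennreal (2 * \<delta> powr (n + 2 * s)) * ennreal ((u x - u y)\<^sup>2 / norm (x - y) powr (n + 2 * s)) + ennreal 2 * ennreal ((u y)\<^sup>2) \<partial>lborel)"
  proof (rule nn_integral_mono)
    fix y :: 'a
    have a: "h\<^sup>2 \<le> 2 * (u x - u y)\<^sup>2 + 2 * (u y)\<^sup>2"
      using sum_squares_bound[of "u x - 2 * u y" 0] zero_le_power2[of "u x - 2 * u y"]
      unfolding h_def by (simp add: power2_eq_square algebra_simps)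
    show "ennreal (h\<^sup>2) * indicator (ball x \<delta>) y \<le> ennreal (2 * \<delta> powr (n + 2 * s)) * ennreal ((u x - u y)\<^sup>2 / norm (x - y) powr (n + 2 * s)) + ennreal 2 * ennreal ((u y)\<^sup>2)"
    proof (cases "y \<in> ball x \<delta>")
      case True
      have "(u x - u y)\<^sup>2 \<le> \<delta> powr (n + 2 * s) * ((u x - u y)\<^sup>2 / norm (x - y) powr (n + 2 * s))"
      proof (cases "x = y")
        case False
        have "norm (x - y) powr (n + 2 * s) \<le> \<delta> powr (n + 2 * s)"
          using True n s by (intro powr_mono2) (auto simp: dist_norm)
        then have "(u x - u y)\<^sup>2 * norm (x - y) powr (n + 2 * s) \<le> \<delta> powr (n + 2 * s) * (u x - u y)\<^sup>2"
          by (subst mult.commute, intro mult_right_mono) auto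
        then show ?thesis using False by (simp add: field_simps)
      qed simp
      with a have "h\<^sup>2 \<le> 2 * \<delta> powr (n + 2 * s) * ((u x - u y)\<^sup>2 / norm (x - y) powr (n + 2 * s)) + 2 * (u y)\<^sup>2"
        by linarith
      then show ?thesis using True
        by (simp flip: ennreal_mult ennreal_plus add: ennreal_leI del: ennreal_numeral)
    qed auto
  qed
  also have "\<dots> = ennreal (2 * \<delta> powr (n + 2 * s)) * ?G + ennreal 2 * (\<integral>\<^sup>+y. ennreal ((u y)\<^sup>2) \<partial>lborel)"
    by (subst nn_integral_add) (simp_all add: nn_integral_cmult del: ennreal_numeral)
  also have "\<dots> \<le> ennreal (2 * \<delta> powr (n + 2 * s)) * ?G + ennreal 2 * ennreal c"
    by (intro add_left_mono mult_left_mono mass) auto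
  finally have main: "ennreal (4 * c) \<le> ennreal (2 * \<delta> powr (n + 2 * s)) * ?G + ennreal (2 * c)"
    using c by (simp flip: ennreal_mult del: ennreal_numeral)
  have C: "?C > 0" using \<omega> c by simp
  show ?thesis
  proof (cases "?G = \<infinity>")
    case True
    have "ennreal ?C * ?G = \<infinity>" using True C c \<omega> by (simp add: ennreal_mult_eq_top_iff)
    then show ?thesis by simp
  next
    case False
    then obtain g where g: "?G = ennreal g" "g \<ge> 0" by (cases "?G") (auto simp: top_unique)
    have "4 * c \<le> 2 * \<delta> powr (n + 2 * s) * g + 2 * c"
      using main c g unfolding g(1)
      by (simp flip: ennreal_mult ennreal_plus add: ennreal_le_iff)
    then have "c \<le> \<delta> powr n * \<delta> powr (2 * s) * g" by (simp add: powr_add)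
    \<comment> \<open>\<delta>^n contributes h^(-2) and \<delta>^(2s) contributes h^(-4s/n): this is
      the origin of the exponent 2 + 4s/n and of the constant.\<close>
    also have "\<delta> powr (2 * s) = (4 * c / \<omega>) powr (2 * s / n) * h powr (- (4 * s / n))"
    proof -
      have "\<delta> powr (2 * s) = (4 * c / \<omega> / h\<^sup>2) powr (2 * s / n)"
        by (simp add: \<delta>_def powr_powr)
      also have "\<dots> = (4 * c / \<omega>) powr (2 * s / n) / (h powr 2) powr (2 * s / n)"
        using c \<omega> h by (subst powr_divide) auto
      also have "(h powr 2) powr (2 * s / n) = h powr (4 * s / n)"
        by (simp only: powr_powr) simp
      finally show ?thesis by (simp add: powr_minus divide_inverse)
    qed
    finally have "c \<le> 4 * c / (\<omega> * h\<^sup>2) * ((4 * c / \<omega>) powr (2 * s / n) * h powr (- (4 * s / n))) * g"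
      using \<delta>n by simp
    then have "1 \<le> ?C * g / (h\<^sup>2 * h powr (4 * s / n))"
      using c \<omega> h by (simp add: powr_minus field_simps)
    then have "h powr (2 + 4 * s / n) \<le> ?C * g"
      using h \<omega> by (simp add: powr_add field_simps)
    then show ?thesis using C g by (simp add: h_def ennreal_mult[symmetric] ennreal_leI)
  qed
qed simp

text \<open>For this exponent the bound is linear in the energy, with a factor that depends only on
  the mass and the dimension and s; on a sphere of fixed mass it is a constant.\<close>

lemma gagliardo_nirenberg:
  fixes u :: "'a::euclidean_space \<Rightarrow> real"
  defines "n \<equiv> real DIM('a)"
  defines "\<omega> \<equiv> unit_ball_vol n"
  assumes [measurable]: "u \<in> borel_measurable borel"
    and s: "0 < s" and c: "0 < c" and mass: "(\<integral>\<^sup>+y. ennreal ((u y)\<^sup>2) \<partial>lborel) \<le> ennreal c"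
  shows "(\<integral>\<^sup>+x. ennreal (\<bar>u x\<bar> powr (2 + 4 * s / n)) \<partial>lborel) \<le>
     ennreal (4 / \<omega> * (4 * c / \<omega>) powr (2 * s / n)) * gagliardo_energy s u"
proof -
  have "(\<integral>\<^sup>+x. ennreal (\<bar>u x\<bar> powr (2 + 4 * s / n)) \<partial>lborel) \<le>
    (\<integral>\<^sup>+x. ennreal (4 / \<omega> * (4 * c / \<omega>) powr (2 * s / n)) *
       (\<integral>\<^sup>+y. ennreal ((u x - u y)\<^sup>2 / norm (x - y) powr (n + 2 * s)) \<partial>lborel) \<partial>lborel)"
    unfolding n_def \<omega>_def
    by (intro nn_integral_mono gagliardo_nirenberg_pointwise) (use assms in auto)
  also have "\<dots> = ennreal (4 / \<omega> * (4 * c / \<omega>) powr (2 * s / n)) * gagliardo_energy s u"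
    by (subst nn_integral_cmult) (simp_all add: gagliardo_energy_iterated n_def)
  finally show ?thesis .
qed


subsection \<open>The Riesz energy\<close>

lemma nn_integral_eq_integrableD:
  fixes f :: "'a \<Rightarrow> real"
  assumes "f \<in> borel_measurable M" "\<And>x. 0 \<le> f x" "(\<integral>\<^sup>+x. ennreal (f x) \<partial>M) = ennreal c" "0 \<le> c"
  shows "integrable M f" "integral\<^sup>L M f = c"
  using nn_integral_eq_integrable[of f M c] assms by auto

text \<open>Tonelli: integrating out the variable on which \<open>f\<close> does not depend leaves
  the full integral of \<open>h\<close>, by invariance under translation and reflection.\<close>

lemma nn_integral_lborel_pair_convolution:
  fixes f h :: "'a::euclidean_space \<Rightarrow> ennreal"
  assumes [measurable]: "f \<in> borel_measurable borel" "h \<in> borel_measurable borel"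
  shows "(\<integral>\<^sup>+(x, y). h (x - y) * f x \<partial>(lborel \<Otimes>\<^sub>M lborel)) = (\<integral>\<^sup>+x. h x \<partial>lborel) * (\<integral>\<^sup>+x. f x \<partial>lborel)"
    "(\<integral>\<^sup>+(x, y). h (x - y) * f y \<partial>(lborel \<Otimes>\<^sub>M lborel)) = (\<integral>\<^sup>+x. h x \<partial>lborel) * (\<integral>\<^sup>+x. f x \<partial>lborel)"
proof -
  have "(\<integral>\<^sup>+(x, y). h (x - y) * f x \<partial>(lborel \<Otimes>\<^sub>M lborel)) = (\<integral>\<^sup>+x. \<integral>\<^sup>+y. h (x - y) * f x \<partial>lborel \<partial>lborel)"
    by (subst lborel.nn_integral_fst[symmetric]) simp_all
  also have "\<dots> = (\<integral>\<^sup>+x. (\<integral>\<^sup>+y. h y \<partial>lborel) * f x \<partial>lborel)"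
    by (simp add: nn_integral_multc nn_integral_lborel_reflect)
  finally show "(\<integral>\<^sup>+(x, y). h (x - y) * f x \<partial>(lborel \<Otimes>\<^sub>M lborel)) = (\<integral>\<^sup>+x. h x \<partial>lborel) * (\<integral>\<^sup>+x. f x \<partial>lborel)"
    by (simp add: nn_integral_cmult)
  have "(\<integral>\<^sup>+(x, y). h (x - y) * f y \<partial>(lborel \<Otimes>\<^sub>M lborel)) = (\<integral>\<^sup>+y. \<integral>\<^sup>+x. h (x - y) * f y \<partial>lborel \<partial>lborel)"
    by (subst lborel_pair.nn_integral_snd[symmetric]) simp_all
  also have "\<dots> = (\<integral>\<^sup>+y. (\<integral>\<^sup>+x. h x \<partial>lborel) * f y \<partial>lborel)"
    by (simp add: nn_integral_multc nn_integral_lborel_shift)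
  finally show "(\<integral>\<^sup>+(x, y). h (x - y) * f y \<partial>(lborel \<Otimes>\<^sub>M lborel)) = (\<integral>\<^sup>+x. h x \<partial>lborel) * (\<integral>\<^sup>+x. f x \<partial>lborel)"
    by (simp add: nn_integral_cmult)
qed

text \<open>The exact value is recorded, and not only a bound, because dominated convergence with
  varying majorants asks for convergence of their integrals; by this formula it reduces to
  convergence of the integrals of \<open>f\<close> and \<open>g\<close>.\<close>

lemma young_majorant_integral:
  fixes f g h :: "'a::euclidean_space \<Rightarrow> real"
  assumes f: "integrable lborel f" "\<And>x. 0 \<le> f x"
    and g: "integrable lborel g" "\<And>x. 0 \<le> g x"
    and h: "integrable lborel h" "\<And>x. 0 \<le> h x"
  shows "integrable (lborel \<Otimes>\<^sub>M lborel) (\<lambda>(x, y). f x * g y + h (x - y) * (f x + g y))"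
    "(\<integral>(x, y). f x * g y + h (x - y) * (f x + g y) \<partial>(lborel \<Otimes>\<^sub>M lborel)) =
      integral\<^sup>L lborel f * integral\<^sup>L lborel g + integral\<^sup>L lborel h * (integral\<^sup>L lborel f + integral\<^sup>L lborel g)"
proof -
  let ?F = "\<lambda>(x, y). f x * g y + h (x - y) * (f x + g y)"
  let ?v = "integral\<^sup>L lborel f * integral\<^sup>L lborel g + integral\<^sup>L lborel h * (integral\<^sup>L lborel f + integral\<^sup>L lborel g)"
  have [measurable]: "f \<in> borel_measurable borel" "g \<in> borel_measurable borel" "h \<in> borel_measurable borel"
    using borel_measurable_integrable[OF f(1)] borel_measurable_integrable[OF g(1)] borel_measurable_integrable[OF h(1)] by simp_all
  have v: "0 \<le> integral\<^sup>L lborel f" "0 \<le> integral\<^sup>L lborel g" "0 \<le> integral\<^sup>L lborel h"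
    using f g h by (simp_all add: integral_nonneg_AE)
  have nn: "(\<integral>\<^sup>+x. f x \<partial>lborel) = ennreal (integral\<^sup>L lborel f)" "(\<integral>\<^sup>+x. g x \<partial>lborel) = ennreal (integral\<^sup>L lborel g)"
     "(\<integral>\<^sup>+x. h x \<partial>lborel) = ennreal (integral\<^sup>L lborel h)"
    using f g h by (simp_all add: nn_integral_eq_integral)
  have 1: "(\<integral>\<^sup>+(x, y). ennreal (f x) * ennreal (g y) \<partial>(lborel \<Otimes>\<^sub>M lborel)) = (\<integral>\<^sup>+x. f x \<partial>lborel) * (\<integral>\<^sup>+x. g x \<partial>lborel)"
    by (subst lborel.nn_integral_fst[symmetric]) (simp_all add: nn_integral_cmult nn_integral_multc)
  have "(\<integral>\<^sup>+z. ennreal (?F z) \<partial>(lborel \<Otimes>\<^sub>M lborel)) =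
    (\<integral>\<^sup>+z. (case z of (x, y) \<Rightarrow> ennreal (f x) * ennreal (g y)) +
       ((case z of (x, y) \<Rightarrow> ennreal (h (x - y)) * ennreal (f x)) + (case z of (x, y) \<Rightarrow> ennreal (h (x - y)) * ennreal (g y))) \<partial>(lborel \<Otimes>\<^sub>M lborel))"
    using f(2) g(2) h(2) by (intro nn_integral_cong) (auto simp flip: ennreal_mult ennreal_plus simp: distrib_left)
  also have "\<dots> = ennreal ?v"
    by (subst nn_integral_add, simp, simp)
       (subst nn_integral_add, simp, simp,
        simp add: 1 nn_integral_lborel_pair_convolution[of "\<lambda>x. ennreal (f x)" "\<lambda>x. ennreal (h x)"]
          nn_integral_lborel_pair_convolution[of "\<lambda>x. ennreal (g x)" "\<lambda>x. ennreal (h x)"] nn v distrib_left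
          flip: ennreal_mult ennreal_plus)
  finally have e: "(\<integral>\<^sup>+z. ennreal (?F z) \<partial>(lborel \<Otimes>\<^sub>M lborel)) = ennreal ?v" .
  have p: "0 \<le> ?F z" for z using f(2) g(2) h(2) by (auto simp: split_beta)
  show "integrable (lborel \<Otimes>\<^sub>M lborel) ?F" "integral\<^sup>L (lborel \<Otimes>\<^sub>M lborel) ?F = ?v"
    using nn_integral_eq_integrableD[OF _ p e] v by simp_all
qed

section \<open>Double integrals against kernels of Young type\<close>

definition kernel_form :: "('a::euclidean_space \<Rightarrow> real) \<Rightarrow> real \<Rightarrow> ('a \<Rightarrow> real) \<Rightarrow> ('a \<Rightarrow> real) \<Rightarrow> real" where
  "kernel_form k r w z = (\<integral>(x, y). k (x - y) * \<bar>w x\<bar> powr r * \<bar>z y\<bar> powr r \<partial>(lborel \<Otimes>\<^sub>M lborel))"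

text \<open>The exponents are those of Young's convolution inequality: (2 - \<rho>) + \<rho>/2 +
  \<rho>/2 = 2, with the kernel in L^(1/(2-\<rho>)) and |w|^r, |z|^r in L^(2/\<rho>). So w and z
  enter through the integral of their power 2r/\<rho>.\<close>

locale young_kernel =
  fixes k :: "'a::euclidean_space \<Rightarrow> real" and r \<rho> :: real
  assumes k_meas[measurable]: "k \<in> borel_measurable borel"
    and k_nonneg: "\<And>x. 0 \<le> k x"
    and \<rho>: "1 < \<rho>" "\<rho> < 2"
    and k_int: "integrable lborel (\<lambda>x. k x powr (1 / (2 - \<rho>)))"
    and r_pos: "0 < r"
begin

definition majorant :: "('a \<Rightarrow> real) \<Rightarrow> ('a \<Rightarrow> real) \<Rightarrow> 'a \<times> 'a \<Rightarrow> real" where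
  "majorant w z = (\<lambda>(x, y). \<bar>w x\<bar> powr (2 * r / \<rho>) * \<bar>z y\<bar> powr (2 * r / \<rho>) +
      k (x - y) powr (1 / (2 - \<rho>)) * (\<bar>w x\<bar> powr (2 * r / \<rho>) + \<bar>z y\<bar> powr (2 * r / \<rho>)))"

definition kernel_mass :: real where
  "kernel_mass = (\<integral>x. k x powr (1 / (2 - \<rho>)) \<partial>lborel)"

lemma kernel_mass_nonneg: "0 \<le> kernel_mass"
  by (simp add: kernel_mass_def)

lemma le_majorant: "k (x - y) * \<bar>w x\<bar> powr r * \<bar>z y\<bar> powr r \<le> majorant w z (x, y)"
  using young_pointwise[OF \<rho> k_nonneg, of "\<bar>w x\<bar> powr r" "\<bar>z y\<bar> powr r" "x - y"]
  by (simp add: majorant_def powr_powr mult_ac)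

lemma majorant_integral:
  assumes "integrable lborel (\<lambda>x. \<bar>w x\<bar> powr (2 * r / \<rho>))" "integrable lborel (\<lambda>x. \<bar>z x\<bar> powr (2 * r / \<rho>))"
  shows "integrable (lborel \<Otimes>\<^sub>M lborel) (majorant w z)"
    "integral\<^sup>L (lborel \<Otimes>\<^sub>M lborel) (majorant w z) =
       (\<integral>x. \<bar>w x\<bar> powr (2 * r / \<rho>) \<partial>lborel) * (\<integral>x. \<bar>z x\<bar> powr (2 * r / \<rho>) \<partial>lborel)
       + kernel_mass * ((\<integral>x. \<bar>w x\<bar> powr (2 * r / \<rho>) \<partial>lborel) + (\<integral>x. \<bar>z x\<bar> powr (2 * r / \<rho>) \<partial>lborel))"
  using young_majorant_integral[OF assms(1) _ assms(2) _ k_int]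
  by (simp_all add: majorant_def kernel_mass_def)

lemma form_integrable:
  assumes [measurable]: "w \<in> borel_measurable borel" "z \<in> borel_measurable borel"
    and "integrable lborel (\<lambda>x. \<bar>w x\<bar> powr (2 * r / \<rho>))" "integrable lborel (\<lambda>x. \<bar>z x\<bar> powr (2 * r / \<rho>))"
  shows "integrable (lborel \<Otimes>\<^sub>M lborel) (\<lambda>(x, y). k (x - y) * \<bar>w x\<bar> powr r * \<bar>z y\<bar> powr r)"
  by (rule Bochner_Integration.integrable_bound[OF majorant_integral(1)[of w z]])
     (use assms le_majorant[of _ _ w z] k_nonneg in \<open>auto intro!: AE_I2 order.trans[OF le_majorant]\<close>)

text \<open>The form is homogeneous and the majorant is not. Dividing both functions by A with
  A^(2r/\<rho>) = B brings their integrals below 1, where the majorant is bounded by a constant;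
  undoing the scaling produces the factor A^(2r) = B^\<rho>, whose exponent decides
  coercivity.\<close>

lemma form_le:
  assumes [measurable]: "w \<in> borel_measurable borel" "z \<in> borel_measurable borel"
    and wz: "integrable lborel (\<lambda>x. \<bar>w x\<bar> powr (2 * r / \<rho>))" "integrable lborel (\<lambda>x. \<bar>z x\<bar> powr (2 * r / \<rho>))"
    and B: "(\<integral>x. \<bar>w x\<bar> powr (2 * r / \<rho>) \<partial>lborel) \<le> B" "(\<integral>x. \<bar>z x\<bar> powr (2 * r / \<rho>) \<partial>lborel) \<le> B" "0 < B"
  shows "kernel_form k r w z \<le> B powr \<rho> * (1 + 2 * kernel_mass)"
proof -
  define A where "A = B powr (\<rho> / (2 * r))"
  have A: "A > 0" using B by (simp add: A_def)
  have AB: "A powr (2 * r / \<rho>) = B" "A powr r * A powr r = B powr \<rho>"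
    using r_pos \<rho> B by (simp_all add: A_def powr_powr powr_add[symmetric])
  have sc: "\<bar>v x / A\<bar> powr (2 * r / \<rho>) = \<bar>v x\<bar> powr (2 * r / \<rho>) / B" for v :: "'a \<Rightarrow> real" and x
    using A AB by (simp add: powr_divide)
  have i: "integrable lborel (\<lambda>x. \<bar>w x / A\<bar> powr (2 * r / \<rho>))" "integrable lborel (\<lambda>x. \<bar>z x / A\<bar> powr (2 * r / \<rho>))"
    unfolding sc using wz by simp_all
  have le1: "(\<integral>x. \<bar>w x / A\<bar> powr (2 * r / \<rho>) \<partial>lborel) \<le> 1" "(\<integral>x. \<bar>z x / A\<bar> powr (2 * r / \<rho>) \<partial>lborel) \<le> 1"
    unfolding sc using B by simp_all
  have fi: "integrable (lborel \<Otimes>\<^sub>M lborel) (\<lambda>(x, y). k (x - y) * \<bar>w x / A\<bar> powr r * \<bar>z y / A\<bar> powr r)"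
    by (rule form_integrable) (use i in auto)
  have "kernel_form k r w z = (\<integral>p. A powr r * A powr r * (case p of (x, y) \<Rightarrow> k (x - y) * \<bar>w x / A\<bar> powr r * \<bar>z y / A\<bar> powr r) \<partial>(lborel \<Otimes>\<^sub>M lborel))"
    unfolding kernel_form_def using A by (intro Bochner_Integration.integral_cong) (auto simp: powr_divide)
  also have "\<dots> = B powr \<rho> * kernel_form k r (\<lambda>x. w x / A) (\<lambda>x. z x / A)"
    unfolding AB kernel_form_def by simp
  finally have scaled: "kernel_form k r w z = B powr \<rho> * kernel_form k r (\<lambda>x. w x / A) (\<lambda>x. z x / A)" .
  have "kernel_form k r (\<lambda>x. w x / A) (\<lambda>x. z x / A) \<le> integral\<^sup>L (lborel \<Otimes>\<^sub>M lborel) (majorant (\<lambda>x. w x / A) (\<lambda>x. z x / A))"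
    unfolding kernel_form_def
    by (rule integral_mono[OF fi majorant_integral(1)[OF i]]) (use le_majorant[of _ _ "\<lambda>x. w x / A" "\<lambda>x. z x / A"] in auto)
  also have "\<dots> \<le> 1 * 1 + kernel_mass * (1 + 1)"
    unfolding majorant_integral(2)[OF i] using le1 kernel_mass_nonneg
    by (intro add_mono mult_mono mult_left_mono) auto
  finally show ?thesis unfolding scaled by (intro mult_left_mono) auto
qed

lemma form_tendsto:
  assumes [measurable]: "\<And>i. w i \<in> borel_measurable borel" "\<And>i. z i \<in> borel_measurable borel"
      "w0 \<in> borel_measurable borel" "z0 \<in> borel_measurable borel"
    and wi: "\<And>i. integrable lborel (\<lambda>x. \<bar>w i x\<bar> powr (2 * r / \<rho>))" "integrable lborel (\<lambda>x. \<bar>w0 x\<bar> powr (2 * r / \<rho>))"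
    and zi: "\<And>i. integrable lborel (\<lambda>x. \<bar>z i x\<bar> powr (2 * r / \<rho>))" "integrable lborel (\<lambda>x. \<bar>z0 x\<bar> powr (2 * r / \<rho>))"
    and wl: "(\<lambda>i. \<integral>x. \<bar>w i x\<bar> powr (2 * r / \<rho>) \<partial>lborel) \<longlonglongrightarrow> (\<integral>x. \<bar>w0 x\<bar> powr (2 * r / \<rho>) \<partial>lborel)"
    and zl: "(\<lambda>i. \<integral>x. \<bar>z i x\<bar> powr (2 * r / \<rho>) \<partial>lborel) \<longlonglongrightarrow> (\<integral>x. \<bar>z0 x\<bar> powr (2 * r / \<rho>) \<partial>lborel)"
    and wae: "AE x in lborel. (\<lambda>i. w i x) \<longlonglongrightarrow> w0 x" and zae: "AE x in lborel. (\<lambda>i. z i x) \<longlonglongrightarrow> z0 x"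
  shows "(\<lambda>i. kernel_form k r (w i) (z i)) \<longlonglongrightarrow> kernel_form k r w0 z0"
proof -
  have ae: "AE p in lborel \<Otimes>\<^sub>M lborel. (\<lambda>i. w i (fst p)) \<longlonglongrightarrow> w0 (fst p) \<and> (\<lambda>i. z i (snd p)) \<longlonglongrightarrow> z0 (snd p)"
  proof (rule lborel_pair.AE_pair_measure)
    show "AE x in lborel. AE y in lborel. (\<lambda>i. w i (fst (x, y))) \<longlonglongrightarrow> w0 (fst (x, y)) \<and> (\<lambda>i. z i (snd (x, y))) \<longlonglongrightarrow> z0 (snd (x, y))"
      using wae by eventually_elim (use zae in simp)
  qed measurable
  have tp: "(\<lambda>i. \<bar>a i\<bar> powr e) \<longlonglongrightarrow> \<bar>b\<bar> powr e" if "a \<longlonglongrightarrow> b" "e > 0" for a :: "nat \<Rightarrow> real" and b e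
    by (intro tendsto_powr2 tendsto_intros that) (use that in auto)
  have e: "2 * r / \<rho> > 0" using r_pos \<rho> by simp
  show ?thesis
    unfolding kernel_form_def
  proof (rule generalized_dominated_convergence(2)[where H="\<lambda>i. majorant (w i) (z i)" and ?H0.0="majorant w0 z0"])
    show "AE p in lborel \<Otimes>\<^sub>M lborel. (\<lambda>i. majorant (w i) (z i) p) \<longlonglongrightarrow> majorant w0 z0 p"
      using ae unfolding majorant_def split_beta
      by eventually_elim (intro tendsto_intros tp e; simp)
    show "AE p in lborel \<Otimes>\<^sub>M lborel. (\<lambda>i. case p of (x, y) \<Rightarrow> k (x - y) * \<bar>w i x\<bar> powr r * \<bar>z i y\<bar> powr r) \<longlonglongrightarrow> (case p of (x, y) \<Rightarrow> k (x - y) * \<bar>w0 x\<bar> powr r * \<bar>z0 y\<bar> powr r)"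
      using ae unfolding split_beta
      by eventually_elim (intro tendsto_intros tp r_pos; simp)
    show "(\<lambda>i. integral\<^sup>L (lborel \<Otimes>\<^sub>M lborel) (majorant (w i) (z i))) \<longlonglongrightarrow> integral\<^sup>L (lborel \<Otimes>\<^sub>M lborel) (majorant w0 z0)"
      unfolding majorant_integral(2)[OF wi(1) zi(1)] majorant_integral(2)[OF wi(2) zi(2)]
      by (intro tendsto_intros wl zl)
  qed (use majorant_integral(1)[OF wi(1) zi(1)] majorant_integral(1)[OF wi(2) zi(2)] k_nonneg le_majorant in \<open>auto simp: split_beta\<close>)
qed

end

text \<open>\<open>M\<close> stands for the mass critical exponent 2 + 4s/n. The space does not
  mention a potential, so the two components, which live in different potential spaces, can be
  handled together in the coupling term.\<close>

definition crit_space :: "real \<Rightarrow> ('a::euclidean_space \<Rightarrow> real) set" where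
  "crit_space M = {u \<in> borel_measurable borel. integrable lborel (\<lambda>x. (u x)\<^sup>2) \<and>
     integrable lborel (\<lambda>x. \<bar>u x\<bar> powr M)}"

lemma crit_spaceD:
  assumes "u \<in> crit_space M"
  shows "u \<in> borel_measurable borel" "integrable lborel (\<lambda>x. (u x)\<^sup>2)" "integrable lborel (\<lambda>x. \<bar>u x\<bar> powr M)"
  using assms by (auto simp: crit_space_def)

lemma crit_space_integrable_powr:
  assumes u: "u \<in> crit_space M" and m: "2 \<le> m" "m \<le> M"
  shows "integrable lborel (\<lambda>x. \<bar>u x\<bar> powr m)"
proof (rule Bochner_Integration.integrable_bound)
  show "integrable lborel (\<lambda>x. (u x)\<^sup>2 + \<bar>u x\<bar> powr M)" using crit_spaceD[OF u] by simp
  show "(\<lambda>x. \<bar>u x\<bar> powr m) \<in> borel_measurable lborel" using crit_spaceD(1)[OF u] by simp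
  show "AE x in lborel. norm (\<bar>u x\<bar> powr m) \<le> norm ((u x)\<^sup>2 + \<bar>u x\<bar> powr M)"
    using interpolation_powr[of "\<bar>u _\<bar>" 1 m M] m by auto
qed

lemma crit_space_add:
  assumes u: "u \<in> crit_space M" and v: "v \<in> crit_space M" and "0 \<le> M"
  shows "(\<lambda>x. u x + v x) \<in> crit_space M"
proof -
  note [measurable] = crit_spaceD(1)[OF u] crit_spaceD(1)[OF v]
  have "integrable lborel (\<lambda>x. (u x + v x)\<^sup>2)"
  proof (rule Bochner_Integration.integrable_bound)
    show "integrable lborel (\<lambda>x. 2 * (u x)\<^sup>2 + 2 * (v x)\<^sup>2)" using crit_spaceD[OF u] crit_spaceD[OF v] by simp
    show "AE x in lborel. norm ((u x + v x)\<^sup>2) \<le> norm (2 * (u x)\<^sup>2 + 2 * (v x)\<^sup>2)"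
    proof (rule AE_I2)
      fix x
      have "(u x + v x)\<^sup>2 \<le> 2 * (u x)\<^sup>2 + 2 * (v x)\<^sup>2"
        using sum_squares_bound[of "u x" "v x"] by (simp add: power2_sum)
      then show "norm ((u x + v x)\<^sup>2) \<le> norm (2 * (u x)\<^sup>2 + 2 * (v x)\<^sup>2)" by simp
    qed
  qed measurable
  moreover have "integrable lborel (\<lambda>x. \<bar>u x + v x\<bar> powr M)"
  proof (rule Bochner_Integration.integrable_bound)
    show "integrable lborel (\<lambda>x. 2 powr M * (\<bar>u x\<bar> powr M + \<bar>v x\<bar> powr M))" using crit_spaceD[OF u] crit_spaceD[OF v] by simp
    show "AE x in lborel. norm (\<bar>u x + v x\<bar> powr M) \<le> norm (2 powr M * (\<bar>u x\<bar> powr M + \<bar>v x\<bar> powr M))"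
    proof (rule AE_I2)
      fix x
      have "\<bar>u x + v x\<bar> powr M \<le> (2 * max \<bar>u x\<bar> \<bar>v x\<bar>) powr M"
        using \<open>0 \<le> M\<close> by (intro powr_mono2) auto
      also have "\<dots> = 2 powr M * (max \<bar>u x\<bar> \<bar>v x\<bar>) powr M" by (simp add: powr_mult)
      also have "\<dots> \<le> 2 powr M * (\<bar>u x\<bar> powr M + \<bar>v x\<bar> powr M)"
        by (intro mult_left_mono) (auto simp: max_def)
      finally show "norm (\<bar>u x + v x\<bar> powr M) \<le> norm (2 powr M * (\<bar>u x\<bar> powr M + \<bar>v x\<bar> powr M))" by simp
    qed
  qed measurable
  ultimately show ?thesis by (simp add: crit_space_def)
qed

lemma crit_space_abs: "u \<in> crit_space M \<Longrightarrow> (\<lambda>x. \<bar>u x\<bar>) \<in> crit_space M"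
  by (auto simp: crit_space_def)

lemma crit_space_scale: "u \<in> crit_space M \<Longrightarrow> (\<lambda>x. c * u x) \<in> crit_space M"
  by (auto simp: crit_space_def power_mult_distrib abs_mult powr_mult)

lemma crit_space_diff:
  assumes "u \<in> crit_space M" "v \<in> crit_space M" "0 \<le> M"
  shows "(\<lambda>x. u x - v x) \<in> crit_space M"
  using crit_space_add[OF assms(1) crit_space_scale[OF assms(2), of "-1"] assms(3)] by simp

text \<open>Strong convergence in L^2 and a bound in L^M give strong convergence in L^m for m
  strictly below M, by interpolation of the difference. The integrals of the powers then converge by
  dominated convergence with majorants that vary with i.\<close>

lemma crit_space_tendsto_integral_powr:
  assumes u: "\<And>i. u i \<in> crit_space M" and u0: "u0 \<in> crit_space M" and m: "2 \<le> m" "m < M"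
    and ae: "AE x in lborel. (\<lambda>i. u i x) \<longlonglongrightarrow> u0 x"
    and L2: "(\<lambda>i. \<integral>x. (u i x - u0 x)\<^sup>2 \<partial>lborel) \<longlonglongrightarrow> 0"
    and bd: "\<And>i. (\<integral>x. \<bar>u i x - u0 x\<bar> powr M \<partial>lborel) \<le> B"
  shows "(\<lambda>i. \<integral>x. \<bar>u i x\<bar> powr m \<partial>lborel) \<longlonglongrightarrow> (\<integral>x. \<bar>u0 x\<bar> powr m \<partial>lborel)"
proof -
  note [measurable] = crit_spaceD(1)[OF u] crit_spaceD(1)[OF u0]
  have M: "0 \<le> M" using m by simp
  have d: "(\<lambda>x. u i x - u0 x) \<in> crit_space M" for i by (intro crit_space_diff u u0 M)
  have B: "0 \<le> B" using order.trans[OF _ bd[of 0]] by simp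
  have dm: "integrable lborel (\<lambda>x. \<bar>u i x - u0 x\<bar> powr m)" for i
    using crit_space_integrable_powr[OF d] m by simp
  have um: "integrable lborel (\<lambda>x. \<bar>u0 x\<bar> powr m)"
    using crit_space_integrable_powr[OF u0] m by simp
  have lim: "(\<lambda>i. \<integral>x. \<bar>u i x - u0 x\<bar> powr m \<partial>lborel) \<longlonglongrightarrow> 0"
  proof (rule LIMSEQ_I)
    fix e :: real assume e: "e > 0"
    \<comment> \<open>This threshold gives \<Lambda>^(m-M) = e / (2 (B+1)), so the part of the
      interpolation that carries the bound \<open>B\<close> is below e/2; the remaining room
      \<open>c\<close> is left to the L^2 part, small for large i.\<close>
    define \<Lambda> where "\<Lambda> = (e / 2 / (B + 1)) powr (1 / (m - M))"
    have \<Lambda>: "\<Lambda> > 0" using e B by (simp add: \<Lambda>_def)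
    have LB: "\<Lambda> powr (m - M) * B < e / 2"
      using e B m by (simp add: \<Lambda>_def powr_powr field_simps)
    define c where "c = e / 2 - \<Lambda> powr (m - M) * B"
    have "c > 0" using LB by (simp add: c_def)
    then have "c / \<Lambda> powr (m - 2) > 0" using \<Lambda> by simp
    then obtain N where N: "\<And>i. i \<ge> N \<Longrightarrow> norm ((\<integral>x. (u i x - u0 x)\<^sup>2 \<partial>lborel) - 0) < c / \<Lambda> powr (m - 2)"
      using LIMSEQ_D[OF L2] by blast
    show "\<exists>N. \<forall>i\<ge>N. norm ((\<integral>x. \<bar>u i x - u0 x\<bar> powr m \<partial>lborel) - 0) < e"
    proof (intro exI allI impI)
      fix i assume i: "i \<ge> N"
      have "(\<integral>x. \<bar>u i x - u0 x\<bar> powr m \<partial>lborel) \<le> (\<integral>x. \<Lambda> powr (m - 2) * (u i x - u0 x)\<^sup>2 + \<Lambda> powr (m - M) * \<bar>u i x - u0 x\<bar> powr M \<partial>lborel)"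
        using interpolation_powr[OF _ \<Lambda>, of "\<bar>u i _ - u0 _\<bar>" m M] m
        by (intro integral_mono dm) (use crit_spaceD[OF d[of i]] in auto)
      also have "\<dots> = \<Lambda> powr (m - 2) * (\<integral>x. (u i x - u0 x)\<^sup>2 \<partial>lborel) + \<Lambda> powr (m - M) * (\<integral>x. \<bar>u i x - u0 x\<bar> powr M \<partial>lborel)"
        using crit_spaceD[OF d[of i]] by simp
      also have "\<dots> \<le> c + \<Lambda> powr (m - M) * B"
        using N[OF i] \<Lambda> bd[of i] by (intro add_mono mult_left_mono) (auto simp: field_simps)
      also have "\<dots> < e" using e by (simp add: c_def)
      finally show "norm ((\<integral>x. \<bar>u i x - u0 x\<bar> powr m \<partial>lborel) - 0) < e" by simp
    qed
  qed
  show ?thesis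
  \<comment> \<open>The majorants come from |u i| \<le> 2 max |u i - u0| |u0|. They converge almost
    everywhere to 2^m |u0|^m, and their integrals converge by \<open>lim\<close>.\<close>
  proof (rule generalized_dominated_convergence(2)[where H="\<lambda>i x. 2 powr m * (\<bar>u i x - u0 x\<bar> powr m + \<bar>u0 x\<bar> powr m)" and ?H0.0="\<lambda>x. 2 powr m * \<bar>u0 x\<bar> powr m"])
    show "AE x in lborel. (\<lambda>i. \<bar>u i x\<bar> powr m) \<longlonglongrightarrow> \<bar>u0 x\<bar> powr m"
      using ae by eventually_elim (intro tendsto_powr2 tendsto_intros; use m in auto)
    show "AE x in lborel. (\<lambda>i. 2 powr m * (\<bar>u i x - u0 x\<bar> powr m + \<bar>u0 x\<bar> powr m)) \<longlonglongrightarrow> 2 powr m * \<bar>u0 x\<bar> powr m"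
      using ae
    proof eventually_elim
      case (elim x)
      have "(\<lambda>i. 2 powr m * (\<bar>u i x - u0 x\<bar> powr m + \<bar>u0 x\<bar> powr m)) \<longlonglongrightarrow> 2 powr m * (\<bar>u0 x - u0 x\<bar> powr m + \<bar>u0 x\<bar> powr m)"
        using m elim by (intro tendsto_powr2 tendsto_intros) auto
      then show ?case by simp
    qed
    show "(\<lambda>i. \<integral>x. 2 powr m * (\<bar>u i x - u0 x\<bar> powr m + \<bar>u0 x\<bar> powr m) \<partial>lborel) \<longlonglongrightarrow> (\<integral>x. 2 powr m * \<bar>u0 x\<bar> powr m \<partial>lborel)"
    proof -
      have "(\<lambda>i. 2 powr m * ((\<integral>x. \<bar>u i x - u0 x\<bar> powr m \<partial>lborel) + (\<integral>x. \<bar>u0 x\<bar> powr m \<partial>lborel))) \<longlonglongrightarrow> 2 powr m * (0 + (\<integral>x. \<bar>u0 x\<bar> powr m \<partial>lborel))"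
        by (intro tendsto_intros lim)
      then show ?thesis using dm um by simp
    qed
    fix i x
    have "\<bar>u i x\<bar> \<le> 2 * max \<bar>u i x - u0 x\<bar> \<bar>u0 x\<bar>"
      by (smt (verit) max.cobounded1 max.cobounded2)
    then have "\<bar>u i x\<bar> powr m \<le> (2 * max \<bar>u i x - u0 x\<bar> \<bar>u0 x\<bar>) powr m"
      using m by (intro powr_mono2) auto
    also have "\<dots> = 2 powr m * (max \<bar>u i x - u0 x\<bar> \<bar>u0 x\<bar>) powr m" by (simp add: powr_mult)
    also have "\<dots> \<le> 2 powr m * (\<bar>u i x - u0 x\<bar> powr m + \<bar>u0 x\<bar> powr m)"
      by (intro mult_left_mono) (auto simp: max_def)
    finally show "\<bar>u i x\<bar> powr m \<le> 2 powr m * (\<bar>u i x - u0 x\<bar> powr m + \<bar>u0 x\<bar> powr m)" .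
  qed (use dm um in auto)
qed

text \<open>Up to the threshold X with X^(\<eta>-1) = \<epsilon> the power is at most X^\<eta>;
  beyond it x^\<eta> = x^(\<eta>-1) x \<le> \<epsilon> x.\<close>

lemma powr_sublinear:
  fixes \<eta> \<epsilon> :: real
  assumes "0 \<le> \<eta>" "\<eta> < 1" "0 < \<epsilon>"
  shows "\<exists>C. \<forall>x\<ge>1. x powr \<eta> \<le> \<epsilon> * x + C"
proof (intro exI allI impI)
  fix x :: real assume x: "1 \<le> x"
  define X where "X = \<epsilon> powr (1 / (\<eta> - 1))"
  have X: "X > 0" using assms by (simp add: X_def)
  show "x powr \<eta> \<le> \<epsilon> * x + X powr \<eta>"
  proof (cases "x \<le> X")
    case True
    then have "x powr \<eta> \<le> X powr \<eta>" using assms x by (intro powr_mono2) auto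
    then show ?thesis using assms x by (simp add: add_increasing)
  next
    case False
    have "x powr \<eta> = x powr (\<eta> - 1) * x" using x by (simp add: powr_diff)
    also have "\<dots> \<le> X powr (\<eta> - 1) * x"
      using False X x assms by (intro mult_right_mono powr_mono2') auto
    also have "X powr (\<eta> - 1) = \<epsilon>" using assms by (simp add: X_def powr_powr)
    finally show ?thesis by (smt (verit) powr_ge_zero)
  qed
qed

section \<open>The Riesz kernel as a sum of two Young kernels\<close>

lemma riesz_kernel_measurable[measurable]: "riesz_kernel \<alpha> \<in> borel_measurable borel"
  unfolding riesz_kernel_def by measurable

text \<open>The strict inequalities on \<open>r\<close> leave room to use exponents \<open>\<rho>1 < 1 + \<alpha> / n < \<rho>2\<close> for the
  singular part and the tail of the Riesz kernel, so that the endpoint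
  Hardy-Littlewood-Sobolev inequality is not needed.\<close>

lemma riesz_kernel_split:
  fixes \<alpha> s r :: real
  defines "n \<equiv> real DIM('a)"
  assumes \<alpha>: "0 < \<alpha>" "\<alpha> < n" and s: "0 < s" and r: "1 + \<alpha> / n < r" "r < 1 + (\<alpha> + 2 * s) / n"
  obtains k1 k2 :: "'a::euclidean_space \<Rightarrow> real" and \<rho>1 \<rho>2 where
    "young_kernel k1 r \<rho>1" "young_kernel k2 r \<rho>2" "\<And>x. riesz_kernel \<alpha> x = k1 x + k2 x"
    "\<rho>1 \<le> r" "\<rho>2 \<le> r" "(r - \<rho>1) * n < 2 * s" "(r - \<rho>2) * n < 2 * s"
proof -
  have n: "n > 0" by (simp add: n_def)
  have an: "0 < \<alpha> / n" "\<alpha> / n < 1" using \<alpha> n by simp_all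
  \<comment> \<open>The four gaps guarantee, in this order, \<rho>1 > 1, \<rho>2 < 2, \<rho>2 < r
    and r - \<rho>1 < 2s/n. Halving makes all four inequalities strict.\<close>
  define \<delta>0 where "\<delta>0 = min (min (\<alpha> / n) (1 - \<alpha> / n)) (min (r - (1 + \<alpha> / n)) (1 + (\<alpha> + 2 * s) / n - r))"
  define \<delta> where "\<delta> = \<delta>0 / 2"
  have "0 < \<delta>0" using an r by (simp add: \<delta>0_def)
  moreover have "\<delta>0 \<le> \<alpha> / n" "\<delta>0 \<le> 1 - \<alpha> / n" "\<delta>0 \<le> r - (1 + \<alpha> / n)" "\<delta>0 \<le> 1 + (\<alpha> + 2 * s) / n - r"
    by (simp_all only: \<delta>0_def min_le_iff_disj order.refl simp_thms)
  ultimately  have \<delta>: "0 < \<delta>" "\<delta> < \<alpha> / n" "\<delta> < 1 - \<alpha> / n" "\<delta> < r - (1 + \<alpha> / n)" "\<delta> < 1 + (\<alpha> + 2 * s) / n - r"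
    unfolding \<delta>_def by linarith+
  define \<rho>1 where "\<rho>1 = 1 + \<alpha> / n - \<delta>"
  define \<rho>2 where "\<rho>2 = 1 + \<alpha> / n + \<delta>"
  define k1 :: "'a \<Rightarrow> real" where "k1 = (\<lambda>x. indicator (ball 0 1) x * riesz_kernel \<alpha> x)"
  define k2 :: "'a \<Rightarrow> real" where "k2 = (\<lambda>x. indicator (- ball 0 1) x * riesz_kernel \<alpha> x)"
  have rp: "r > 0" using r an by simp
  have neg: "(norm x powr (\<alpha> - n)) powr (1 / c) = norm x powr (- ((n - \<alpha>) / c))" for x :: 'a and c
    by (simp only: powr_powr) (simp add: minus_divide_left)
  have k1_eq: "k1 x powr (1 / (2 - \<rho>1)) = indicator (ball 0 1) x * norm x powr (- ((n - \<alpha>) / (2 - \<rho>1)))" for x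
    unfolding neg[symmetric] by (simp add: k1_def riesz_kernel_def n_def indicator_def)
  have k2_eq: "k2 x powr (1 / (2 - \<rho>2)) = indicator (- ball 0 1) x * norm x powr (- ((n - \<alpha>) / (2 - \<rho>2)))" for x
    unfolding neg[symmetric] by (simp add: k2_def riesz_kernel_def n_def indicator_def)
  have p: "\<rho>1 < 2" "\<rho>2 < 2" "1 < \<rho>1" "1 < \<rho>2" using \<delta> an by (auto simp: \<rho>1_def \<rho>2_def)
  \<comment> \<open>For \<rho> = 1 + \<alpha>/n the exponent (n - \<alpha>) / (2 - \<rho>) would be
    exactly n, which is integrable neither at 0 nor at infinity. Lowering \<rho> repairs the
    singularity, raising it repairs the tail.\<close>
  have e1: "(n - \<alpha>) / (2 - \<rho>1) < n"
  proof -
    have "n * (2 - \<rho>1) = n - \<alpha> + n * \<delta>" using n by (simp add: \<rho>1_def field_simps)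
    then have "n - \<alpha> < n * (2 - \<rho>1)" using n \<delta> by simp
    then show ?thesis using p by (simp add: pos_divide_less_eq)
  qed
  have e2: "(n - \<alpha>) / (2 - \<rho>2) > n"
  proof -
    have "n * (2 - \<rho>2) = n - \<alpha> - n * \<delta>" using n by (simp add: \<rho>2_def field_simps)
    then have "n - \<alpha> > n * (2 - \<rho>2)" using n \<delta> by simp
    then show ?thesis using p by (simp add: pos_less_divide_eq)
  qed
  show thesis
  proof
    show "young_kernel k1 r \<rho>1"
    proof
      show "k1 \<in> borel_measurable borel" unfolding k1_def
        by (intro borel_measurable_times borel_measurable_indicator riesz_kernel_measurable) auto
      show "0 \<le> k1 x" for x by (simp add: k1_def riesz_kernel_def)
      show "integrable lborel (\<lambda>x. k1 x powr (1 / (2 - \<rho>1)))"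
        unfolding k1_eq
      proof (rule integrableI_nonneg)
        have "(\<lambda>x::'a. indicator (ball 0 1) x * norm x powr (- ((n - \<alpha>) / (2 - \<rho>1)))) \<in> borel_measurable borel"
          by (intro borel_measurable_times borel_measurable_indicator) auto
        then show "(\<lambda>x::'a. indicator (ball 0 1) x * norm x powr (- ((n - \<alpha>) / (2 - \<rho>1)))) \<in> borel_measurable lborel"
          by simp
        show "(\<integral>\<^sup>+x. ennreal (indicator (ball 0 1) (x::'a) * norm x powr (- ((n - \<alpha>) / (2 - \<rho>1)))) \<partial>lborel) < \<infinity>"
          using nn_integral_norm_powr_ball[where 'a='a, OF e1[unfolded n_def]] unfolding n_def .
      qed simp
    qed (use p rp in auto)
    show "young_kernel k2 r \<rho>2"
    proof
      show "k2 \<in> borel_measurable borel" unfolding k2_def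
        by (intro borel_measurable_times borel_measurable_indicator riesz_kernel_measurable) auto
      show "0 \<le> k2 x" for x by (simp add: k2_def riesz_kernel_def)
      show "integrable lborel (\<lambda>x. k2 x powr (1 / (2 - \<rho>2)))"
        unfolding k2_eq
      proof (rule integrableI_nonneg)
        have "(\<lambda>x::'a. indicator (- ball 0 1) x * norm x powr (- ((n - \<alpha>) / (2 - \<rho>2)))) \<in> borel_measurable borel"
          by (intro borel_measurable_times borel_measurable_indicator) auto
        then show "(\<lambda>x::'a. indicator (- ball 0 1) x * norm x powr (- ((n - \<alpha>) / (2 - \<rho>2)))) \<in> borel_measurable lborel"
          by simp
        show "(\<integral>\<^sup>+x. ennreal (indicator (- ball 0 1) (x::'a) * norm x powr (- ((n - \<alpha>) / (2 - \<rho>2)))) \<partial>lborel) < \<infinity>"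
          using nn_integral_norm_powr_outside_ball[where 'a='a, OF e2[unfolded n_def]] unfolding n_def .
      qed simp
    qed (use p rp in auto)
    show "riesz_kernel \<alpha> x = k1 x + k2 x" for x by (auto simp: k1_def k2_def indicator_def)
    show "\<rho>1 \<le> r" "\<rho>2 \<le> r" using \<delta> by (auto simp: \<rho>1_def \<rho>2_def)
    have "r - \<rho>1 < 2 * s / n" "r - \<rho>2 < 2 * s / n" using \<delta> by (auto simp: \<rho>1_def \<rho>2_def add_divide_distrib)
    then show "(r - \<rho>1) * n < 2 * s" "(r - \<rho>2) * n < 2 * s" using n by (simp_all add: field_simps)
  qed
qed

text \<open>The upper bound is equivalent to (r - \<rho>) n < 2 s \<rho>, and \<rho> > 1 leaves
  room. The stronger condition without the factor \<rho> is what makes the growth in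
  \<open>form_sublinear\<close> less than linear.\<close>

lemma young_kernel_exponent:
  fixes k :: "'a::euclidean_space \<Rightarrow> real"
  assumes "young_kernel k r \<rho>" "\<rho> \<le> r" "(r - \<rho>) * real DIM('a) < 2 * s"
  shows "2 \<le> 2 * r / \<rho>" "2 * r / \<rho> < 2 + 4 * s / real DIM('a)"
proof -
  interpret young_kernel k r \<rho> by fact
  show "2 \<le> 2 * r / \<rho>" using \<rho> assms by (simp add: field_simps)
  have n: "real DIM('a) > 0" by simp
  have s: "0 < s" using assms(2,3) n by (smt (verit) mult_nonneg_nonneg)
  have "r - \<rho> < 2 * s / DIM('a)" using assms(3) n by (simp add: field_simps)
  also have "\<dots> \<le> 2 * s / DIM('a) * \<rho>" using \<rho> s n by (simp add: field_simps)
  finally have "2 * r < (2 + 4 * s / DIM('a)) * \<rho>" by (simp add: field_simps)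
  then show "2 * r / \<rho> < 2 + 4 * s / real DIM('a)" using \<rho> by (simp add: pos_divide_less_eq)
qed

text \<open>With m = 2r/\<rho> and \<theta> = (m-2)/(M-2), interpolation bounds the integral of
  |v|^m by 2c (1+E)^\<theta>, and \<open>form_le\<close> raises this to the power \<rho>. Since
  \<theta> \<rho> = (r - \<rho>) n / (2s) < 1, Young's inequality in the form
  \<open>powr_sublinear\<close> applies; mass subcriticality enters here. \<open>E\<close> is a free
  number so that the sum of two seminorms can be inserted.\<close>

lemma (in young_kernel) form_sublinear:
  fixes s c \<epsilon> :: real
  defines "M \<equiv> 2 + 4 * s / real DIM('a)"
  assumes r: "\<rho> \<le> r" "(r - \<rho>) * real DIM('a) < 2 * s" and s: "0 < s" and c: "0 < c" and \<epsilon>: "0 < \<epsilon>"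
  shows "\<exists>C. \<forall>w z E. w \<in> crit_space M \<longrightarrow> z \<in> crit_space M \<longrightarrow> 0 \<le> E \<longrightarrow>
     (\<integral>x. (w x)\<^sup>2 \<partial>lborel) \<le> c \<longrightarrow> (\<integral>x. (z x)\<^sup>2 \<partial>lborel) \<le> c \<longrightarrow>
     (\<integral>x. \<bar>w x\<bar> powr M \<partial>lborel) \<le> c * E \<longrightarrow> (\<integral>x. \<bar>z x\<bar> powr M \<partial>lborel) \<le> c * E \<longrightarrow>
     kernel_form k r w z \<le> \<epsilon> * E + C"
proof -
  define m where "m = 2 * r / \<rho>"
  have m: "2 \<le> m" "m < M"
    using young_kernel_exponent[OF young_kernel_axioms r] by (simp_all add: m_def M_def)
  have n: "real DIM('a) > 0" by simp
  define \<theta> where "\<theta> = (m - 2) / (M - 2)"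
  have \<theta>\<rho>: "\<theta> * \<rho> = (r - \<rho>) * real DIM('a) / (2 * s)"
    using \<rho> s n by (simp add: \<theta>_def m_def M_def field_simps)
  have \<eta>: "0 \<le> \<theta> * \<rho>" "\<theta> * \<rho> < 1"
    unfolding \<theta>\<rho> using r s n by simp_all
  define A where "A = (2 * c) powr \<rho> * (1 + 2 * kernel_mass)"
  have A: "A > 0" using c kernel_mass_nonneg by (simp add: A_def add_pos_nonneg)
  obtain C where C: "\<And>x. x \<ge> 1 \<Longrightarrow> x powr (\<theta> * \<rho>) \<le> \<epsilon> / A * x + C"
    using powr_sublinear[OF \<eta>, of "\<epsilon> / A"] \<epsilon> A by auto
  show ?thesis
  proof (intro exI allI impI)
    fix w z :: "'a \<Rightarrow> real" and E
    assume w: "w \<in> crit_space M" and z: "z \<in> crit_space M" and E: "0 \<le> E"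
      and wc: "(\<integral>x. (w x)\<^sup>2 \<partial>lborel) \<le> c" and zc: "(\<integral>x. (z x)\<^sup>2 \<partial>lborel) \<le> c"
      and wM: "(\<integral>x. \<bar>w x\<bar> powr M \<partial>lborel) \<le> c * E" and zM: "(\<integral>x. \<bar>z x\<bar> powr M \<partial>lborel) \<le> c * E"
    \<comment> \<open>Taking \<Lambda>^(M-2) = 1 + E balances the two interpolation terms: both
      become multiples of (1+E)^\<theta>.\<close>
    define \<Lambda> where "\<Lambda> = (1 + E) powr (1 / (M - 2))"
    have \<Lambda>: "\<Lambda> > 0" using E by (simp add: \<Lambda>_def)
    have L: "\<Lambda> powr (m - 2) = (1 + E) powr \<theta>" "\<Lambda> powr (m - M) = (1 + E) powr (\<theta> - 1)"
      using m by (simp_all add: \<Lambda>_def powr_powr \<theta>_def field_simps)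
    have bd: "(\<integral>x. \<bar>v x\<bar> powr m \<partial>lborel) \<le> 2 * c * (1 + E) powr \<theta>"
      if v: "v \<in> crit_space M" and vc: "(\<integral>x. (v x)\<^sup>2 \<partial>lborel) \<le> c" and vM: "(\<integral>x. \<bar>v x\<bar> powr M \<partial>lborel) \<le> c * E" for v :: "'a \<Rightarrow> real"
    proof -
      have "(\<integral>x. \<bar>v x\<bar> powr m \<partial>lborel) \<le> (\<integral>x. \<Lambda> powr (m - 2) * (v x)\<^sup>2 + \<Lambda> powr (m - M) * \<bar>v x\<bar> powr M \<partial>lborel)"
        using interpolation_powr[OF _ \<Lambda>, of "\<bar>v _\<bar>" m M] m
        by (intro integral_mono crit_space_integrable_powr[OF v]) (use crit_spaceD[OF v] in auto)
      also have "\<dots> = \<Lambda> powr (m - 2) * (\<integral>x. (v x)\<^sup>2 \<partial>lborel) + \<Lambda> powr (m - M) * (\<integral>x. \<bar>v x\<bar> powr M \<partial>lborel)"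
        using crit_spaceD[OF v] by simp
      also have "\<dots> \<le> (1 + E) powr \<theta> * c + (1 + E) powr (\<theta> - 1) * (c * (1 + E))"
        unfolding L using vc order.trans[OF vM, of "c * (1 + E)"] c by (intro add_mono mult_left_mono) auto
      also have "(1 + E) powr (\<theta> - 1) * (c * (1 + E)) = c * (1 + E) powr \<theta>"
        using E by (simp add: powr_diff)
      finally show ?thesis by (simp add: algebra_simps)
    qed
    have B: "0 < 2 * c * (1 + E) powr \<theta>" using c E by simp
    have "kernel_form k r w z \<le> (2 * c * (1 + E) powr \<theta>) powr \<rho> * (1 + 2 * kernel_mass)"
      by (rule form_le[OF crit_spaceD(1)[OF w] crit_spaceD(1)[OF z] _ _ _ _ B])
         (use crit_space_integrable_powr[OF w] crit_space_integrable_powr[OF z] m bd[OF w wc wM] bd[OF z zc zM] in \<open>auto simp: m_def\<close>)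
    also have "\<dots> = A * (1 + E) powr (\<theta> * \<rho>)"
      using c E by (simp add: powr_mult powr_powr A_def)
    also have "\<dots> \<le> A * (\<epsilon> / A * (1 + E) + C)"
      using A C[of "1 + E"] E by (intro mult_left_mono) auto
    also have "\<dots> = \<epsilon> * E + (\<epsilon> + A * C)" using A by (simp add: field_simps)
    finally show "kernel_form k r w z \<le> \<epsilon> * E + (\<epsilon> + A * C)" .
  qed
qed

text \<open>\<open>space_type\<close> only fixes the type 'a, hence the dimension; the other
  parameters are real numbers and do not determine it.\<close>

locale riesz_exponent =
  fixes space_type :: "'a::euclidean_space itself" and \<alpha> s r :: real
  assumes \<alpha>: "0 < \<alpha>" "\<alpha> < real DIM('a)" and s: "0 < s"
    and r: "1 + \<alpha> / real DIM('a) < r" "r < 1 + (\<alpha> + 2 * s) / real DIM('a)"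
begin

lemma r_gt_1: "1 < r"
proof -
  have "0 < \<alpha> / real DIM('a)" using \<alpha> by simp
  then show ?thesis using r by simp
qed

lemma split_form:
  fixes w z :: "'a \<Rightarrow> real"
  assumes w: "w \<in> crit_space (2 + 4 * s / real DIM('a))" and z: "z \<in> crit_space (2 + 4 * s / real DIM('a))"
    and k: "young_kernel k1 r \<rho>1" "young_kernel k2 r \<rho>2" "\<And>x. riesz_kernel \<alpha> x = k1 x + k2 x"
    "\<rho>1 \<le> r" "\<rho>2 \<le> r" "(r - \<rho>1) * real DIM('a) < 2 * s" "(r - \<rho>2) * real DIM('a) < 2 * s"
  shows "integrable (lborel \<Otimes>\<^sub>M lborel) (\<lambda>(x, y). riesz_kernel \<alpha> (x - y) * \<bar>w x\<bar> powr r * \<bar>z y\<bar> powr r)"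
    "kernel_form (riesz_kernel \<alpha>) r w z = kernel_form k1 r w z + kernel_form k2 r w z"
proof -
  note e1 = young_kernel_exponent[OF k(1,4,6)] and e2 = young_kernel_exponent[OF k(2,5,7)]
  have i: "integrable (lborel \<Otimes>\<^sub>M lborel) (\<lambda>(x, y). k1 (x - y) * \<bar>w x\<bar> powr r * \<bar>z y\<bar> powr r)"
    "integrable (lborel \<Otimes>\<^sub>M lborel) (\<lambda>(x, y). k2 (x - y) * \<bar>w x\<bar> powr r * \<bar>z y\<bar> powr r)"
    by (rule young_kernel.form_integrable[OF k(1)] young_kernel.form_integrable[OF k(2)];
        use e1 e2 crit_spaceD(1)[OF w] crit_spaceD(1)[OF z] crit_space_integrable_powr[OF w] crit_space_integrable_powr[OF z] in simp)+
  have eq: "(\<lambda>(x, y). riesz_kernel \<alpha> (x - y) * \<bar>w x\<bar> powr r * \<bar>z y\<bar> powr r) =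
     (\<lambda>p. (case p of (x, y) \<Rightarrow> k1 (x - y) * \<bar>w x\<bar> powr r * \<bar>z y\<bar> powr r) + (case p of (x, y) \<Rightarrow> k2 (x - y) * \<bar>w x\<bar> powr r * \<bar>z y\<bar> powr r))"
    by (auto simp: k(3) algebra_simps)
  show "integrable (lborel \<Otimes>\<^sub>M lborel) (\<lambda>(x, y). riesz_kernel \<alpha> (x - y) * \<bar>w x\<bar> powr r * \<bar>z y\<bar> powr r)"
    unfolding eq using i by (rule Bochner_Integration.integrable_add)
  show "kernel_form (riesz_kernel \<alpha>) r w z = kernel_form k1 r w z + kernel_form k2 r w z"
    unfolding kernel_form_def eq using i by (rule Bochner_Integration.integral_add)
qed

lemma integrable_riesz:
  fixes w z :: "'a \<Rightarrow> real"
  assumes "w \<in> crit_space (2 + 4 * s / real DIM('a))" "z \<in> crit_space (2 + 4 * s / real DIM('a))"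
  shows "integrable (lborel \<Otimes>\<^sub>M lborel) (\<lambda>(x, y). riesz_kernel \<alpha> (x - y) * \<bar>w x\<bar> powr r * \<bar>z y\<bar> powr r)"
  by (rule riesz_kernel_split[OF \<alpha> s r]) (rule split_form(1)[OF assms])

lemma riesz_form_sublinear:
  fixes c \<epsilon> :: real
  assumes c: "0 < c" and \<epsilon>: "0 < \<epsilon>"
  shows "\<exists>C. \<forall>(w::'a\<Rightarrow>real) z E. w \<in> crit_space (2 + 4 * s / real DIM('a)) \<longrightarrow> z \<in> crit_space (2 + 4 * s / real DIM('a)) \<longrightarrow> 0 \<le> E \<longrightarrow>
     (\<integral>x. (w x)\<^sup>2 \<partial>lborel) \<le> c \<longrightarrow> (\<integral>x. (z x)\<^sup>2 \<partial>lborel) \<le> c \<longrightarrow>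
     (\<integral>x. \<bar>w x\<bar> powr (2 + 4 * s / real DIM('a)) \<partial>lborel) \<le> c * E \<longrightarrow> (\<integral>x. \<bar>z x\<bar> powr (2 + 4 * s / real DIM('a)) \<partial>lborel) \<le> c * E \<longrightarrow>
     kernel_form (riesz_kernel \<alpha>) r w z \<le> \<epsilon> * E + C"
proof -
  obtain k1 k2 :: "'a \<Rightarrow> real" and \<rho>1 \<rho>2 where k: "young_kernel k1 r \<rho>1" "young_kernel k2 r \<rho>2" "\<And>x. riesz_kernel \<alpha> x = k1 x + k2 x"
    "\<rho>1 \<le> r" "\<rho>2 \<le> r" "(r - \<rho>1) * real DIM('a) < 2 * s" "(r - \<rho>2) * real DIM('a) < 2 * s"
    using riesz_kernel_split[OF \<alpha> s r] by metis
  have "0 < \<epsilon> / 2" using \<epsilon> by simp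
  from young_kernel.form_sublinear[OF k(1,4,6) s c this]
  obtain C1 where C1: "\<And>w z E. \<lbrakk>w \<in> crit_space (2 + 4 * s / real DIM('a)); z \<in> crit_space (2 + 4 * s / real DIM('a)); 0 \<le> E; (\<integral>x. (w x)\<^sup>2 \<partial>lborel) \<le> c; (\<integral>x. (z x)\<^sup>2 \<partial>lborel) \<le> c;
     (\<integral>x. \<bar>w x\<bar> powr (2 + 4 * s / real DIM('a)) \<partial>lborel) \<le> c * E; (\<integral>x. \<bar>z x\<bar> powr (2 + 4 * s / real DIM('a)) \<partial>lborel) \<le> c * E\<rbrakk> \<Longrightarrow> kernel_form k1 r w z \<le> \<epsilon> / 2 * E + C1"
    by blast
  have "0 < \<epsilon> / 2" using \<epsilon> by simp
  from young_kernel.form_sublinear[OF k(2,5,7) s c this]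
  obtain C2 where C2: "\<And>w z E. \<lbrakk>w \<in> crit_space (2 + 4 * s / real DIM('a)); z \<in> crit_space (2 + 4 * s / real DIM('a)); 0 \<le> E; (\<integral>x. (w x)\<^sup>2 \<partial>lborel) \<le> c; (\<integral>x. (z x)\<^sup>2 \<partial>lborel) \<le> c;
     (\<integral>x. \<bar>w x\<bar> powr (2 + 4 * s / real DIM('a)) \<partial>lborel) \<le> c * E; (\<integral>x. \<bar>z x\<bar> powr (2 + 4 * s / real DIM('a)) \<partial>lborel) \<le> c * E\<rbrakk> \<Longrightarrow> kernel_form k2 r w z \<le> \<epsilon> / 2 * E + C2"
    by blast
  show ?thesis
  proof (intro exI allI impI)
    fix w z :: "'a \<Rightarrow> real" and E :: real
    assume a: "w \<in> crit_space (2 + 4 * s / real DIM('a))" "z \<in> crit_space (2 + 4 * s / real DIM('a))" "0 \<le> E" "(\<integral>x. (w x)\<^sup>2 \<partial>lborel) \<le> c" "(\<integral>x. (z x)\<^sup>2 \<partial>lborel) \<le> c"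
     "(\<integral>x. \<bar>w x\<bar> powr (2 + 4 * s / real DIM('a)) \<partial>lborel) \<le> c * E" "(\<integral>x. \<bar>z x\<bar> powr (2 + 4 * s / real DIM('a)) \<partial>lborel) \<le> c * E"
    show "kernel_form (riesz_kernel \<alpha>) r w z \<le> \<epsilon> * E + (C1 + C2)"
      using C1[OF a] C2[OF a] split_form(2)[OF a(1,2) k] by (simp add: field_simps)
  qed
qed

text \<open>Convergence is asked for all powers in the subcritical range because the two exponents
  2r/\<rho>1 and 2r/\<rho>2 at which it is applied come out of the splitting of the kernel.\<close>

lemma riesz_form_tendsto:
  fixes w z :: "nat \<Rightarrow> 'a \<Rightarrow> real"
  assumes w: "\<And>i. w i \<in> crit_space (2 + 4 * s / real DIM('a))" "w0 \<in> crit_space (2 + 4 * s / real DIM('a))"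
    and z: "\<And>i. z i \<in> crit_space (2 + 4 * s / real DIM('a))" "z0 \<in> crit_space (2 + 4 * s / real DIM('a))"
    and wl: "\<And>m. 2 \<le> m \<Longrightarrow> m < (2 + 4 * s / real DIM('a)) \<Longrightarrow> (\<lambda>i. \<integral>x. \<bar>w i x\<bar> powr m \<partial>lborel) \<longlonglongrightarrow> (\<integral>x. \<bar>w0 x\<bar> powr m \<partial>lborel)"
    and zl: "\<And>m. 2 \<le> m \<Longrightarrow> m < (2 + 4 * s / real DIM('a)) \<Longrightarrow> (\<lambda>i. \<integral>x. \<bar>z i x\<bar> powr m \<partial>lborel) \<longlonglongrightarrow> (\<integral>x. \<bar>z0 x\<bar> powr m \<partial>lborel)"
    and wae: "AE x in lborel. (\<lambda>i. w i x) \<longlonglongrightarrow> w0 x" and zae: "AE x in lborel. (\<lambda>i. z i x) \<longlonglongrightarrow> z0 x"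
  shows "(\<lambda>i. kernel_form (riesz_kernel \<alpha>) r (w i) (z i)) \<longlonglongrightarrow> kernel_form (riesz_kernel \<alpha>) r w0 z0"
proof -
  obtain k1 k2 :: "'a \<Rightarrow> real" and \<rho>1 \<rho>2 where k: "young_kernel k1 r \<rho>1" "young_kernel k2 r \<rho>2" "\<And>x. riesz_kernel \<alpha> x = k1 x + k2 x"
    "\<rho>1 \<le> r" "\<rho>2 \<le> r" "(r - \<rho>1) * real DIM('a) < 2 * s" "(r - \<rho>2) * real DIM('a) < 2 * s"
    using riesz_kernel_split[OF \<alpha> s r] by metis
  have t: "(\<lambda>i. kernel_form k r (w i) (z i)) \<longlonglongrightarrow> kernel_form k r w0 z0"
    if k: "young_kernel k r \<rho>" "\<rho> \<le> r" "(r - \<rho>) * real DIM('a) < 2 * s" for k :: "'a \<Rightarrow> real" and \<rho>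
  proof -
    note e = young_kernel_exponent[OF k]
    show ?thesis
      by (rule young_kernel.form_tendsto[OF k(1)])
         (use crit_spaceD(1)[OF w(1)] crit_spaceD(1)[OF z(1)] crit_spaceD(1)[OF w(2)] crit_spaceD(1)[OF z(2)]
           crit_space_integrable_powr[OF w(1)] crit_space_integrable_powr[OF z(1)]
           crit_space_integrable_powr[OF w(2)] crit_space_integrable_powr[OF z(2)] e wl[OF e] zl[OF e] wae zae in auto)
  qed
  show ?thesis
    unfolding split_form(2)[OF w(1) z(1) k] split_form(2)[OF w(2) z(2) k]
    by (intro tendsto_add t[OF k(1,4,6)] t[OF k(2,5,7)])
qed

end

subsection \<open>Subsequences\<close>

lemma fatou_limit:
  fixes F :: "nat \<Rightarrow> 'a \<Rightarrow> real"
  assumes F: "\<And>i. integrable M (F i)" "\<And>i x. 0 \<le> F i x" and F0[measurable]: "F0 \<in> borel_measurable M" and pos: "\<And>x. 0 \<le> F0 x"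
    and ae: "AE x in M. (\<lambda>i. F i x) \<longlonglongrightarrow> F0 x"
    and lim: "(\<lambda>i. \<integral>x. F i x \<partial>M) \<longlonglongrightarrow> e"
  shows "integrable M F0" "(\<integral>x. F0 x \<partial>M) \<le> e"
proof -
  have [measurable]: "F i \<in> borel_measurable M" for i using F by auto
  have e: "0 \<le> e" using F(2) by (intro LIMSEQ_le_const[OF lim]) auto
  have "(\<integral>\<^sup>+x. ennreal (F0 x) \<partial>M) = (\<integral>\<^sup>+x. liminf (\<lambda>i. ennreal (F i x)) \<partial>M)"
    by (rule nn_integral_cong_AE) (use ae in eventually_elim, rule lim_imp_Liminf[symmetric], auto intro!: tendsto_ennrealI)
  also have "\<dots> \<le> liminf (\<lambda>i. \<integral>\<^sup>+x. ennreal (F i x) \<partial>M)"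
    by (rule nn_integral_liminf) measurable
  also have "(\<lambda>i. \<integral>\<^sup>+x. ennreal (F i x) \<partial>M) = (\<lambda>i. ennreal (\<integral>x. F i x \<partial>M))"
    using F by (auto simp: nn_integral_eq_integral)
  also have "liminf \<dots> = ennreal e"
    by (rule lim_imp_Liminf) (auto intro!: tendsto_ennrealI lim)
  finally have le: "(\<integral>\<^sup>+x. ennreal (F0 x) \<partial>M) \<le> ennreal e" .
  show i: "integrable M F0"
    by (rule integrableI_nonneg) (use le pos in \<open>auto intro: le_less_trans\<close>)
  show "(\<integral>x. F0 x \<partial>M) \<le> e"
    using le pos e by (subst (asm) nn_integral_eq_integral[OF i]) auto
qed

text \<open>The argument of Riesz and Fischer: along a fast subsequence the squared increments d k
  have integrals at most 8^(-k), so the sum of 4^k d k is integrable and almost everywhere the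
  increments are at most sqrt C 2^(-k). The clause on nonnegativity is pointwise, without an
  exceptional set.\<close>

lemma L2_Cauchy_convergent_subseq:
  fixes f :: "nat \<Rightarrow> 'a \<Rightarrow> real"
  assumes [measurable]: "\<And>i. f i \<in> borel_measurable M"
    and int: "\<And>i l. integrable M (\<lambda>x. (f i x - f l x)\<^sup>2)"
    and cauchy: "\<And>e. 0 < e \<Longrightarrow> \<exists>N. \<forall>i\<ge>N. \<forall>l\<ge>N. (\<integral>x. (f i x - f l x)\<^sup>2 \<partial>M) < e"
  shows "\<exists>r f0. strict_mono (r :: nat \<Rightarrow> nat) \<and> f0 \<in> borel_measurable M \<and> (\<forall>x. (\<forall>i. 0 \<le> f i x) \<longrightarrow> 0 \<le> f0 x) \<and>
    (AE x in M. (\<lambda>i. f (r i) x) \<longlonglongrightarrow> f0 x) \<and>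
    (\<forall>i. integrable M (\<lambda>x. (f i x - f0 x)\<^sup>2)) \<and> (\<lambda>i. \<integral>x. (f (r i) x - f0 x)\<^sup>2 \<partial>M) \<longlonglongrightarrow> 0"
proof -
  have "\<forall>k. \<exists>N. \<forall>i\<ge>N. \<forall>l\<ge>N. (\<integral>x. (f i x - f l x)\<^sup>2 \<partial>M) < (1/8)^k"
    using cauchy by simp
  then obtain N where N: "\<And>k i l. i \<ge> N k \<Longrightarrow> l \<ge> N k \<Longrightarrow> (\<integral>x. (f i x - f l x)\<^sup>2 \<partial>M) < (1/8)^k"
    by metis
  \<comment> \<open>\<open>Suc x\<close> makes the sequence strictly increasing, and
    \<open>N (Suc k)\<close> keeps it beyond the index that the rate (1/8)^k demands.\<close>
  define r where "r = rec_nat (N 0) (\<lambda>k x. max (Suc x) (N (Suc k)))"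
  have r_Suc: "r (Suc k) = max (Suc (r k)) (N (Suc k))" for k by (simp add: r_def)
  have rmono: "strict_mono r" unfolding strict_mono_Suc_iff by (auto simp: r_Suc less_max_iff_disj)
  have rN: "N k \<le> r k" for k by (cases k) (simp_all add: r_def)
  have rle: "r k \<le> r (Suc k)" for k by (simp add: r_Suc)
  define d where "d k x = (f (r (Suc k)) x - f (r k) x)\<^sup>2" for k x
  have dint: "(\<integral>\<^sup>+x. ennreal (d k x) \<partial>M) \<le> ennreal ((1/8)^k)" for k
  proof -
    have "(\<integral>x. d k x \<partial>M) \<le> (1/8)^k"
      unfolding d_def using N[of k "r (Suc k)" "r k"] rN[of k] rle[of k] by simp
    moreover have "(\<integral>\<^sup>+x. ennreal (d k x) \<partial>M) = ennreal (\<integral>x. d k x \<partial>M)"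
      unfolding d_def by (rule nn_integral_eq_integral[OF int]) auto
    ultimately show ?thesis by (simp add: ennreal_leI)
  qed
  have [measurable]: "d k \<in> borel_measurable M" for k unfolding d_def by measurable
  have "(\<integral>\<^sup>+x. (\<Sum>k. ennreal (4^k * d k x)) \<partial>M) = (\<Sum>k. \<integral>\<^sup>+x. ennreal (4^k) * ennreal (d k x) \<partial>M)"
    by (subst nn_integral_suminf) (auto simp: ennreal_mult d_def)
  also have "\<dots> = (\<Sum>k. ennreal (4^k) * (\<integral>\<^sup>+x. ennreal (d k x) \<partial>M))"
    by (simp add: nn_integral_cmult)
  also have "\<dots> \<le> (\<Sum>k. ennreal (1 * (1/2)^k))"
  proof (intro suminf_le allI)
    fix k
    have "ennreal (4^k) * (\<integral>\<^sup>+x. ennreal (d k x) \<partial>M) \<le> ennreal (4^k) * ennreal ((1/8)^k)"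
      by (intro mult_left_mono dint) auto
    also have "\<dots> = ennreal (1 * (1/2)^k)"
      by (simp flip: ennreal_mult power_mult_distrib)
    finally show "ennreal (4^k) * (\<integral>\<^sup>+x. ennreal (d k x) \<partial>M) \<le> ennreal (1 * (1/2)^k)" .
  qed auto
  also have "\<dots> < \<infinity>" by (rule suminf_ennreal_geometric_finite) auto
  finally have "(\<integral>\<^sup>+x. (\<Sum>k. ennreal (4^k * d k x)) \<partial>M) \<noteq> \<infinity>" by simp
  then have "AE x in M. (\<Sum>k. ennreal (4^k * d k x)) \<noteq> \<infinity>"
    by (intro nn_integral_PInf_AE) auto
  then have conv: "AE x in M. convergent (\<lambda>i. f (r i) x)"
  proof eventually_elim
    case (elim x)
    then obtain C where C: "(\<Sum>k. ennreal (4^k * d k x)) = ennreal C" "C \<ge> 0" by (cases "\<Sum>k. ennreal (4^k * d k x)") auto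
    have b: "\<bar>f (r (Suc k)) x - f (r k) x\<bar> \<le> sqrt C * (1/2)^k" for k
    proof -
      have "ennreal (4^k * d k x) \<le> ennreal C" unfolding C(1)[symmetric] by (rule term_le_suminf_ennreal)
      then have "4^k * d k x \<le> C" using C by (simp add: ennreal_le_iff)
      then have "sqrt (4^k * d k x) \<le> sqrt C" by (rule real_sqrt_le_mono)
      moreover have "sqrt (4^k * d k x) = 2^k * \<bar>f (r (Suc k)) x - f (r k) x\<bar>"
      proof -
        have "(4::real)^k = (2^k)\<^sup>2" by (simp add: power2_eq_square flip: power_mult_distrib)
        then have "4^k * d k x = (2^k * (f (r (Suc k)) x - f (r k) x))\<^sup>2"
          by (simp add: d_def power_mult_distrib)
        then show ?thesis by (simp add: abs_mult)
      qed
      ultimately have "2^k * \<bar>f (r (Suc k)) x - f (r k) x\<bar> \<le> sqrt C" by (simp only:)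
      then show ?thesis by (simp add: field_simps power_one_over)
    qed
    have "summable (\<lambda>k. f (r (Suc k)) x - f (r k) x)"
      by (rule summable_comparison_test'[where g="\<lambda>k. sqrt C * (1/2)^k" and N=0]) (use b in \<open>auto intro!: summable_mult summable_geometric\<close>)
    then have "convergent (\<lambda>n. \<Sum>k<n. f (r (Suc k)) x - f (r k) x)" by (simp add: summable_iff_convergent)
    then have "convergent (\<lambda>n. f (r n) x - f (r 0) x)" using sum_lessThan_telescope[of "\<lambda>k. f (r k) x"] by simp
    then have "convergent (\<lambda>n. (f (r n) x - f (r 0) x) + f (r 0) x)" by (intro convergent_add convergent_const)
    then show ?case by simp
  qed
  \<comment> \<open>The default value 0 off the convergence set preserves nonnegativity at every
    point.\<close>
  define f0 where "f0 x = (if Cauchy (\<lambda>i. f (r i) x) then lim (\<lambda>i. f (r i) x) else 0)" for x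
  have f0m[measurable]: "f0 \<in> borel_measurable M" unfolding f0_def by measurable
  have ae: "AE x in M. (\<lambda>i. f (r i) x) \<longlonglongrightarrow> f0 x"
    using conv by eventually_elim (simp add: f0_def Cauchy_convergent_iff convergent_LIMSEQ_iff)
  have pos: "0 \<le> f0 x" if "\<forall>i. 0 \<le> f i x" for x
    using that by (auto simp: f0_def Cauchy_convergent_iff convergent_LIMSEQ_iff intro!: LIMSEQ_le_const)
  \<comment> \<open>Fatou's lemma in the second index: a bound for the distance from
    \<open>f j\<close> to all late terms passes to the limit \<open>f0\<close>. It yields
    integrability for one late j and later the convergence itself.\<close>
  have bnd: "integrable M (\<lambda>x. (f j x - f0 x)\<^sup>2) \<and> (\<integral>x. (f j x - f0 x)\<^sup>2 \<partial>M) \<le> e"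
    if "\<And>l. l \<ge> L \<Longrightarrow> (\<integral>x. (f j x - f l x)\<^sup>2 \<partial>M) \<le> e" for j L e
  proof -
    have e0: "0 \<le> e" using order.trans[OF _ that[of L]] by simp
    have "(\<integral>\<^sup>+x. ennreal ((f j x - f0 x)\<^sup>2) \<partial>M) = (\<integral>\<^sup>+x. liminf (\<lambda>i. ennreal ((f j x - f (r i) x)\<^sup>2)) \<partial>M)"
      by (rule nn_integral_cong_AE) (use ae in eventually_elim, rule lim_imp_Liminf[symmetric], auto intro!: tendsto_intros)
    also have "\<dots> \<le> liminf (\<lambda>i. \<integral>\<^sup>+x. ennreal ((f j x - f (r i) x)\<^sup>2) \<partial>M)"
      by (rule nn_integral_liminf) measurable
    also have "(\<lambda>i. \<integral>\<^sup>+x. ennreal ((f j x - f (r i) x)\<^sup>2) \<partial>M) = (\<lambda>i. ennreal (\<integral>x. (f j x - f (r i) x)\<^sup>2 \<partial>M))"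
      by (intro ext nn_integral_eq_integral int) auto
    also have "liminf \<dots> \<le> ennreal e"
    proof -
      have "\<forall>\<^sub>F i in sequentially. ennreal (\<integral>x. (f j x - f (r i) x)\<^sup>2 \<partial>M) \<le> ennreal e"
        using eventually_ge_at_top[of L]
        by eventually_elim (use that seq_suble[OF rmono] in \<open>auto intro!: ennreal_leI dest: order.trans\<close>)
      then have "liminf (\<lambda>i. ennreal (\<integral>x. (f j x - f (r i) x)\<^sup>2 \<partial>M)) \<le> liminf (\<lambda>i. ennreal e)"
        by (rule Liminf_mono)
      then show ?thesis by (simp add: Liminf_const)
    qed
    finally have le: "(\<integral>\<^sup>+x. ennreal ((f j x - f0 x)\<^sup>2) \<partial>M) \<le> ennreal e" .
    have i: "integrable M (\<lambda>x. (f j x - f0 x)\<^sup>2)"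
      by (rule integrableI_nonneg) (use le in \<open>auto intro: le_less_trans\<close>)
    show ?thesis using le e0 i by (subst (asm) nn_integral_eq_integral[OF i]) auto
  qed
  have i0: "integrable M (\<lambda>x. (f i x - f0 x)\<^sup>2)" for i
  proof -
    obtain N where N: "\<And>j l. j \<ge> N \<Longrightarrow> l \<ge> N \<Longrightarrow> (\<integral>x. (f j x - f l x)\<^sup>2 \<partial>M) < 1" using cauchy[of 1] by auto
    have iN: "integrable M (\<lambda>x. (f N x - f0 x)\<^sup>2)" using bnd[of N N 1] N[of N] by (auto intro: less_imp_le)
    have "integrable M (\<lambda>x. 2 * (f i x - f N x)\<^sup>2 + 2 * (f N x - f0 x)\<^sup>2)" using iN int by simp
    then show ?thesis
    proof (rule Bochner_Integration.integrable_bound)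
      show "AE x in M. norm ((f i x - f0 x)\<^sup>2) \<le> norm (2 * (f i x - f N x)\<^sup>2 + 2 * (f N x - f0 x)\<^sup>2)"
      proof (rule AE_I2)
        fix x
        have "(f i x - f0 x)\<^sup>2 \<le> 2 * (f i x - f N x)\<^sup>2 + 2 * (f N x - f0 x)\<^sup>2"
          using sum_squares_bound[of "f i x - f N x" "f N x - f0 x"] power2_sum[of "f i x - f N x" "f N x - f0 x"] by simp
        then show "norm ((f i x - f0 x)\<^sup>2) \<le> norm (2 * (f i x - f N x)\<^sup>2 + 2 * (f N x - f0 x)\<^sup>2)" by simp
      qed
    qed measurable
  qed
  have "(\<lambda>i. \<integral>x. (f i x - f0 x)\<^sup>2 \<partial>M) \<longlonglongrightarrow> 0"
  proof (rule LIMSEQ_I)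
    fix e :: real assume e: "0 < e"
    obtain N where N: "\<And>j l. j \<ge> N \<Longrightarrow> l \<ge> N \<Longrightarrow> (\<integral>x. (f j x - f l x)\<^sup>2 \<partial>M) < e / 2" using cauchy[of "e/2"] e by auto
    show "\<exists>N. \<forall>i\<ge>N. norm ((\<integral>x. (f i x - f0 x)\<^sup>2 \<partial>M) - 0) < e"
    proof (intro exI allI impI)
      fix i assume "N \<le> i"
      then have "(\<integral>x. (f i x - f0 x)\<^sup>2 \<partial>M) \<le> e / 2" using bnd[of N i "e/2"] N by (auto intro: less_imp_le)
      then show "norm ((\<integral>x. (f i x - f0 x)\<^sup>2 \<partial>M) - 0) < e" using e by simp
    qed
  qed
  from LIMSEQ_subseq_LIMSEQ[OF this rmono] have "(\<lambda>i. \<integral>x. (f (r i) x - f0 x)\<^sup>2 \<partial>M) \<longlonglongrightarrow> 0"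
    by (simp add: o_def)
  then show ?thesis using rmono f0m pos ae i0 by blast
qed

lemma finite_bounded_convergent_subseq:
  fixes f :: "'b \<Rightarrow> nat \<Rightarrow> real"
  assumes "finite P" "\<And>p. p \<in> P \<Longrightarrow> Bseq (f p)"
  shows "\<exists>r. strict_mono (r :: nat \<Rightarrow> nat) \<and> (\<forall>p\<in>P. convergent (\<lambda>i. f p (r i)))"
  using assms
proof (induction P rule: finite_induct)
  case empty
  show ?case by (rule exI[of _ id]) (auto simp: strict_mono_def)
next
  case (insert p P)
  then obtain r where r: "strict_mono r" "\<forall>p\<in>P. convergent (\<lambda>i. f p (r i))" by auto
  have "Bseq (\<lambda>i. f p (r i))" using insert.prems[of p] by (auto simp: Bseq_def)
  then have "bounded (range (\<lambda>i. f p (r i)))" by (simp add: Bseq_eq_bounded)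
  then obtain l r' where r': "strict_mono (r' :: nat \<Rightarrow> nat)" "((\<lambda>i. f p (r i)) \<circ> r') \<longlonglongrightarrow> l"
    using bounded_imp_convergent_subsequence by blast
  have "convergent (\<lambda>i. f q ((r \<circ> r') i))" if "q \<in> insert p P" for q
  proof (cases "q = p")
    case True
    then show ?thesis using r' by (auto simp: o_def convergent_def)
  next
    case False
    then have "convergent (\<lambda>i. f q (r i))" using that r by auto
    then show ?thesis using convergent_subseq_convergent[OF _ r'(1), of "\<lambda>i. f q (r i)"] by (simp add: o_def)
  qed
  then show ?case using strict_mono_o[OF r(1) r'(1)] by blast
qed

lemma countable_bounded_convergent_subseq:
  fixes f :: "nat \<Rightarrow> 'b \<Rightarrow> nat \<Rightarrow> real"
  assumes fin: "\<And>j. finite (P j)" and b: "\<And>j p. p \<in> P j \<Longrightarrow> Bseq (f j p)"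
  shows "\<exists>r. strict_mono (r :: nat \<Rightarrow> nat) \<and> (\<forall>j. \<forall>p\<in>P j. convergent (\<lambda>i. f j p (r i)))"
proof -
  interpret subseqs "\<lambda>j r. \<forall>p\<in>P j. convergent (\<lambda>i. f j p (r i))"
  proof
    fix n and t :: "nat \<Rightarrow> nat" assume "strict_mono t"
    have "\<And>p. p \<in> P n \<Longrightarrow> Bseq (\<lambda>i. f n p (t i))" using b[of _ n] by (simp add: Bseq_def) meson
    from finite_bounded_convergent_subseq[OF fin[of n] this]
    show "\<exists>r'. strict_mono r' \<and> (\<forall>p\<in>P n. convergent (\<lambda>i. f n p ((t \<circ> r') i)))" by simp
  qed
  \<comment> \<open>From index \<open>Suc j\<close> on, the diagonal sequence is a subsequence of
    the one selected at stage \<open>j\<close>, and convergence survives passing to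
    subsequences.\<close>
  have diag: "\<forall>p\<in>P j. convergent (\<lambda>i. f j p ((diagseq \<circ> (+) (Suc j)) i))" for j
  proof (rule diagseq_holds)
    fix r t :: "nat \<Rightarrow> nat" and n
    assume "strict_mono r" "\<forall>p\<in>P n. convergent (\<lambda>i. f n p (t i))"
    then show "\<forall>p\<in>P n. convergent (\<lambda>i. f n p ((t \<circ> r) i))"
      using convergent_subseq_convergent[of "\<lambda>i. f n _ (t i)" r] by (simp add: o_def)
  qed
  then have "convergent (\<lambda>i. f j p (diagseq (i + Suc j)))" if "p \<in> P j" for j p
  proof -
    have "i + Suc j = Suc j + i" for i by simp
    then show ?thesis using diag that by (simp only: o_def)
  qed
  then have "convergent (\<lambda>i. f j p (diagseq i))" if "p \<in> P j" for j p
    using that convergent_ignore_initial_segment[of "\<lambda>i. f j p (diagseq i)" "Suc j"] by blast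
  then show ?thesis using subseq_diagseq by blast
qed

text \<open>Write a as its deviation from the average of w over A plus that average. Jensen bounds
  the square of the deviation by the average of (a - w)^2, and the second term contains w only
  through one linear functional, which is what makes the estimate useful for compactness.\<close>

lemma square_le_average:
  fixes w :: "'a \<Rightarrow> real"
  assumes A[measurable]: "A \<in> sets M" and fin: "emeasure M A < \<infinity>" and m: "0 < measure M A"
    and [measurable]: "w \<in> borel_measurable M" and w2: "integrable M (\<lambda>x. (w x)\<^sup>2)"
  shows "ennreal (a\<^sup>2) \<le> ennreal (2 / measure M A) * (\<integral>\<^sup>+y. ennreal ((a - w y)\<^sup>2) * indicator A y \<partial>M)
     + ennreal (2 * (\<integral>y. indicator A y * w y \<partial>M)\<^sup>2 / (measure M A)\<^sup>2)"
proof -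
  define m where "m = measure M A"
  define W where "W = (\<integral>y. indicator A y * w y \<partial>M)"
  define Q where "Q = (\<integral>y. indicator A y * (w y)\<^sup>2 \<partial>M)"
  have m0: "m > 0" using m by (simp add: m_def)
  have i1: "integrable M (indicator A :: 'a \<Rightarrow> real)" using fin by simp
  have i2: "integrable M (\<lambda>y. indicator A y * (w y)\<^sup>2)"
    by (rule Bochner_Integration.integrable_bound[OF w2]) (auto simp: indicator_def)
  have i3: "integrable M (\<lambda>y. indicator A y * w y)"
  proof (rule Bochner_Integration.integrable_bound)
    show "integrable M (\<lambda>y. indicator A y + indicator A y * (w y)\<^sup>2)" using i1 i2 by simp
    show "AE y in M. norm (indicator A y * w y) \<le> norm (indicator A y + indicator A y * (w y)\<^sup>2)"
    proof (rule AE_I2)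
      fix y
      have "\<bar>w y\<bar> \<le> 1 + (w y)\<^sup>2" using sum_squares_bound[of "\<bar>w y\<bar>" 1] by simp
      then show "norm (indicator A y * w y) \<le> norm (indicator A y + indicator A y * (w y)\<^sup>2)"
        by (simp add: indicator_def)
    qed
  qed measurable
  have ex: "(\<integral>y. indicator A y * (b - w y)\<^sup>2 \<partial>M) = b\<^sup>2 * m - 2 * b * W + Q"
    and ei: "integrable M (\<lambda>y. indicator A y * (b - w y)\<^sup>2)" for b
  proof -
    have e: "(\<lambda>y. indicator A y * (b - w y)\<^sup>2) = (\<lambda>y. b\<^sup>2 * indicator A y - 2 * b * (indicator A y * w y) + indicator A y * (w y)\<^sup>2)"
      by (auto simp: power2_diff algebra_simps)
    show "(\<integral>y. indicator A y * (b - w y)\<^sup>2 \<partial>M) = b\<^sup>2 * m - 2 * b * W + Q"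
      unfolding e using i1 i2 i3 by (simp add: W_def Q_def m_def measure_def)
    show "integrable M (\<lambda>y. indicator A y * (b - w y)\<^sup>2)"
      unfolding e using i1 i2 i3 by simp
  qed
  \<comment> \<open>The expansion at b = W/m, the average of w: its nonnegativity is the
    Cauchy-Schwarz inequality W^2 \<le> m Q.\<close>
  have "0 \<le> (W / m)\<^sup>2 * m - 2 * (W / m) * W + Q" unfolding ex[symmetric] by (simp add: integral_nonneg_AE)
  then have QW: "W\<^sup>2 / m \<le> Q" using m0 by (simp add: power2_eq_square field_simps)
  define D where "D = (\<integral>y. indicator A y * (a - w y)\<^sup>2 \<partial>M)"
  have "(a * m - W)\<^sup>2 / m \<le> D"
    using QW m0 unfolding D_def ex by (simp add: power2_diff power2_eq_square field_simps)
  then have "(a * m - W)\<^sup>2 \<le> m * D" using m0 by (simp add: field_simps)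
  moreover have "(a * m)\<^sup>2 \<le> 2 * (a * m - W)\<^sup>2 + 2 * W\<^sup>2"
    using sum_squares_bound[of "a * m - W" W] power2_sum[of "a * m - W" W] by simp
  ultimately have "a\<^sup>2 * m\<^sup>2 \<le> 2 * m * D + 2 * W\<^sup>2" by (simp add: power_mult_distrib)
  then have le: "a\<^sup>2 \<le> 2 / m * D + 2 * W\<^sup>2 / m\<^sup>2" using m0 by (simp add: field_simps power2_eq_square)
  have D0: "0 \<le> D" by (simp add: D_def)
  have "(\<integral>\<^sup>+y. ennreal ((a - w y)\<^sup>2) * indicator A y \<partial>M) = (\<integral>\<^sup>+y. ennreal (indicator A y * (a - w y)\<^sup>2) \<partial>M)"
    by (intro nn_integral_cong) (auto simp: indicator_def)
  also have "\<dots> = ennreal D" unfolding D_def by (rule nn_integral_eq_integral[OF ei]) auto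
  finally show ?thesis
    using le D0 m0 by (simp add: m_def[symmetric] W_def[symmetric] ennreal_leI flip: ennreal_mult ennreal_plus)
qed

subsection \<open>Fractional Sobolev spaces with a potential\<close>

text \<open>The Borel counterpart of \<open>frac_sobolev_pot\<close>, phrased by Bochner
  integrability on \<open>lborel\<close> and its product so that Fubini and real valued integral
  identities can be used without completions.\<close>

definition borel_sobolev :: "real \<Rightarrow> ('a::euclidean_space \<Rightarrow> real) \<Rightarrow> ('a \<Rightarrow> real) set" where
  "borel_sobolev s V = {u \<in> borel_measurable borel. integrable lborel (\<lambda>x. (u x)\<^sup>2) \<and>
     integrable (lborel \<Otimes>\<^sub>M lborel) (gagliardo_quotient s u u) \<and> integrable lborel (\<lambda>x. V x * (u x)\<^sup>2)}"

abbreviation seminorm :: "real \<Rightarrow> ('a::euclidean_space \<Rightarrow> real) \<Rightarrow> real" where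
  "seminorm s u \<equiv> integral\<^sup>L (lborel \<Otimes>\<^sub>M lborel) (gagliardo_quotient s u u)"

lemma borel_sobolevD:
  assumes "u \<in> borel_sobolev s V"
  shows "u \<in> borel_measurable borel" "integrable lborel (\<lambda>x. (u x)\<^sup>2)"
    "integrable (lborel \<Otimes>\<^sub>M lborel) (gagliardo_quotient s u u)" "integrable lborel (\<lambda>x. V x * (u x)\<^sup>2)"
  using assms by (auto simp: borel_sobolev_def)

lemma gagliardo_energy_eq:
  assumes "u \<in> borel_sobolev s V"
  shows "gagliardo_energy s u = ennreal (seminorm s u)"
  unfolding gagliardo_energy_def
  by (rule nn_integral_eq_integral[OF borel_sobolevD(3)[OF assms]]) (simp add: gagliardo_quotient_nonneg)

lemma seminorm_nonneg: "0 \<le> seminorm s u"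
  by (simp add: integral_nonneg_AE gagliardo_quotient_nonneg)

lemma borel_sobolev_critical_bound:
  fixes u :: "'a::euclidean_space \<Rightarrow> real"
  assumes u: "u \<in> borel_sobolev s V" and s: "0 < s" and c: "0 < c" and mass: "(\<integral>x. (u x)\<^sup>2 \<partial>lborel) \<le> c"
  shows "u \<in> crit_space (2 + 4 * s / real DIM('a))"
    "(\<integral>x. \<bar>u x\<bar> powr (2 + 4 * s / real DIM('a)) \<partial>lborel) \<le>
      4 / unit_ball_vol (real DIM('a)) * (4 * c / unit_ball_vol (real DIM('a))) powr (2 * s / real DIM('a)) * seminorm s u"
proof -
  let ?C = "4 / unit_ball_vol (real DIM('a)) * (4 * c / unit_ball_vol (real DIM('a))) powr (2 * s / real DIM('a))"
  note [measurable] = borel_sobolevD(1)[OF u]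
  have "(\<integral>\<^sup>+y. ennreal ((u y)\<^sup>2) \<partial>lborel) \<le> ennreal c"
    using mass by (subst nn_integral_eq_integral[OF borel_sobolevD(2)[OF u]]) (auto simp: ennreal_leI)
  from gagliardo_nirenberg[OF _ s c this]
  have "(\<integral>\<^sup>+x. ennreal (\<bar>u x\<bar> powr (2 + 4 * s / real DIM('a))) \<partial>lborel) \<le> ennreal ?C * ennreal (seminorm s u)"
    by (simp add: gagliardo_energy_eq[OF u])
  also have "\<dots> = ennreal (?C * seminorm s u)"
    by (rule ennreal_mult[symmetric]) (auto simp: seminorm_nonneg)
  finally have le: "(\<integral>\<^sup>+x. ennreal (\<bar>u x\<bar> powr (2 + 4 * s / real DIM('a))) \<partial>lborel) \<le> ennreal (?C * seminorm s u)" .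
  have i: "integrable lborel (\<lambda>x. \<bar>u x\<bar> powr (2 + 4 * s / real DIM('a)))"
    by (rule integrableI_nonneg) (use le in \<open>auto intro: le_less_trans\<close>)
  then show "u \<in> crit_space (2 + 4 * s / real DIM('a))"
    using borel_sobolevD[OF u] by (simp add: crit_space_def)
  have C: "0 \<le> ?C * seminorm s u" by (intro mult_nonneg_nonneg seminorm_nonneg) auto
  show "(\<integral>x. \<bar>u x\<bar> powr (2 + 4 * s / real DIM('a)) \<partial>lborel) \<le> ?C * seminorm s u"
    using le C by (subst (asm) nn_integral_eq_integral[OF i]) (auto simp: ennreal_le_iff)
qed

lemma borel_sobolev_crit_space:
  fixes u :: "'a::euclidean_space \<Rightarrow> real"
  assumes "u \<in> borel_sobolev s V" "0 < s"
  shows "u \<in> crit_space (2 + 4 * s / real DIM('a))"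
proof (rule borel_sobolev_critical_bound(1)[OF assms])
  \<comment> \<open>The bound for the mass has to be positive although u may vanish almost
    everywhere.\<close>
  show "0 < 1 + (\<integral>x. (u x)\<^sup>2 \<partial>lborel)" by (simp add: add_pos_nonneg)
qed simp

section \<open>Linear structure and contractions of the spaces\<close>

lemma gagliardo_quotient_add_le:
  "gagliardo_quotient s (\<lambda>x. u x + w x) (\<lambda>x. u x + w x) z \<le> 2 * gagliardo_quotient s u u z + 2 * gagliardo_quotient s w w z"
proof -
  obtain x y where z: "z = (x, y)" by (cases z)
  have "((u x + w x) - (u y + w y))\<^sup>2 \<le> 2 * (u x - u y)\<^sup>2 + 2 * (w x - w y)\<^sup>2"
    using sum_squares_bound[of "u x - u y" "w x - w y"] power2_sum[of "u x - u y" "w x - w y"] by (simp add: algebra_simps)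
  from divide_right_mono[OF this, of "norm (x - y) powr (real DIM('a) + 2 * s)"]
  show ?thesis by (simp add: z gagliardo_quotient_def power2_eq_square add_divide_distrib)
qed

text \<open>Stated for normal contractions of u; passing to the absolute value is one.\<close>

lemma borel_sobolev_bound:
  assumes u: "u \<in> borel_sobolev s V" and [measurable]: "v \<in> borel_measurable borel" "V \<in> borel_measurable borel"
    and le: "\<And>x. \<bar>v x\<bar> \<le> \<bar>u x\<bar>" "\<And>x y. \<bar>v x - v y\<bar> \<le> \<bar>u x - u y\<bar>" and V: "\<And>x. 0 \<le> V x"
  shows "v \<in> borel_sobolev s V" "\<And>z. gagliardo_quotient s v v z \<le> gagliardo_quotient s u u z"
proof -
  show gq: "gagliardo_quotient s v v z \<le> gagliardo_quotient s u u z" for z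
  proof -
    obtain x y where z: "z = (x, y)" by (cases z)
    have "(v x - v y)\<^sup>2 \<le> (u x - u y)\<^sup>2" using le(2)[of x y] by (simp add: abs_le_square_iff)
    from divide_right_mono[OF this, of "norm (x - y) powr (real DIM('a) + 2 * s)"]
    show ?thesis by (simp add: z gagliardo_quotient_def power2_eq_square)
  qed
  have sq: "(v x)\<^sup>2 \<le> (u x)\<^sup>2" for x using le(1)[of x] by (simp add: abs_le_square_iff)
  have "integrable lborel (\<lambda>x. (v x)\<^sup>2)"
    by (rule Bochner_Integration.integrable_bound[OF borel_sobolevD(2)[OF u]]) (use sq in auto)
  moreover have "integrable lborel (\<lambda>x. V x * (v x)\<^sup>2)"
    by (rule Bochner_Integration.integrable_bound[OF borel_sobolevD(4)[OF u]]) (use sq V in \<open>auto intro!: AE_I2 mult_left_mono\<close>)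
  moreover have "integrable (lborel \<Otimes>\<^sub>M lborel) (gagliardo_quotient s v v)"
    by (rule Bochner_Integration.integrable_bound[OF borel_sobolevD(3)[OF u]]) (use gq gagliardo_quotient_nonneg[of s v] gagliardo_quotient_nonneg[of s u] in auto)
  ultimately show "v \<in> borel_sobolev s V" by (simp add: borel_sobolev_def)
qed

lemma borel_sobolev_add:
  assumes u: "u \<in> borel_sobolev s V" and w: "w \<in> borel_sobolev s V" and [measurable]: "V \<in> borel_measurable borel" and V: "\<And>x. 0 \<le> V x"
  shows "(\<lambda>x. u x + w x) \<in> borel_sobolev s V"
    "(\<integral>x. V x * (u x + w x)\<^sup>2 \<partial>lborel) \<le> 2 * (\<integral>x. V x * (u x)\<^sup>2 \<partial>lborel) + 2 * (\<integral>x. V x * (w x)\<^sup>2 \<partial>lborel)"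
    "seminorm s (\<lambda>x. u x + w x) \<le> 2 * seminorm s u + 2 * seminorm s w"
proof -
  note [measurable] = borel_sobolevD(1)[OF u] borel_sobolevD(1)[OF w]
  have sq: "(u x + w x)\<^sup>2 \<le> 2 * (u x)\<^sup>2 + 2 * (w x)\<^sup>2" for x
    using sum_squares_bound[of "u x" "w x"] by (simp add: power2_sum)
  have Vsq: "V x * (u x + w x)\<^sup>2 \<le> 2 * (V x * (u x)\<^sup>2) + 2 * (V x * (w x)\<^sup>2)" for x
    using mult_left_mono[OF sq V] by (simp add: algebra_simps)
  have i2: "integrable lborel (\<lambda>x. (u x + w x)\<^sup>2)"
    by (rule Bochner_Integration.integrable_bound[of _ "\<lambda>x. 2 * (u x)\<^sup>2 + 2 * (w x)\<^sup>2"])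
       (use borel_sobolevD[OF u] borel_sobolevD[OF w] sq in \<open>auto intro!: AE_I2\<close>)
  have i4: "integrable lborel (\<lambda>x. V x * (u x + w x)\<^sup>2)"
    by (rule Bochner_Integration.integrable_bound[of _ "\<lambda>x. 2 * (V x * (u x)\<^sup>2) + 2 * (V x * (w x)\<^sup>2)"])
       (use borel_sobolevD[OF u] borel_sobolevD[OF w] Vsq V in \<open>auto intro!: AE_I2\<close>)
  have i3: "integrable (lborel \<Otimes>\<^sub>M lborel) (gagliardo_quotient s (\<lambda>x. u x + w x) (\<lambda>x. u x + w x))"
    by (rule Bochner_Integration.integrable_bound[of _ "\<lambda>z. 2 * gagliardo_quotient s u u z + 2 * gagliardo_quotient s w w z"])
       (use borel_sobolevD[OF u] borel_sobolevD[OF w] gagliardo_quotient_add_le[of s u w] in \<open>auto intro!: AE_I2 simp: gagliardo_quotient_nonneg\<close>)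
  show "(\<lambda>x. u x + w x) \<in> borel_sobolev s V" using i2 i3 i4 by (simp add: borel_sobolev_def)
  have "(\<integral>x. V x * (u x + w x)\<^sup>2 \<partial>lborel) \<le> (\<integral>x. 2 * (V x * (u x)\<^sup>2) + 2 * (V x * (w x)\<^sup>2) \<partial>lborel)"
    by (intro integral_mono i4) (use borel_sobolevD[OF u] borel_sobolevD[OF w] Vsq in auto)
  then show "(\<integral>x. V x * (u x + w x)\<^sup>2 \<partial>lborel) \<le> 2 * (\<integral>x. V x * (u x)\<^sup>2 \<partial>lborel) + 2 * (\<integral>x. V x * (w x)\<^sup>2 \<partial>lborel)"
    using borel_sobolevD[OF u] borel_sobolevD[OF w] by simp
  have "seminorm s (\<lambda>x. u x + w x) \<le> (\<integral>z. 2 * gagliardo_quotient s u u z + 2 * gagliardo_quotient s w w z \<partial>(lborel \<Otimes>\<^sub>M lborel))"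
    by (intro integral_mono i3) (use borel_sobolevD[OF u] borel_sobolevD[OF w] gagliardo_quotient_add_le[of s u w] in auto)
  then show "seminorm s (\<lambda>x. u x + w x) \<le> 2 * seminorm s u + 2 * seminorm s w"
    using borel_sobolevD[OF u] borel_sobolevD[OF w] by simp
qed

lemma gagliardo_quotient_scale:
  "gagliardo_quotient s (\<lambda>x. c * u x) (\<lambda>x. c * u x) z = c\<^sup>2 * gagliardo_quotient s u u z"
  by (simp add: gagliardo_quotient_def split_beta power2_eq_square algebra_simps)

lemma borel_sobolev_scale:
  assumes u: "u \<in> borel_sobolev s V"
  shows "(\<lambda>x. c * u x) \<in> borel_sobolev s V" "seminorm s (\<lambda>x. c * u x) = c\<^sup>2 * seminorm s u"
    "(\<integral>x. V x * (c * u x)\<^sup>2 \<partial>lborel) = c\<^sup>2 * (\<integral>x. V x * (u x)\<^sup>2 \<partial>lborel)"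
proof -
  have eq: "gagliardo_quotient s (\<lambda>x. c * u x) (\<lambda>x. c * u x) = (\<lambda>z. c\<^sup>2 * gagliardo_quotient s u u z)"
    by (rule ext) (rule gagliardo_quotient_scale)
  have e2: "(\<lambda>x. V x * (c * u x)\<^sup>2) = (\<lambda>x. c\<^sup>2 * (V x * (u x)\<^sup>2))" by (simp add: power_mult_distrib mult_ac)
  have "integrable (lborel \<Otimes>\<^sub>M lborel) (gagliardo_quotient s (\<lambda>x. c * u x) (\<lambda>x. c * u x))"
    unfolding eq using borel_sobolevD[OF u] by simp
  moreover have "integrable lborel (\<lambda>x. V x * (c * u x)\<^sup>2)"
    unfolding e2 using borel_sobolevD[OF u] by simp
  moreover have "integrable lborel (\<lambda>x. (c * u x)\<^sup>2)"
    using borel_sobolevD[OF u] by (simp add: power_mult_distrib)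
  ultimately show "(\<lambda>x. c * u x) \<in> borel_sobolev s V"
    using borel_sobolevD[OF u] by (simp only: borel_sobolev_def mem_Collect_eq) simp
  show "seminorm s (\<lambda>x. c * u x) = c\<^sup>2 * seminorm s u" unfolding eq by simp
  show "(\<integral>x. V x * (c * u x)\<^sup>2 \<partial>lborel) = c\<^sup>2 * (\<integral>x. V x * (u x)\<^sup>2 \<partial>lborel)" unfolding e2 by simp
qed

text \<open>Covering a ball by finitely many small balls and comparing \<open>w\<close> with its averages over these
  controls the \<open>L\<^sup>2\<close> norm by the seminorm and finitely many linear functionals of \<open>w\<close>.\<close>

lemma local_L2_estimate:
  fixes w :: "'a::euclidean_space \<Rightarrow> real"
  defines "n \<equiv> real DIM('a)"
  assumes [measurable]: "w \<in> borel_measurable borel" and w2: "integrable lborel (\<lambda>x. (w x)\<^sup>2)"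
    and s: "0 < s" and \<delta>: "0 < \<delta>" and P: "finite P" "cball 0 R \<subseteq> (\<Union>p\<in>P. ball p \<delta>)"
    and m: "m = measure lborel (ball (0::'a) \<delta>)"
  shows "(\<integral>\<^sup>+x. ennreal ((w x)\<^sup>2) * indicator (cball 0 R) x \<partial>lborel) \<le>
     ennreal (2 / m * (2 * \<delta>) powr (n + 2 * s)) * gagliardo_energy s w
     + ennreal ((\<Sum>p\<in>P. 2 * (\<integral>y. indicator (ball p \<delta>) y * w y \<partial>lborel)\<^sup>2 / m\<^sup>2) * measure lborel (cball (0::'a) R))"
proof -
  have m0: "0 < m" using \<delta> by (simp add: m)
  have mp: "measure lborel (ball p \<delta>) = m" for p :: 'a
    using \<delta> by (simp add: m content_ball)
  have n0: "0 \<le> n" by (simp add: n_def)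
  define S where "S = (\<Sum>p\<in>P. 2 * (\<integral>y. indicator (ball p \<delta>) y * w y \<partial>lborel)\<^sup>2 / m\<^sup>2)"
  have S0: "0 \<le> S" unfolding S_def by (intro sum_nonneg) auto
  have ms[measurable]: "(\<lambda>x::'a. ennreal S * indicator (cball 0 R) x) \<in> borel_measurable borel"
    by (intro borel_measurable_times_ennreal borel_measurable_indicator) auto
  have "(\<integral>\<^sup>+x. ennreal ((w x)\<^sup>2) * indicator (cball 0 R) x \<partial>lborel) \<le>
    (\<integral>\<^sup>+x. ennreal (2 / m * (2 * \<delta>) powr (n + 2 * s)) * (\<integral>\<^sup>+y. ennreal ((w x - w y)\<^sup>2 / norm (x - y) powr (n + 2 * s)) \<partial>lborel)
       + ennreal S * indicator (cball 0 R) x \<partial>lborel)"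
  proof (rule nn_integral_mono)
    fix x :: 'a
    show "ennreal ((w x)\<^sup>2) * indicator (cball 0 R) x \<le> ennreal (2 / m * (2 * \<delta>) powr (n + 2 * s)) * (\<integral>\<^sup>+y. ennreal ((w x - w y)\<^sup>2 / norm (x - y) powr (n + 2 * s)) \<partial>lborel)
       + ennreal S * indicator (cball 0 R) x"
    proof (cases "x \<in> cball 0 R")
      case True
      then obtain p where p: "p \<in> P" "x \<in> ball p \<delta>" using P by auto
      have "ennreal ((w x)\<^sup>2) \<le> ennreal (2 / m) * (\<integral>\<^sup>+y. ennreal ((w x - w y)\<^sup>2) * indicator (ball p \<delta>) y \<partial>lborel)
         + ennreal (2 * (\<integral>y. indicator (ball p \<delta>) y * w y \<partial>lborel)\<^sup>2 / m\<^sup>2)"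
        using square_le_average[of "ball p \<delta>" lborel w "w x"] m0 w2 \<delta>
        by (simp add: mp emeasure_ball)
      also have "(\<integral>\<^sup>+y. ennreal ((w x - w y)\<^sup>2) * indicator (ball p \<delta>) y \<partial>lborel) \<le>
         (\<integral>\<^sup>+y. ennreal ((2 * \<delta>) powr (n + 2 * s)) * ennreal ((w x - w y)\<^sup>2 / norm (x - y) powr (n + 2 * s)) \<partial>lborel)"
      proof (rule nn_integral_mono)
        fix y
        show "ennreal ((w x - w y)\<^sup>2) * indicator (ball p \<delta>) y \<le> ennreal ((2 * \<delta>) powr (n + 2 * s)) * ennreal ((w x - w y)\<^sup>2 / norm (x - y) powr (n + 2 * s))"
        proof (cases "y \<in> ball p \<delta> \<and> x \<noteq> y")
          case True
          have "norm (x - y) \<le> 2 * \<delta>"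
            using p True norm_triangle_ineq[of "x - p" "p - y"] by (simp add: dist_norm norm_minus_commute)
          then have "norm (x - y) powr (n + 2 * s) \<le> (2 * \<delta>) powr (n + 2 * s)"
            using n0 s by (intro powr_mono2) auto
          then have "(w x - w y)\<^sup>2 * norm (x - y) powr (n + 2 * s) \<le> (2 * \<delta>) powr (n + 2 * s) * (w x - w y)\<^sup>2"
            by (subst mult.commute, intro mult_right_mono) auto
          then have "(w x - w y)\<^sup>2 \<le> (2 * \<delta>) powr (n + 2 * s) * ((w x - w y)\<^sup>2 / norm (x - y) powr (n + 2 * s))"
            using True by (simp add: field_simps)
          then show ?thesis using True by (simp flip: ennreal_mult add: ennreal_leI)
        qed auto
      qed
      also have "\<dots> = ennreal ((2 * \<delta>) powr (n + 2 * s)) * (\<integral>\<^sup>+y. ennreal ((w x - w y)\<^sup>2 / norm (x - y) powr (n + 2 * s)) \<partial>lborel)"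
        by (rule nn_integral_cmult) measurable
      \<comment> \<open>The ball that contains x varies with x; bounding its summand by the sum over
        all centres gives a constant independent of x.\<close>
      also have "2 * (\<integral>y. indicator (ball p \<delta>) y * w y \<partial>lborel)\<^sup>2 / m\<^sup>2 \<le> S"
        unfolding S_def by (rule member_le_sum[OF p(1)]) (use P in auto)
      finally show ?thesis using True m0
        by (simp add: mult.assoc[symmetric] mult_left_mono add_mono ennreal_leI flip: ennreal_mult)
    qed simp
  qed
  also have "\<dots> = ennreal (2 / m * (2 * \<delta>) powr (n + 2 * s)) * gagliardo_energy s w + ennreal S * emeasure lborel (cball (0::'a) R)"
    by (subst nn_integral_add) (simp_all add: nn_integral_cmult nn_integral_cmult_indicator gagliardo_energy_iterated n_def)
  also have "emeasure lborel (cball (0::'a) R) = ennreal (measure lborel (cball (0::'a) R))"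
    by (rule emeasure_eq_ennreal_measure) (use emeasure_lborel_cball_finite[of "0::'a" R] in \<open>simp add: less_top\<close>)
  finally show ?thesis using S0 by (simp add: S_def[symmetric] ennreal_mult)
qed


text \<open>Outside the ball of radius R the inequality V \<ge> L turns mass into potential energy
  divided by L; inside, the local estimate applies. On bounded sequences a small \<delta> makes the
  first term small and a large L the last, so only finitely many linear functionals of w
  remain.\<close>

lemma global_L2_estimate:
  fixes w :: "'a::euclidean_space \<Rightarrow> real"
  defines "n \<equiv> real DIM('a)"
  assumes w: "w \<in> borel_sobolev s V" and [measurable]: "V \<in> borel_measurable borel" and V: "\<And>x. 0 \<le> V x"
    and s: "0 < s" and \<delta>: "0 < \<delta>" and P: "finite P" "cball 0 R \<subseteq> (\<Union>p\<in>P. ball p \<delta>)"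
    and m: "m = measure lborel (ball (0::'a) \<delta>)"
    and L: "0 < L" "AE x in lborel. R \<le> norm x \<longrightarrow> L \<le> V x"
  shows "(\<integral>x. (w x)\<^sup>2 \<partial>lborel) \<le> 2 / m * (2 * \<delta>) powr (n + 2 * s) * seminorm s w
     + (\<Sum>p\<in>P. 2 * (\<integral>y. indicator (ball p \<delta>) y * w y \<partial>lborel)\<^sup>2 / m\<^sup>2) * measure lborel (cball (0::'a) R)
     + (\<integral>x. V x * (w x)\<^sup>2 \<partial>lborel) / L"
proof -
  let ?S = "(\<Sum>p\<in>P. 2 * (\<integral>y. indicator (ball p \<delta>) y * w y \<partial>lborel)\<^sup>2 / m\<^sup>2) * measure lborel (cball (0::'a) R)"
  note [measurable] = borel_sobolevD(1)[OF w]
  have m0: "0 < m" using \<delta> by (simp add: m content_ball)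
  have S0: "0 \<le> ?S" by (intro mult_nonneg_nonneg sum_nonneg) auto
  have A0: "0 \<le> 2 / m * (2 * \<delta>) powr (n + 2 * s) * seminorm s w" using m0 by (intro mult_nonneg_nonneg seminorm_nonneg) auto
  have C0: "0 \<le> (\<integral>x. V x * (w x)\<^sup>2 \<partial>lborel) / L" using L V by (simp add: integral_nonneg_AE)
  have [measurable]: "(\<lambda>x. ennreal ((w x)\<^sup>2) * indicator (cball 0 R) x) \<in> borel_measurable borel"
    by (intro borel_measurable_times_ennreal borel_measurable_indicator) auto
  have "ennreal (\<integral>x. (w x)\<^sup>2 \<partial>lborel) = (\<integral>\<^sup>+x. ennreal ((w x)\<^sup>2) \<partial>lborel)"
    by (rule nn_integral_eq_integral[OF borel_sobolevD(2)[OF w], symmetric]) simp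
  also have "\<dots> \<le> (\<integral>\<^sup>+x. ennreal ((w x)\<^sup>2) * indicator (cball 0 R) x + ennreal (V x * (w x)\<^sup>2 / L) \<partial>lborel)"
  proof (rule nn_integral_mono_AE, use L(2) in eventually_elim)
    case (elim x)
    show ?case
    proof (cases "x \<in> cball 0 R")
      case False
      then have "L \<le> V x" using elim by simp
      then have "(w x)\<^sup>2 \<le> V x * (w x)\<^sup>2 / L"
        using L(1) mult_right_mono[of L "V x" "(w x)\<^sup>2"] by (simp add: field_simps)
      then show ?thesis using False by (simp add: ennreal_leI)
    qed simp
  qed
  also have "\<dots> = (\<integral>\<^sup>+x. ennreal ((w x)\<^sup>2) * indicator (cball 0 R) x \<partial>lborel) + (\<integral>\<^sup>+x. ennreal (V x * (w x)\<^sup>2 / L) \<partial>lborel)"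
    by (rule nn_integral_add) simp_all
  also have "(\<integral>\<^sup>+x. ennreal (V x * (w x)\<^sup>2 / L) \<partial>lborel) = ennreal ((\<integral>x. V x * (w x)\<^sup>2 \<partial>lborel) / L)"
    by (subst nn_integral_eq_integral) (use borel_sobolevD(4)[OF w] L V in auto)
  also have "(\<integral>\<^sup>+x. ennreal ((w x)\<^sup>2) * indicator (cball 0 R) x \<partial>lborel) \<le>
     ennreal (2 / m * (2 * \<delta>) powr (n + 2 * s)) * gagliardo_energy s w + ennreal ?S"
    unfolding n_def by (rule local_L2_estimate[OF _ borel_sobolevD(2)[OF w] s \<delta> P m]) simp
  also have "ennreal (2 / m * (2 * \<delta>) powr (n + 2 * s)) * gagliardo_energy s w = ennreal (2 / m * (2 * \<delta>) powr (n + 2 * s) * seminorm s w)"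
    unfolding gagliardo_energy_eq[OF w] using m0 by (intro ennreal_mult[symmetric] seminorm_nonneg) auto
  finally have "ennreal (\<integral>x. (w x)\<^sup>2 \<partial>lborel) \<le> ennreal (2 / m * (2 * \<delta>) powr (n + 2 * s) * seminorm s w) + ennreal ?S + ennreal ((\<integral>x. V x * (w x)\<^sup>2 \<partial>lborel) / L)"
    by (simp add: add_mono)
  also have "\<dots> = ennreal (2 / m * (2 * \<delta>) powr (n + 2 * s) * seminorm s w + ?S + (\<integral>x. V x * (w x)\<^sup>2 \<partial>lborel) / L)"
    using A0 S0 C0 by (simp only: ennreal_plus add_nonneg_nonneg)
  finally show ?thesis
    using A0 S0 C0 by (subst (asm) ennreal_le_iff) (intro add_nonneg_nonneg)
qed

section \<open>Compactness in L^2\<close>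

lemma borel_sobolev_diff:
  assumes u: "u \<in> borel_sobolev s V" and w: "w \<in> borel_sobolev s V" and V: "V \<in> borel_measurable borel" "\<And>x. 0 \<le> V x"
  shows "(\<lambda>x. u x - w x) \<in> borel_sobolev s V"
    "(\<integral>x. V x * (u x - w x)\<^sup>2 \<partial>lborel) \<le> 2 * (\<integral>x. V x * (u x)\<^sup>2 \<partial>lborel) + 2 * (\<integral>x. V x * (w x)\<^sup>2 \<partial>lborel)"
    "seminorm s (\<lambda>x. u x - w x) \<le> 2 * seminorm s u + 2 * seminorm s w"
  using borel_sobolev_add[OF u borel_sobolev_scale(1)[OF w, of "-1"] V] borel_sobolev_scale(2,3)[OF w, of "-1"] by simp_all

text \<open>The global estimate is applied to differences of the sequence. For given e one fixes L,
  then the scale j, and then waits until the finitely many averages at scale j are close. The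
  subsequence is chosen before e, hence the diagonal extraction over all scales.\<close>

lemma relatively_compact_L2:
  fixes u :: "nat \<Rightarrow> 'a::euclidean_space \<Rightarrow> real"
  assumes V[measurable]: "V \<in> borel_measurable borel" and V0: "\<And>x. 0 \<le> V x"
    and tail: "\<And>L. \<exists>R. AE x in lborel. R \<le> norm x \<longrightarrow> L \<le> V x"
    and s: "0 < s" and u: "\<And>i. u i \<in> borel_sobolev s V"
    and mass: "\<And>i. (\<integral>x. (u i x)\<^sup>2 \<partial>lborel) \<le> c"
    and B: "\<And>i. seminorm s (u i) \<le> B" "\<And>i. (\<integral>x. V x * (u i x)\<^sup>2 \<partial>lborel) \<le> B"
  shows "\<exists>r. strict_mono (r :: nat \<Rightarrow> nat) \<and>
    (\<forall>e>0. \<exists>N. \<forall>i\<ge>N. \<forall>l\<ge>N. (\<integral>x. (u (r i) x - u (r l) x)\<^sup>2 \<partial>lborel) < e)"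
proof -
  note [measurable] = borel_sobolevD(1)[OF u]
  have B0: "0 \<le> B" using B(1)[of 0] seminorm_nonneg[of s "u 0"] by linarith
  define n where "n = real DIM('a)"
  \<comment> \<open>One index controls both the radius of the covering balls and the radius j of the
    ball covered, so countably many finite families of averages suffice.\<close>
  define \<delta> where "\<delta> j = 1 / (real j + 1)" for j :: nat
  have \<delta>0: "0 < \<delta> j" for j by (simp add: \<delta>_def)
  have "\<exists>k. finite k \<and> cball (0::'a) (real j) \<subseteq> (\<Union>x\<in>k. ball x (\<delta> j))" for j
    using compact_cball[of "0::'a" "real j"] \<delta>0[of j] unfolding compact_eq_totally_bounded by blast
  then obtain P where P: "\<And>j. finite (P j)" "\<And>j. cball (0::'a) (real j) \<subseteq> (\<Union>x\<in>P j. ball x (\<delta> j))"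
    by metis
  define W where "W j p i = (\<integral>y. indicator (ball p (\<delta> j)) y * u i y \<partial>lborel)" for j p i
  define m where "m j = measure lborel (ball (0::'a) (\<delta> j))" for j
  have m0: "0 < m j" for j using \<delta>0[of j] by (simp add: m_def content_ball)
  have mp: "measure lborel (ball p (\<delta> j)) = m j" for p :: 'a and j
    using \<delta>0[of j] by (simp add: m_def content_ball)
  have ii: "integrable lborel (indicator (ball p d) :: 'a \<Rightarrow> real)" for p d
    using emeasure_lborel_ball_finite[of p d] by (intro integrable_real_indicator) auto
  have iw2: "integrable lborel (\<lambda>y. indicator (ball p d) y * (u i y)\<^sup>2)" for p d i
    by (rule Bochner_Integration.integrable_bound[OF borel_sobolevD(2)[OF u[of i]]]) (auto simp: indicator_def intro!: borel_measurable_times borel_measurable_indicator)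
  have bd: "norm (indicator (ball p d) y * u i y) \<le> indicator (ball p d) y + indicator (ball p d) y * (u i y)\<^sup>2" for p :: 'a and d y i
    using sum_squares_bound[of "\<bar>u i y\<bar>" 1] by (auto simp: indicator_def)
  have mi: "(\<lambda>y. indicator (ball p d) y * u i y) \<in> borel_measurable lborel" for p :: 'a and d i
    by (simp, intro borel_measurable_times borel_measurable_indicator) auto
  have iw: "integrable lborel (\<lambda>y. indicator (ball p d) y * u i y)" for p :: 'a and d i
    by (rule Bochner_Integration.integrable_bound[OF Bochner_Integration.integrable_add[OF ii iw2] mi])
       (use bd in \<open>auto intro!: AE_I2 order.trans[OF bd]\<close>)
  have "Bseq (W j p)" if "p \<in> P j" for j p
  proof (rule BseqI')
    fix i
    have "norm (W j p i) \<le> (\<integral>y. norm (indicator (ball p (\<delta> j)) y * u i y) \<partial>lborel)"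
      unfolding W_def by (rule integral_norm_bound)
    also have "\<dots> \<le> (\<integral>y. indicator (ball p (\<delta> j)) y + (u i y)\<^sup>2 \<partial>lborel)"
    proof (rule integral_mono)
      fix y show "norm (indicator (ball p (\<delta> j)) y * u i y) \<le> indicator (ball p (\<delta> j)) y + (u i y)\<^sup>2"
        using bd[of p "\<delta> j" y i] by (auto simp: indicator_def split: if_splits)
    qed (use iw ii borel_sobolevD(2)[OF u[of i]] in auto)
    also have "\<dots> \<le> m j + c" using ii borel_sobolevD(2)[OF u[of i]] mass[of i] by (simp add: mp)
    finally show "norm (W j p i) \<le> m j + c" .
  qed
  from countable_bounded_convergent_subseq[of P W, OF P(1) this]
  obtain r where r: "strict_mono (r :: nat \<Rightarrow> nat)" "\<And>j p. p \<in> P j \<Longrightarrow> convergent (\<lambda>i. W j p (r i))" by blast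
  have "\<exists>N. \<forall>i\<ge>N. \<forall>l\<ge>N. (\<integral>x. (u (r i) x - u (r l) x)\<^sup>2 \<partial>lborel) < e" if e: "0 < e" for e
  proof -
    \<comment> \<open>A difference of two terms has seminorm and potential energy at most 2B + 2B.
      The choice makes 4B/L less than e/3, and the summand 1 keeps L positive when B = 0.\<close>
    define L where "L = 12 * B / e + 1"
    have L: "0 < L" "4 * B / L < e / 3" using B0 e by (simp_all add: L_def field_simps add_pos_nonneg)
    obtain R where R: "AE x in lborel. R \<le> norm x \<longrightarrow> L \<le> V x" using tail by blast
    have lim: "(\<lambda>j. 2 / m j * (2 * \<delta> j) powr (n + 2 * s) * (4 * B)) \<longlonglongrightarrow> 0"
    proof -
      \<comment> \<open>\<open>m j\<close> is proportional to (\<delta> j)^n, which cancels this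
        part of the power and leaves (\<delta> j)^(2s).\<close>
      have eq: "2 / m j * (2 * \<delta> j) powr (n + 2 * s) * (4 * B) = 8 * B * 2 powr (n + 2 * s) / unit_ball_vol n * (1 / (real j + 1)) powr (2 * s)" for j
      proof -
        have "m j = unit_ball_vol n * \<delta> j powr n" using \<delta>0[of j] by (simp add: m_def content_ball n_def powr_realpow)
        moreover have "(2 * \<delta> j) powr (n + 2 * s) = 2 powr (n + 2 * s) * \<delta> j powr n * \<delta> j powr (2 * s)"
          using \<delta>0[of j] by (simp add: powr_mult powr_add)
        ultimately show ?thesis using \<delta>0[of j] by (simp add: \<delta>_def)
      qed
      have l: "(\<lambda>j. (1 / (real j + 1)) powr (2 * s)) \<longlonglongrightarrow> 0"
      proof (rule tendsto_zero_powrI[where b="2 * s"])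
        show "(\<lambda>j. 1 / (real j + 1)) \<longlonglongrightarrow> 0"
          using LIMSEQ_Suc[OF lim_const_over_n[of 1]] by (simp add: add.commute)
      qed (use s in auto)
      show ?thesis unfolding eq by (rule tendsto_mult_right_zero[OF l])
    qed
    have "\<forall>\<^sub>F j in sequentially. 2 / m j * (2 * \<delta> j) powr (n + 2 * s) * (4 * B) < e / 3 \<and> R \<le> real j"
      using order_tendstoD(2)[OF lim, of "e/3"] e filterlim_at_top[THEN iffD1, OF filterlim_real_sequentially, rule_format, of R]
      by (simp add: eventually_conj_iff)
    then obtain j where j: "2 / m j * (2 * \<delta> j) powr (n + 2 * s) * (4 * B) < e / 3" "R \<le> real j"
      using eventually_happens'[OF sequentially_bot] by blast
    define K where "K = real (card (P j)) * (2 / (m j)\<^sup>2) * measure lborel (cball (0::'a) (real j))"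
    have K0: "0 \<le> K" by (simp add: K_def)
    \<comment> \<open>\<open>K\<close> gathers everything in the middle term that is constant once j
      is fixed; then K \<eta>^2 = K e / (3 (K+1)) is below the last third of e.\<close>
    define \<eta> where "\<eta> = sqrt (e / (3 * (K + 1)))"
    have \<eta>: "0 < \<eta>" "K * \<eta>\<^sup>2 < e / 3" using e K0 by (simp_all add: \<eta>_def field_simps)
    have "\<forall>\<^sub>F N in sequentially. \<forall>p\<in>P j. \<forall>i\<ge>N. \<forall>l\<ge>N. \<bar>W j p (r i) - W j p (r l)\<bar> < \<eta>"
    proof (rule eventually_ball_finite[OF P(1)], intro ballI)
      fix p assume "p \<in> P j"
      then have "Cauchy (\<lambda>i. W j p (r i))" using r(2) by (simp add: Cauchy_convergent_iff)
      then obtain N where "\<forall>i\<ge>N. \<forall>l\<ge>N. \<bar>W j p (r i) - W j p (r l)\<bar> < \<eta>"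
        using \<eta>(1) unfolding Cauchy_def dist_real_def by blast
      then show "\<forall>\<^sub>F N in sequentially. \<forall>i\<ge>N. \<forall>l\<ge>N. \<bar>W j p (r i) - W j p (r l)\<bar> < \<eta>"
        unfolding eventually_sequentially by (meson order.trans)
    qed
    then obtain N where N: "\<And>p i l. p \<in> P j \<Longrightarrow> i \<ge> N \<Longrightarrow> l \<ge> N \<Longrightarrow> \<bar>W j p (r i) - W j p (r l)\<bar> < \<eta>"
      using eventually_happens'[OF sequentially_bot] by blast
    show ?thesis
    proof (intro exI allI impI)
      fix i l assume i: "N \<le> i" and l: "N \<le> l"
      let ?w = "\<lambda>x. u (r i) x - u (r l) x"
      note d = borel_sobolev_diff[OF u[of "r i"] u[of "r l"] V V0]
      have Rj: "AE x in lborel. real j \<le> norm x \<longrightarrow> L \<le> V x" using R j(2) by (auto elim!: eventually_mono)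
      have Ww: "(\<integral>y. indicator (ball p (\<delta> j)) y * ?w y \<partial>lborel) = W j p (r i) - W j p (r l)" for p
        unfolding W_def using iw by (simp add: right_diff_distrib)
      have "(\<integral>x. (?w x)\<^sup>2 \<partial>lborel) \<le> 2 / m j * (2 * \<delta> j) powr (n + 2 * s) * seminorm s ?w
       + (\<Sum>p\<in>P j. 2 * (\<integral>y. indicator (ball p (\<delta> j)) y * ?w y \<partial>lborel)\<^sup>2 / (m j)\<^sup>2) * measure lborel (cball (0::'a) (real j))
       + (\<integral>x. V x * (?w x)\<^sup>2 \<partial>lborel) / L"
        unfolding n_def by (rule global_L2_estimate[OF d(1) V V0 s \<delta>0 P m_def L(1) Rj])
      also have "2 / m j * (2 * \<delta> j) powr (n + 2 * s) * seminorm s ?w \<le> 2 / m j * (2 * \<delta> j) powr (n + 2 * s) * (4 * B)"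
        using d(3) B(1)[of "r i"] B(1)[of "r l"] less_imp_le[OF m0[of j]] by (intro mult_left_mono) auto
      also have "(\<Sum>p\<in>P j. 2 * (\<integral>y. indicator (ball p (\<delta> j)) y * ?w y \<partial>lborel)\<^sup>2 / (m j)\<^sup>2) * measure lborel (cball (0::'a) (real j))
         \<le> (\<Sum>p\<in>P j. 2 * \<eta>\<^sup>2 / (m j)\<^sup>2) * measure lborel (cball (0::'a) (real j))"
      proof (intro mult_right_mono sum_mono divide_right_mono mult_left_mono)
        fix p assume p: "p \<in> P j"
        show "(\<integral>y. indicator (ball p (\<delta> j)) y * ?w y \<partial>lborel)\<^sup>2 \<le> \<eta>\<^sup>2"
          unfolding Ww using N[OF p i l] \<eta>(1) by (simp add: abs_le_square_iff[symmetric])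
      qed auto
      also have "\<dots> = K * \<eta>\<^sup>2" by (simp add: K_def)
      also have "(\<integral>x. V x * (?w x)\<^sup>2 \<partial>lborel) / L \<le> 4 * B / L"
        using d(2) B(2)[of "r i"] B(2)[of "r l"] L(1) by (intro divide_right_mono) auto
      finally show "(\<integral>x. (?w x)\<^sup>2 \<partial>lborel) < e" using j(1) \<eta>(2) L(2) by simp
    qed
  qed
  then show ?thesis using r(1) by blast
qed

text \<open>The limits \<open>e1\<close> and \<open>e2\<close> of the two energies are kept apart
  from the energies of \<open>u0\<close>: only lower semicontinuity holds for the quadratic parts,
  whereas masses and subcritical powers converge.\<close>

theorem borel_sobolev_compact_embedding:
  fixes u :: "nat \<Rightarrow> 'a::euclidean_space \<Rightarrow> real"
  assumes V[measurable]: "V \<in> borel_measurable borel" and V0: "\<And>x. 0 \<le> V x"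
    and tail: "\<And>L. \<exists>R. AE x in lborel. R \<le> norm x \<longrightarrow> L \<le> V x"
    and s: "0 < s" and u: "\<And>i. u i \<in> borel_sobolev s V"
    and mass: "\<And>i. (\<integral>x. (u i x)\<^sup>2 \<partial>lborel) = c" and pos: "\<And>i x. 0 \<le> u i x"
    and B: "\<And>i. seminorm s (u i) \<le> B" "\<And>i. (\<integral>x. V x * (u i x)\<^sup>2 \<partial>lborel) \<le> B"
  obtains r u0 e1 e2 where "strict_mono (r :: nat \<Rightarrow> nat)" "u0 \<in> borel_sobolev s V"
    "\<And>x. 0 \<le> u0 x" "(\<integral>x. (u0 x)\<^sup>2 \<partial>lborel) = c"
    "AE x in lborel. (\<lambda>i. u (r i) x) \<longlonglongrightarrow> u0 x"
    "\<And>m. 2 \<le> m \<Longrightarrow> m < 2 + 4 * s / real DIM('a) \<Longrightarrow>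
       (\<lambda>i. \<integral>x. \<bar>u (r i) x\<bar> powr m \<partial>lborel) \<longlonglongrightarrow> (\<integral>x. \<bar>u0 x\<bar> powr m \<partial>lborel)"
    "(\<lambda>i. seminorm s (u (r i))) \<longlonglongrightarrow> e1" "seminorm s u0 \<le> e1"
    "(\<lambda>i. \<integral>x. V x * (u (r i) x)\<^sup>2 \<partial>lborel) \<longlonglongrightarrow> e2" "(\<integral>x. V x * (u0 x)\<^sup>2 \<partial>lborel) \<le> e2"
proof -
  note [measurable] = borel_sobolevD(1)[OF u]
  have c0: "0 \<le> c" using mass[of 0] by (metis integral_nonneg_AE AE_I2 zero_le_power2)
  have B0: "0 \<le> B" using B(1)[of 0] seminorm_nonneg[of s "u 0"] by linarith
  obtain r1 where r1': "strict_mono (r1 :: nat \<Rightarrow> nat) \<and>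
    (\<forall>e>0. \<exists>N. \<forall>i\<ge>N. \<forall>l\<ge>N. (\<integral>x. (u (r1 i) x - u (r1 l) x)\<^sup>2 \<partial>lborel) < e)"
    using relatively_compact_L2[of V s u c B, OF V V0 tail s u eq_refl[OF mass] B] by (elim exE)
  have r1: "strict_mono r1"
    "\<And>e. e > 0 \<Longrightarrow> \<exists>N. \<forall>i\<ge>N. \<forall>l\<ge>N. (\<integral>x. (u (r1 i) x - u (r1 l) x)\<^sup>2 \<partial>lborel) < e"
    using r1' by simp_all
  have "integrable lborel (\<lambda>x. (u (r1 i) x - u (r1 l) x)\<^sup>2)" for i l
    by (rule borel_sobolevD(2)[OF borel_sobolev_diff(1)[OF u u V V0]])
  from L2_Cauchy_convergent_subseq[of "\<lambda>i. u (r1 i)", OF _ this r1(2)]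
  obtain r2 u0 where r2: "strict_mono (r2 :: nat \<Rightarrow> nat)" and u0m: "u0 \<in> borel_measurable lborel"
    and u0pos: "\<And>x. (\<forall>i. 0 \<le> u (r1 i) x) \<Longrightarrow> 0 \<le> u0 x"
    and ae2: "AE x in lborel. (\<lambda>i. u (r1 (r2 i)) x) \<longlonglongrightarrow> u0 x"
    and di: "\<And>i. integrable lborel (\<lambda>x. (u (r1 i) x - u0 x)\<^sup>2)"
    and l2: "(\<lambda>i. \<integral>x. (u (r1 (r2 i)) x - u0 x)\<^sup>2 \<partial>lborel) \<longlonglongrightarrow> 0"
    by auto
  have [measurable]: "u0 \<in> borel_measurable borel" using u0m by simp
  \<comment> \<open>The boolean index packs the two real sequences into one family, so that a single
    extraction makes both converge.\<close>
  define E where "E b i = (if b then seminorm s (u (r1 (r2 i))) else (\<integral>x. V x * (u (r1 (r2 i)) x)\<^sup>2 \<partial>lborel))" for b i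
  have "Bseq (E b)" for b
    by (rule BseqI'[where K=B]) (use B V0 in \<open>auto simp: E_def integral_nonneg_AE abs_of_nonneg[OF seminorm_nonneg]\<close>)
  then obtain r3 where r3: "strict_mono (r3 :: nat \<Rightarrow> nat)" "\<And>b. convergent (\<lambda>i. E b (r3 i))"
    using finite_bounded_convergent_subseq[of "UNIV :: bool set" E] by auto
  obtain e1 where e1: "(\<lambda>i. seminorm s (u (r1 (r2 (r3 i))))) \<longlonglongrightarrow> e1"
    using r3(2)[of True] by (auto simp: E_def convergent_def)
  obtain e2 where e2: "(\<lambda>i. \<integral>x. V x * (u (r1 (r2 (r3 i))) x)\<^sup>2 \<partial>lborel) \<longlonglongrightarrow> e2"
    using r3(2)[of False] by (auto simp: E_def convergent_def)
  define r where "r i = r1 (r2 (r3 i))" for i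
  have rm: "strict_mono r"
    unfolding r_def using r1(1) r2 r3(1) by (simp add: strict_mono_def)
  have ae: "AE x in lborel. (\<lambda>i. u (r i) x) \<longlonglongrightarrow> u0 x"
    using ae2 unfolding r_def by eventually_elim (use LIMSEQ_subseq_LIMSEQ[OF _ r3(1)] in \<open>auto simp: o_def\<close>)
  have l2r: "(\<lambda>i. \<integral>x. (u (r i) x - u0 x)\<^sup>2 \<partial>lborel) \<longlonglongrightarrow> 0"
    using LIMSEQ_subseq_LIMSEQ[OF l2 r3(1)] by (simp add: r_def o_def)
  have ae': "AE z in lborel \<Otimes>\<^sub>M lborel. (\<lambda>i. u (r i) (fst z)) \<longlonglongrightarrow> u0 (fst z) \<and> (\<lambda>i. u (r i) (snd z)) \<longlonglongrightarrow> u0 (snd z)"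
  proof (rule lborel_pair.AE_pair_measure)
    show "AE x in lborel. AE y in lborel. (\<lambda>i. u (r i) (fst (x, y))) \<longlonglongrightarrow> u0 (fst (x, y)) \<and> (\<lambda>i. u (r i) (snd (x, y))) \<longlonglongrightarrow> u0 (snd (x, y))"
      using ae by eventually_elim (use ae in simp)
  qed measurable
  have g: "integrable (lborel \<Otimes>\<^sub>M lborel) (gagliardo_quotient s u0 u0)" "seminorm s u0 \<le> e1"
  proof -
    have "AE z in lborel \<Otimes>\<^sub>M lborel. (\<lambda>i. gagliardo_quotient s (u (r i)) (u (r i)) z) \<longlonglongrightarrow> gagliardo_quotient s u0 u0 z"
      using ae' unfolding gagliardo_quotient_def split_beta
    proof eventually_elim
      case (elim z)
      show ?case
        unfolding divide_inverse by (intro tendsto_intros) (use elim in auto)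
    qed
    from fatou_limit[where F="\<lambda>i. gagliardo_quotient s (u (r i)) (u (r i))", OF borel_sobolevD(3)[OF u] gagliardo_quotient_nonneg _ gagliardo_quotient_nonneg this]
    show "integrable (lborel \<Otimes>\<^sub>M lborel) (gagliardo_quotient s u0 u0)" "seminorm s u0 \<le> e1"
      using e1 unfolding r_def by simp_all
  qed
  have p: "integrable lborel (\<lambda>x. V x * (u0 x)\<^sup>2)" "(\<integral>x. V x * (u0 x)\<^sup>2 \<partial>lborel) \<le> e2"
  proof -
    have "AE x in lborel. (\<lambda>i. V x * (u (r i) x)\<^sup>2) \<longlonglongrightarrow> V x * (u0 x)\<^sup>2"
      using ae by eventually_elim (intro tendsto_intros, auto)
    from fatou_limit[where F="\<lambda>i x. V x * (u (r i) x)\<^sup>2", OF borel_sobolevD(4)[OF u] _ _ _ this] V0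
    show "integrable lborel (\<lambda>x. V x * (u0 x)\<^sup>2)" "(\<integral>x. V x * (u0 x)\<^sup>2 \<partial>lborel) \<le> e2"
      using e2 unfolding r_def by simp_all
  qed
  have u02: "integrable lborel (\<lambda>x. (u0 x)\<^sup>2)"
  proof (rule Bochner_Integration.integrable_bound)
    show "integrable lborel (\<lambda>x. 2 * (u (r1 0) x - u0 x)\<^sup>2 + 2 * (u (r1 0) x)\<^sup>2)"
      using di borel_sobolevD(2)[OF u] by simp
    show "AE x in lborel. norm ((u0 x)\<^sup>2) \<le> norm (2 * (u (r1 0) x - u0 x)\<^sup>2 + 2 * (u (r1 0) x)\<^sup>2)"
    proof (rule AE_I2)
      fix x
      have "(u0 x)\<^sup>2 \<le> 2 * (u (r1 0) x - u0 x)\<^sup>2 + 2 * (u (r1 0) x)\<^sup>2"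
        using sum_squares_bound[of "u0 x - u (r1 0) x" "u (r1 0) x"] power2_sum[of "u0 x - u (r1 0) x" "u (r1 0) x"]
        by (simp add: power2_commute)
      then show "norm ((u0 x)\<^sup>2) \<le> norm (2 * (u (r1 0) x - u0 x)\<^sup>2 + 2 * (u (r1 0) x)\<^sup>2)" by simp
    qed
  qed measurable
  have u0: "u0 \<in> borel_sobolev s V" using u02 g p by (simp add: borel_sobolev_def)
  have lm: "(\<lambda>i. \<integral>x. \<bar>u (r i) x\<bar> powr m \<partial>lborel) \<longlonglongrightarrow> (\<integral>x. \<bar>u0 x\<bar> powr m \<partial>lborel)"
    if m: "2 \<le> m" "m < 2 + 4 * s / real DIM('a)" for m
  proof -
    define c' where "c' = 2 * c + 2 * (\<integral>x. (u0 x)\<^sup>2 \<partial>lborel) + 1"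
    have c': "0 < c'" using c0 by (simp add: c'_def add_nonneg_pos)
    note d = borel_sobolev_diff[OF u u0 V V0]
    have dm: "(\<integral>x. (u i x - u0 x)\<^sup>2 \<partial>lborel) \<le> c'" for i
    proof -
      have "(\<integral>x. (u i x - u0 x)\<^sup>2 \<partial>lborel) \<le> (\<integral>x. 2 * (u i x)\<^sup>2 + 2 * (u0 x)\<^sup>2 \<partial>lborel)"
      proof (rule integral_mono)
        fix x show "(u i x - u0 x)\<^sup>2 \<le> 2 * (u i x)\<^sup>2 + 2 * (u0 x)\<^sup>2"
          using sum_squares_bound[of "u i x" "- u0 x"] by (simp add: power2_diff)
      qed (use borel_sobolevD(2)[OF d(1)] borel_sobolevD(2)[OF u] u02 in auto)
      also have "\<dots> = 2 * c + 2 * (\<integral>x. (u0 x)\<^sup>2 \<partial>lborel)"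
        using borel_sobolevD(2)[OF u] u02 mass by simp
      finally show ?thesis by (simp add: c'_def)
    qed
    show ?thesis
    proof (rule crit_space_tendsto_integral_powr[where u="\<lambda>i. u (r i)", OF borel_sobolev_crit_space[OF u s] borel_sobolev_crit_space[OF u0 s] m ae l2r])
      fix i
      show "(\<integral>x. \<bar>u (r i) x - u0 x\<bar> powr (2 + 4 * s / real DIM('a)) \<partial>lborel) \<le>
        4 / unit_ball_vol (real DIM('a)) * (4 * c' / unit_ball_vol (real DIM('a))) powr (2 * s / real DIM('a)) * (2 * B + 2 * seminorm s u0)"
        by (rule order.trans[OF borel_sobolev_critical_bound(2)[OF d(1) s c' dm] mult_left_mono])
           (use d(3)[of "r i"] B(1)[of "r i"] in auto)
    qed
  qed
  \<comment> \<open>The case m = 2: no mass is lost in the limit, so \<open>u0\<close> lies on the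
    same sphere.\<close>
  have "(\<lambda>i. \<integral>x. \<bar>u (r i) x\<bar> powr 2 \<partial>lborel) \<longlonglongrightarrow> (\<integral>x. \<bar>u0 x\<bar> powr 2 \<partial>lborel)"
    by (rule lm) (use s in auto)
  then have "(\<lambda>i. c) \<longlonglongrightarrow> (\<integral>x. (u0 x)\<^sup>2 \<partial>lborel)" using mass by simp
  then have "(\<integral>x. (u0 x)\<^sup>2 \<partial>lborel) = c" by (simp add: LIMSEQ_const_iff)
  moreover have "0 \<le> u0 x" for x using u0pos pos by simp
  ultimately show thesis
    using that[OF rm u0 _ _ ae lm _ g(2) _ p(2)] e1 e2 by (simp add: r_def)
qed

subsection \<open>First variation\<close>

text \<open>Dominated convergence for difference quotients along sequences. The derivative is taken
  only at 0, and the bound is a Lipschitz bound for increments from 0, so derivatives at other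
  points do not appear.\<close>

lemma integral_has_real_derivative_dominated:
  fixes f :: "real \<Rightarrow> 'a \<Rightarrow> real"
  assumes f: "\<And>h. integrable M (f h)" and [measurable]: "f' \<in> borel_measurable M"
    and d: "\<And>x. ((\<lambda>h. f h x) has_real_derivative f' x) (at 0)"
    and w: "integrable M w" and b: "\<And>h x. \<bar>h\<bar> \<le> 1 \<Longrightarrow> \<bar>f h x - f 0 x\<bar> \<le> w x * \<bar>h\<bar>"
  shows "integrable M f'" "((\<lambda>h. \<integral>x. f h x \<partial>M) has_real_derivative (\<integral>x. f' x \<partial>M)) (at 0)"
proof -
  have [measurable]: "f h \<in> borel_measurable M" for h using f by auto
  have D: "(\<lambda>h. (f h x - f 0 x) / h) \<midarrow>0\<rightarrow> f' x" for x
    using d[of x] by (simp add: DERIV_def)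
  have q: "norm ((f h x - f 0 x) / h) \<le> w x" if "h \<noteq> 0" "\<bar>h\<bar> \<le> 1" for h x
    using b[OF that(2), of x] that by (simp add: field_simps)
  have lim: "integrable M f' \<and> (\<lambda>i. \<integral>x. (f (X i) x - f 0 x) / X i \<partial>M) \<longlonglongrightarrow> (\<integral>x. f' x \<partial>M)"
    if X: "\<And>i. X i \<noteq> 0" "X \<longlonglongrightarrow> 0" "\<And>i. \<bar>X i\<bar> \<le> 1" for X
  proof -
    have ae: "AE x in M. (\<lambda>i. (f (X i) x - f 0 x) / X i) \<longlonglongrightarrow> f' x"
    proof (rule AE_I2)
      fix x
      show "(\<lambda>i. (f (X i) x - f 0 x) / X i) \<longlonglongrightarrow> f' x"
        using D[of x] X(1,2) unfolding tendsto_at_iff_sequentially by (auto simp: o_def)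
    qed
    have m: "\<And>i. (\<lambda>x. (f (X i) x - f 0 x) / X i) \<in> borel_measurable M" by measurable
    have bd: "\<And>i. AE x in M. norm ((f (X i) x - f 0 x) / X i) \<le> w x" using q X by auto
    show ?thesis
      using integrable_dominated_convergence[OF _ m w ae bd] integral_dominated_convergence[OF _ m w ae bd] by simp
  qed
  \<comment> \<open>One concrete null sequence in [-1, 1] yields integrability of the
    derivative.\<close>
  have X: "\<And>i. 1 / (real i + 1) \<noteq> 0" "(\<lambda>i. 1 / (real i + 1)) \<longlonglongrightarrow> 0" "\<And>i. \<bar>1 / (real i + 1)\<bar> \<le> 1"
    using LIMSEQ_Suc[OF lim_const_over_n[of "1::real"]] by (auto simp: add.commute)
  show "integrable M f'" using lim[OF X] by simp
  have "(\<lambda>h. ((\<integral>x. f h x \<partial>M) - (\<integral>x. f 0 x \<partial>M)) / h) \<midarrow>0\<rightarrow> (\<integral>x. f' x \<partial>M)"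
    unfolding tendsto_at_iff_sequentially
  proof (intro allI impI)
    fix X :: "nat \<Rightarrow> real" assume X: "\<forall>i. X i \<in> UNIV - {0}" "X \<longlonglongrightarrow> 0"
    \<comment> \<open>The bound holds for increments of size at most 1, which an arbitrary null
      sequence satisfies only eventually; hence the shift by \<open>N\<close>.\<close>
    obtain N where N: "\<And>i. i \<ge> N \<Longrightarrow> \<bar>X i\<bar> \<le> 1" using LIMSEQ_D[OF X(2), of 1] by (auto intro: less_imp_le)
    have "(\<lambda>i. \<integral>x. (f (X (i + N)) x - f 0 x) / X (i + N) \<partial>M) \<longlonglongrightarrow> (\<integral>x. f' x \<partial>M)"
      using lim[of "\<lambda>i. X (i + N)"] X N LIMSEQ_ignore_initial_segment[OF X(2)] by auto
    then have "(\<lambda>i. ((\<integral>x. f (X (i + N)) x \<partial>M) - (\<integral>x. f 0 x \<partial>M)) / X (i + N)) \<longlonglongrightarrow> (\<integral>x. f' x \<partial>M)"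
      using f by simp
    then show "((\<lambda>h. ((\<integral>x. f h x \<partial>M) - (\<integral>x. f 0 x \<partial>M)) / h) \<circ> X) \<longlonglongrightarrow> (\<integral>x. f' x \<partial>M)"
      unfolding o_def by (rule LIMSEQ_offset)
  qed
  then show "((\<lambda>h. \<integral>x. f h x \<partial>M) has_real_derivative (\<integral>x. f' x \<partial>M)) (at 0)"
    by (simp add: DERIV_def)
qed

text \<open>Away from 0 the function is locally a power of t or of -t. At 0 the quotient |h|^r / h
  has modulus |h|^(r-1), which tends to 0 since r > 1, and the formula gives 0 there as
  well.\<close>

lemma has_real_derivative_abs_powr:
  fixes r t :: real
  assumes r: "1 < r"
  shows "((\<lambda>t. \<bar>t\<bar> powr r) has_real_derivative r * (\<bar>t\<bar> powr (r - 2) * t)) (at t)"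
proof -
  consider "t > 0" | "t < 0" | "t = 0" by linarith
  then show ?thesis
  proof cases
    case 1
    have "((\<lambda>t. t powr r) has_real_derivative r * (\<bar>t\<bar> powr (r - 2) * t)) (at t)"
      using 1 by (auto intro!: derivative_eq_intros simp: powr_diff power2_eq_square)
    moreover have "\<forall>\<^sub>F x in nhds t. \<bar>x\<bar> powr r = x powr r"
      using eventually_nhds_in_open[of "{0<..}" t] 1 by (auto elim!: eventually_mono)
    ultimately show ?thesis by (subst DERIV_cong_ev[OF refl _ refl]) auto
  next
    case 2
    have "((\<lambda>t. (- t) powr r) has_real_derivative r * (\<bar>t\<bar> powr (r - 2) * t)) (at t)"
      using 2 by (auto intro!: derivative_eq_intros simp: powr_diff power2_eq_square field_simps)
    moreover have "\<forall>\<^sub>F x in nhds t. \<bar>x\<bar> powr r = (- x) powr r"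
      using eventually_nhds_in_open[of "{..<0}" t] 2 by (auto elim!: eventually_mono)
    ultimately show ?thesis by (subst DERIV_cong_ev[OF refl _ refl]) auto
  next
    case 3
    have "(\<lambda>h::real. \<bar>\<bar>h\<bar> powr (r - 1)\<bar>) \<midarrow>0\<rightarrow> 0"
    proof -
      have "(\<lambda>h::real. \<bar>h\<bar> powr (r - 1)) \<midarrow>0\<rightarrow> \<bar>0\<bar> powr (r - 1)"
        by (intro tendsto_powr2 tendsto_intros) (use r in auto)
      then show ?thesis by simp
    qed
    then have "(\<lambda>h::real. \<bar>h\<bar> powr r / h) \<midarrow>0\<rightarrow> 0"
    proof (rule Lim_null_comparison[rotated])
      show "\<forall>\<^sub>F h::real in at 0. norm (\<bar>h\<bar> powr r / h) \<le> \<bar>\<bar>h\<bar> powr (r - 1)\<bar>"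
        using eventually_neq_at_within[of 0] by eventually_elim (simp add: powr_diff)
    qed
    then show ?thesis using 3 by (simp add: DERIV_def)
  qed
qed

text \<open>For r < 2 the factor |t|^(r-2) is unbounded near 0. Merging it with t first gives an
  exponent that is positive for r > 1, to which monotonicity of powers applies.\<close>

lemma abs_signed_powr: "\<bar>\<bar>t\<bar> powr (r - 2) * t\<bar> = \<bar>t\<bar> powr (r - 1)" for t r :: real
proof (cases "t = 0")
  case False
  have "\<bar>t\<bar> powr (r - 2) * \<bar>t\<bar> = \<bar>t\<bar> powr (r - 2) * \<bar>t\<bar> powr 1" using False by simp
  also have "\<dots> = \<bar>t\<bar> powr (r - 1)" unfolding powr_add[symmetric] by simp
  finally show ?thesis by (simp add: abs_mult)
qed simp

lemma abs_signed_powr_mult_le: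
  fixes t b A r :: real
  assumes "1 < r" "\<bar>t\<bar> \<le> A" "\<bar>b\<bar> \<le> A"
  shows "\<bar>\<bar>t\<bar> powr (r - 2) * t * b\<bar> \<le> A powr r"
proof -
  have A: "0 \<le> A" using assms by linarith
  have "\<bar>\<bar>t\<bar> powr (r - 2) * t * b\<bar> = \<bar>t\<bar> powr (r - 1) * \<bar>b\<bar>"
    using abs_signed_powr[of t r] by (simp only: abs_mult)
  also have "\<dots> \<le> A powr (r - 1) * A"
    using assms A by (intro mult_mono powr_mono2) auto
  also have "\<dots> = A powr r" using A by (cases "A = 0") (auto simp: powr_diff)
  finally show ?thesis .
qed

text \<open>Mean value inequality on [-1, 1] for the product along the two lines. The resulting
  constant does not depend on h and is again a product of r-th powers, so it can serve as an
  integrable majorant.\<close>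

lemma product_powr_difference_bound:
  fixes a b c d h r :: real
  assumes r: "1 < r" and h: "\<bar>h\<bar> \<le> 1"
  shows "\<bar>\<bar>a + h * b\<bar> powr r * \<bar>c + h * d\<bar> powr r - \<bar>a\<bar> powr r * \<bar>c\<bar> powr r\<bar>
    \<le> 2 * r * ((\<bar>a\<bar> + \<bar>b\<bar>) powr r * (\<bar>c\<bar> + \<bar>d\<bar>) powr r) * \<bar>h\<bar>"
proof -
  let ?A = "\<bar>a\<bar> + \<bar>b\<bar>" and ?C = "\<bar>c\<bar> + \<bar>d\<bar>"
  define g where "g h = \<bar>a + h * b\<bar> powr r * \<bar>c + h * d\<bar> powr r" for h
  define g' where "g' h = r * (\<bar>a + h * b\<bar> powr (r - 2) * (a + h * b)) * b * \<bar>c + h * d\<bar> powr r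
     + r * (\<bar>c + h * d\<bar> powr (r - 2) * (c + h * d)) * d * \<bar>a + h * b\<bar> powr r" for h
  have der: "(g has_real_derivative g' z) (at z within S)" for z S
  proof -
    have "((\<lambda>h. \<bar>x + h * y\<bar> powr r) has_real_derivative r * (\<bar>x + z * y\<bar> powr (r - 2) * (x + z * y)) * y) (at z within S)" for x y
      by (rule DERIV_chain2[OF has_real_derivative_abs_powr[OF r]]) (auto intro!: derivative_eq_intros)
    from DERIV_mult[OF this[of a b] this[of c d]] show ?thesis
      unfolding g_def g'_def by (simp add: mult_ac add_ac)
  qed
  have bd: "\<bar>x + z * y\<bar> \<le> \<bar>x\<bar> + \<bar>y\<bar>" if "z \<in> {-1..1}" for x y z :: real
  proof -
    have "\<bar>z * y\<bar> \<le> 1 * \<bar>y\<bar>" unfolding abs_mult using that by (intro mult_right_mono) auto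
    then show ?thesis by linarith
  qed
  have g'b: "norm (g' z) \<le> 2 * r * (?A powr r * ?C powr r)" if z: "z \<in> {-1..1}" for z
  proof -
    have 1: "\<bar>\<bar>a + z * b\<bar> powr (r - 2) * (a + z * b) * b\<bar> * \<bar>c + z * d\<bar> powr r \<le> ?A powr r * ?C powr r"
      using bd[OF z] r by (intro mult_mono abs_signed_powr_mult_le powr_mono2) auto
    have 2: "\<bar>\<bar>c + z * d\<bar> powr (r - 2) * (c + z * d) * d\<bar> * \<bar>a + z * b\<bar> powr r \<le> ?C powr r * ?A powr r"
      using bd[OF z] r by (intro mult_mono abs_signed_powr_mult_le powr_mono2) auto
    have "norm (g' z) \<le> r * (\<bar>\<bar>a + z * b\<bar> powr (r - 2) * (a + z * b) * b\<bar> * \<bar>c + z * d\<bar> powr r)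
       + r * (\<bar>\<bar>c + z * d\<bar> powr (r - 2) * (c + z * d) * d\<bar> * \<bar>a + z * b\<bar> powr r)"
      unfolding g'_def real_norm_def by (rule order.trans[OF abs_triangle_ineq]) (use r in \<open>simp add: abs_mult mult_ac\<close>)
    also have "\<dots> \<le> r * (?A powr r * ?C powr r) + r * (?C powr r * ?A powr r)"
      using r by (intro add_mono mult_left_mono 1 2) auto
    finally show ?thesis by (simp add: mult_ac)
  qed
  have "norm (g h - g 0) \<le> 2 * r * (?A powr r * ?C powr r) * norm (h - 0)"
    by (rule field_differentiable_bound[of "{-1..1}" g g']) (use h der g'b in auto)
  then show ?thesis by (simp add: g_def)
qed

text \<open>The pairing of \<open>choquard_term\<close> with \<phi> before Fubini. As an integral
  over the product it arises directly when the energy is differentiated;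
  \<open>choquard_term_integral\<close> connects the two.\<close>

definition choquard_form :: "real \<Rightarrow> real \<Rightarrow> ('a::euclidean_space \<Rightarrow> real) \<Rightarrow> ('a \<Rightarrow> real) \<Rightarrow> ('a \<Rightarrow> real) \<Rightarrow> real" where
  "choquard_form \<alpha> r w u \<phi> = (\<integral>(x, y). riesz_kernel \<alpha> (x - y) * (\<bar>u x\<bar> powr (r - 2) * u x * \<phi> x) * \<bar>w y\<bar> powr r \<partial>(lborel \<Otimes>\<^sub>M lborel))"

lemma riesz_kernel_commute: "riesz_kernel \<alpha> (x - y) = riesz_kernel \<alpha> (y - x)"
  by (simp add: riesz_kernel_def norm_minus_commute)

lemma integral_riesz_swap:
  fixes f g :: "'a::euclidean_space \<Rightarrow> real"
  assumes [measurable]: "f \<in> borel_measurable borel" "g \<in> borel_measurable borel"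
  shows "(\<integral>(x, y). riesz_kernel \<alpha> (x - y) * f x * g y \<partial>(lborel \<Otimes>\<^sub>M lborel)) =
    (\<integral>(x, y). riesz_kernel \<alpha> (x - y) * g x * f y \<partial>(lborel \<Otimes>\<^sub>M lborel))"
proof -
  have "(\<integral>(x, y). (\<lambda>(x, y). riesz_kernel \<alpha> (x - y) * f x * g y) (y, x) \<partial>(lborel \<Otimes>\<^sub>M lborel)) =
    (\<integral>(x, y). riesz_kernel \<alpha> (x - y) * f x * g y \<partial>(lborel \<Otimes>\<^sub>M lborel))"
    by (rule lborel_pair.integral_product_swap) measurable
  then show ?thesis by (simp add: riesz_kernel_commute mult_ac)
qed

context riesz_exponent
begin

text \<open>|u|^(r-1) |\<phi>| is at most (|u| + |\<phi>|)^r, and |u| + |\<phi>| stays in the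
  critical space, so the form is dominated by a finite D term.\<close>

lemma choquard_form_integrable:
  fixes w u \<phi> :: "'a \<Rightarrow> real"
  assumes w: "w \<in> crit_space (2 + 4 * s / real DIM('a))" and u: "u \<in> crit_space (2 + 4 * s / real DIM('a))"
    and \<phi>: "\<phi> \<in> crit_space (2 + 4 * s / real DIM('a))"
  shows "integrable (lborel \<Otimes>\<^sub>M lborel) (\<lambda>(x, y). riesz_kernel \<alpha> (x - y) * (\<bar>u x\<bar> powr (r - 2) * u x * \<phi> x) * \<bar>w y\<bar> powr r)"
proof -
  note [measurable] = crit_spaceD(1)[OF w] crit_spaceD(1)[OF u] crit_spaceD(1)[OF \<phi>]
  have M: "0 \<le> 2 + 4 * s / real DIM('a)" using s by simp
  have a: "(\<lambda>x. \<bar>u x\<bar> + \<bar>\<phi> x\<bar>) \<in> crit_space (2 + 4 * s / real DIM('a))"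
    by (intro crit_space_add crit_space_abs u \<phi> M)
  show ?thesis
  proof (rule Bochner_Integration.integrable_bound[OF integrable_riesz[OF a w]])
    show "AE z in lborel \<Otimes>\<^sub>M lborel. norm (case z of (x, y) \<Rightarrow> riesz_kernel \<alpha> (x - y) * (\<bar>u x\<bar> powr (r - 2) * u x * \<phi> x) * \<bar>w y\<bar> powr r)
      \<le> norm (case z of (x, y) \<Rightarrow> riesz_kernel \<alpha> (x - y) * \<bar>\<bar>u x\<bar> + \<bar>\<phi> x\<bar>\<bar> powr r * \<bar>w y\<bar> powr r)"
    proof (rule AE_I2, clarify)
      fix x y
      have "\<bar>\<bar>u x\<bar> powr (r - 2) * u x * \<phi> x\<bar> \<le> (\<bar>u x\<bar> + \<bar>\<phi> x\<bar>) powr r"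
        by (rule abs_signed_powr_mult_le[OF r_gt_1]) auto
      then have "\<bar>riesz_kernel \<alpha> (x - y)\<bar> * \<bar>\<bar>u x\<bar> powr (r - 2) * u x * \<phi> x\<bar> * \<bar>\<bar>w y\<bar> powr r\<bar> \<le> \<bar>riesz_kernel \<alpha> (x - y)\<bar> * (\<bar>u x\<bar> + \<bar>\<phi> x\<bar>) powr r * \<bar>\<bar>w y\<bar> powr r\<bar>"
        by (intro mult_right_mono mult_left_mono) auto
      then show "norm (riesz_kernel \<alpha> (x - y) * (\<bar>u x\<bar> powr (r - 2) * u x * \<phi> x) * \<bar>w y\<bar> powr r)
         \<le> norm (riesz_kernel \<alpha> (x - y) * \<bar>\<bar>u x\<bar> + \<bar>\<phi> x\<bar>\<bar> powr r * \<bar>w y\<bar> powr r)"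
        by (simp add: abs_mult)
    qed
  qed measurable
qed

text \<open>Two directions are allowed at once: u = w and \<phi> = \<psi> give the variation of the
  self-interaction, \<psi> = 0 that of the coupling with one component frozen. The second half of
  the derivative has its arguments exchanged by symmetry of the kernel.\<close>

lemma riesz_form_has_derivative:
  fixes w u \<phi> \<psi> :: "'a \<Rightarrow> real"
  assumes u: "u \<in> crit_space (2 + 4 * s / real DIM('a))" and w: "w \<in> crit_space (2 + 4 * s / real DIM('a))"
    and \<phi>: "\<phi> \<in> crit_space (2 + 4 * s / real DIM('a))" and \<psi>: "\<psi> \<in> crit_space (2 + 4 * s / real DIM('a))"
  shows "((\<lambda>h. kernel_form (riesz_kernel \<alpha>) r (\<lambda>x. u x + h * \<phi> x) (\<lambda>x. w x + h * \<psi> x)) has_real_derivative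
    r * (choquard_form \<alpha> r w u \<phi> + choquard_form \<alpha> r u w \<psi>)) (at 0)"
proof -
  note [measurable] = crit_spaceD(1)[OF w] crit_spaceD(1)[OF u] crit_spaceD(1)[OF \<phi>] crit_spaceD(1)[OF \<psi>]
  have M: "0 \<le> 2 + 4 * s / real DIM('a)" using s by simp
  define f where "f h = (\<lambda>(x, y). riesz_kernel \<alpha> (x - y) * \<bar>u x + h * \<phi> x\<bar> powr r * \<bar>w y + h * \<psi> y\<bar> powr r)" for h
  define f1 where "f1 = (\<lambda>(x, y). riesz_kernel \<alpha> (x - y) * (\<bar>u x\<bar> powr (r - 2) * u x * \<phi> x) * \<bar>w y\<bar> powr r)"
  define f2 where "f2 = (\<lambda>(x, y). riesz_kernel \<alpha> (x - y) * \<bar>u x\<bar> powr r * (\<bar>w y\<bar> powr (r - 2) * w y * \<psi> y))"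
  define W where "W = (\<lambda>(x, y). 2 * r * (riesz_kernel \<alpha> (x - y) * \<bar>\<bar>u x\<bar> + \<bar>\<phi> x\<bar>\<bar> powr r * \<bar>\<bar>w y\<bar> + \<bar>\<psi> y\<bar>\<bar> powr r))"
  have fi: "integrable (lborel \<Otimes>\<^sub>M lborel) (f h)" for h
    unfolding f_def by (intro integrable_riesz crit_space_add crit_space_scale u w \<phi> \<psi> M)
  have i1: "integrable (lborel \<Otimes>\<^sub>M lborel) f1"
    unfolding f1_def by (rule choquard_form_integrable[OF w u \<phi>])
  have i2: "integrable (lborel \<Otimes>\<^sub>M lborel) f2" "integral\<^sup>L (lborel \<Otimes>\<^sub>M lborel) f2 = choquard_form \<alpha> r u w \<psi>"
  proof -
    have "f2 = (\<lambda>(x, y). (\<lambda>(x, y). riesz_kernel \<alpha> (x - y) * (\<bar>w x\<bar> powr (r - 2) * w x * \<psi> x) * \<bar>u y\<bar> powr r) (y, x))"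
      unfolding f2_def by (auto simp: riesz_kernel_commute mult_ac)
    then show "integrable (lborel \<Otimes>\<^sub>M lborel) f2"
      using lborel_pair.integrable_product_swap[OF choquard_form_integrable[OF u w \<psi>]] by simp
    show "integral\<^sup>L (lborel \<Otimes>\<^sub>M lborel) f2 = choquard_form \<alpha> r u w \<psi>"
      unfolding f2_def choquard_form_def by (rule integral_riesz_swap) measurable
  qed
  have Wi: "integrable (lborel \<Otimes>\<^sub>M lborel) W"
  proof -
    have "integrable (lborel \<Otimes>\<^sub>M lborel) (\<lambda>(x, y). riesz_kernel \<alpha> (x - y) * \<bar>\<bar>u x\<bar> + \<bar>\<phi> x\<bar>\<bar> powr r * \<bar>\<bar>w y\<bar> + \<bar>\<psi> y\<bar>\<bar> powr r)"
      by (intro integrable_riesz crit_space_add crit_space_abs u w \<phi> \<psi> M)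
    then have "integrable (lborel \<Otimes>\<^sub>M lborel) (\<lambda>z. 2 * r * (case z of (x, y) \<Rightarrow> riesz_kernel \<alpha> (x - y) * \<bar>\<bar>u x\<bar> + \<bar>\<phi> x\<bar>\<bar> powr r * \<bar>\<bar>w y\<bar> + \<bar>\<psi> y\<bar>\<bar> powr r))"
      by (rule integrable_mult_right)
    moreover have "W = (\<lambda>z. 2 * r * (case z of (x, y) \<Rightarrow> riesz_kernel \<alpha> (x - y) * \<bar>\<bar>u x\<bar> + \<bar>\<phi> x\<bar>\<bar> powr r * \<bar>\<bar>w y\<bar> + \<bar>\<psi> y\<bar>\<bar> powr r))"
      by (auto simp: W_def)
    ultimately show ?thesis by (simp only:)
  qed
  have der: "((\<lambda>h. f h z) has_real_derivative r * (f1 z + f2 z)) (at 0)" for z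
  proof -
    obtain x y where z: "z = (x, y)" by (cases z)
    have d: "((\<lambda>h. \<bar>a + h * b\<bar> powr r) has_real_derivative r * (\<bar>a + 0 * b\<bar> powr (r - 2) * (a + 0 * b)) * b) (at 0)" for a b :: real
      by (rule DERIV_chain2[OF has_real_derivative_abs_powr[OF r_gt_1]]) (auto intro!: derivative_eq_intros)
    from DERIV_cmult[OF DERIV_mult[OF d[of "u x" "\<phi> x"] d[of "w y" "\<psi> y"]], of "riesz_kernel \<alpha> (x - y)"]
    show ?thesis by (simp add: z f_def f1_def f2_def algebra_simps)
  qed
  have bd: "\<bar>f h z - f 0 z\<bar> \<le> W z * \<bar>h\<bar>" if h: "\<bar>h\<bar> \<le> 1" for h z
  proof -
    obtain x y where z: "z = (x, y)" by (cases z)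
    have k: "0 \<le> riesz_kernel \<alpha> (x - y)" by (simp add: riesz_kernel_def)
    have "\<bar>f h z - f 0 z\<bar> = riesz_kernel \<alpha> (x - y) * \<bar>\<bar>u x + h * \<phi> x\<bar> powr r * \<bar>w y + h * \<psi> y\<bar> powr r - \<bar>u x\<bar> powr r * \<bar>w y\<bar> powr r\<bar>"
      using k by (simp add: z f_def mult.assoc abs_mult flip: right_diff_distrib)
    also have "\<dots> \<le> riesz_kernel \<alpha> (x - y) * (2 * r * ((\<bar>u x\<bar> + \<bar>\<phi> x\<bar>) powr r * (\<bar>w y\<bar> + \<bar>\<psi> y\<bar>) powr r) * \<bar>h\<bar>)"
      by (intro mult_left_mono k product_powr_difference_bound r_gt_1 h)
    also have "\<dots> = W z * \<bar>h\<bar>" by (simp add: z W_def)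
    finally show ?thesis .
  qed
  have m: "(\<lambda>z. r * (f1 z + f2 z)) \<in> borel_measurable (lborel \<Otimes>\<^sub>M lborel)"
    using i1 i2(1) by (auto dest!: borel_measurable_integrable)
  have "((\<lambda>h. \<integral>z. f h z \<partial>(lborel \<Otimes>\<^sub>M lborel)) has_real_derivative (\<integral>z. r * (f1 z + f2 z) \<partial>(lborel \<Otimes>\<^sub>M lborel))) (at 0)"
    by (rule integral_has_real_derivative_dominated(2)[OF fi m der Wi bd])
  moreover have "(\<integral>z. r * (f1 z + f2 z) \<partial>(lborel \<Otimes>\<^sub>M lborel)) = r * (choquard_form \<alpha> r w u \<phi> + choquard_form \<alpha> r u w \<psi>)"
    using i1 i2 by (simp add: choquard_form_def f1_def)
  ultimately show ?thesis by (simp only: kernel_form_def f_def)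
qed

end

section \<open>The quadratic part of the energy\<close>

lemma integrable_mult_of_squares:
  fixes u w :: "'a \<Rightarrow> real"
  assumes [measurable]: "u \<in> borel_measurable M" "w \<in> borel_measurable M" "V \<in> borel_measurable M"
    and u: "integrable M (\<lambda>x. V x * (u x)\<^sup>2)" and w: "integrable M (\<lambda>x. V x * (w x)\<^sup>2)" and V: "\<And>x. 0 \<le> V x"
  shows "integrable M (\<lambda>x. V x * u x * w x)"
proof (rule Bochner_Integration.integrable_bound)
  show "integrable M (\<lambda>x. V x * (u x)\<^sup>2 + V x * (w x)\<^sup>2)" using u w by simp
  show "AE x in M. norm (V x * u x * w x) \<le> norm (V x * (u x)\<^sup>2 + V x * (w x)\<^sup>2)"
  proof (rule AE_I2)
    fix x
    have p: "0 \<le> \<bar>u x\<bar> * \<bar>w x\<bar>" by simp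
    have "2 * \<bar>u x\<bar> * \<bar>w x\<bar> \<le> (u x)\<^sup>2 + (w x)\<^sup>2" using sum_squares_bound[of "\<bar>u x\<bar>" "\<bar>w x\<bar>"] by simp
    then have "\<bar>u x * w x\<bar> \<le> (u x)\<^sup>2 + (w x)\<^sup>2" unfolding abs_mult using p by linarith
    from mult_left_mono[OF this V[of x]]
    show "norm (V x * u x * w x) \<le> norm (V x * (u x)\<^sup>2 + V x * (w x)\<^sup>2)"
      using V[of x] by (simp add: abs_mult distrib_left mult.assoc)
  qed
qed measurable

text \<open>The quotient is a product of two differences with the weight 1 / |x - y|^(n+2s), so the
  bound for weighted products of square integrable functions applies on the product space.\<close>

lemma integrable_gagliardo_quotient:
  fixes u w :: "'a::euclidean_space \<Rightarrow> real"
  assumes u: "u \<in> borel_sobolev s V" and w: "w \<in> borel_sobolev s V'"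
  shows "integrable (lborel \<Otimes>\<^sub>M lborel) (gagliardo_quotient s u w)"
proof -
  note [measurable] = borel_sobolevD(1)[OF u] borel_sobolevD(1)[OF w]
  have e: "gagliardo_quotient s v v' = (\<lambda>z. 1 / norm (fst z - snd z) powr (real DIM('a) + 2 * s) * (v (fst z) - v (snd z)) * (v' (fst z) - v' (snd z)))" for v v' :: "'a \<Rightarrow> real"
    by (auto simp: gagliardo_quotient_def)
  have e2: "gagliardo_quotient s v v = (\<lambda>z. 1 / norm (fst z - snd z) powr (real DIM('a) + 2 * s) * (v (fst z) - v (snd z))\<^sup>2)" for v :: "'a \<Rightarrow> real"
    by (auto simp: gagliardo_quotient_def power2_eq_square)
  show ?thesis
    unfolding e
    by (rule integrable_mult_of_squares) (use borel_sobolevD(3)[OF u] borel_sobolevD(3)[OF w] in \<open>simp_all add: e2\<close>)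
qed

lemma seminorm_expand:
  assumes u: "u \<in> borel_sobolev s V" and w: "w \<in> borel_sobolev s V"
  shows "seminorm s (\<lambda>x. u x + h * w x) = seminorm s u + 2 * h * integral\<^sup>L (lborel \<Otimes>\<^sub>M lborel) (gagliardo_quotient s u w) + h\<^sup>2 * seminorm s w"
proof -
  have "gagliardo_quotient s (\<lambda>x. u x + h * w x) (\<lambda>x. u x + h * w x) =
     (\<lambda>z. gagliardo_quotient s u u z + 2 * h * gagliardo_quotient s u w z + h\<^sup>2 * gagliardo_quotient s w w z)"
    by (auto simp: gagliardo_quotient_def power2_eq_square algebra_simps add_divide_distrib diff_divide_distrib)
  then show ?thesis
    using borel_sobolevD(3)[OF u] borel_sobolevD(3)[OF w] integrable_gagliardo_quotient[OF u w] by simp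
qed

lemma weighted_square_expand:
  fixes u w :: "'a \<Rightarrow> real"
  assumes "integrable M (\<lambda>x. V x * (u x)\<^sup>2)" "integrable M (\<lambda>x. V x * u x * w x)" "integrable M (\<lambda>x. V x * (w x)\<^sup>2)"
  shows "(\<integral>x. V x * (u x + h * w x)\<^sup>2 \<partial>M) = (\<integral>x. V x * (u x)\<^sup>2 \<partial>M) + 2 * h * (\<integral>x. V x * u x * w x \<partial>M) + h\<^sup>2 * (\<integral>x. V x * (w x)\<^sup>2 \<partial>M)"
proof -
  have "(\<lambda>x. V x * (u x + h * w x)\<^sup>2) = (\<lambda>x. V x * (u x)\<^sup>2 + 2 * h * (V x * u x * w x) + h\<^sup>2 * (V x * (w x)\<^sup>2))"
    by (auto simp: power2_eq_square algebra_simps)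
  then show ?thesis using assms by simp
qed

lemma kernel_form_scale:
  "kernel_form k r (\<lambda>x. c * u x) (\<lambda>x. d * w x) = \<bar>c\<bar> powr r * \<bar>d\<bar> powr r * kernel_form k r u w"
proof -
  have "(\<lambda>(x, y). k (x - y) * \<bar>c * u x\<bar> powr r * \<bar>d * w y\<bar> powr r) =
    (\<lambda>z. \<bar>c\<bar> powr r * \<bar>d\<bar> powr r * (case z of (x, y) \<Rightarrow> k (x - y) * \<bar>u x\<bar> powr r * \<bar>w y\<bar> powr r))"
    by (auto simp: abs_mult powr_mult)
  then show ?thesis unfolding kernel_form_def by simp
qed

text \<open>The energy as a function of \<open>u\<close> alone with \<open>v\<close> frozen; terms
  depending only on \<open>v\<close> are dropped. The parameter \<kappa> is later half the constant
  of the fractional Laplacian.\<close>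

definition partial_energy ::
  "real \<Rightarrow> real \<Rightarrow> real \<Rightarrow> ('a::euclidean_space \<Rightarrow> real) \<Rightarrow> real \<Rightarrow> real \<Rightarrow> real \<Rightarrow> real \<Rightarrow> ('a \<Rightarrow> real) \<Rightarrow> ('a \<Rightarrow> real) \<Rightarrow> real" where
  "partial_energy \<kappa> s \<alpha> V \<mu> p \<beta> r v u =
     (\<kappa> * seminorm s u + (\<integral>x. V x * (u x)\<^sup>2 \<partial>lborel)) / 2
     - \<mu> / (2 * p) * kernel_form (riesz_kernel \<alpha>) p u u - \<beta> / r * kernel_form (riesz_kernel \<alpha>) r u v"

text \<open>The normalised curve \<open>a (u + h \<phi>) / \<parallel>u + h \<phi>\<parallel>\<close> stays on the sphere, and the energy along it is
  a differentiable function of \<open>h\<close> by homogeneity.\<close>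

lemma euler_lagrange:
  fixes u v \<phi> V :: "'a::euclidean_space \<Rightarrow> real"
  assumes \<alpha>: "0 < \<alpha>" "\<alpha> < real DIM('a)" and s: "0 < s"
    and p: "1 + \<alpha> / real DIM('a) < p" "p < 1 + (\<alpha> + 2 * s) / real DIM('a)"
    and r: "1 + \<alpha> / real DIM('a) < r" "r < 1 + (\<alpha> + 2 * s) / real DIM('a)"
    and V[measurable]: "V \<in> borel_measurable borel" and V0: "\<And>x. 0 \<le> V x"
    and u: "u \<in> borel_sobolev s V" and v: "v \<in> crit_space (2 + 4 * s / real DIM('a))"
    and \<phi>: "\<phi> \<in> borel_sobolev s V" and a: "0 < a" and mass: "(\<integral>x. (u x)\<^sup>2 \<partial>lborel) = a\<^sup>2"
    and min: "\<And>w. w \<in> borel_sobolev s V \<Longrightarrow> (\<integral>x. (w x)\<^sup>2 \<partial>lborel) = a\<^sup>2 \<Longrightarrow>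
       partial_energy \<kappa> s \<alpha> V \<mu> p \<beta> r v u \<le> partial_energy \<kappa> s \<alpha> V \<mu> p \<beta> r v w"
  shows "\<kappa> * integral\<^sup>L (lborel \<Otimes>\<^sub>M lborel) (gagliardo_quotient s u \<phi>) + (\<integral>x. V x * u x * \<phi> x \<partial>lborel)
     + (\<mu> * kernel_form (riesz_kernel \<alpha>) p u u + \<beta> * kernel_form (riesz_kernel \<alpha>) r u v
         - (\<kappa> * seminorm s u + (\<integral>x. V x * (u x)\<^sup>2 \<partial>lborel))) / a\<^sup>2 * (\<integral>x. u x * \<phi> x \<partial>lborel)
     = \<mu> * choquard_form \<alpha> p u u \<phi> + \<beta> * choquard_form \<alpha> r v u \<phi>"
proof -
  interpret P: riesz_exponent "TYPE('a)" \<alpha> s p by unfold_locales fact+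
  interpret R: riesz_exponent "TYPE('a)" \<alpha> s r by unfold_locales fact+
  note uc = borel_sobolev_crit_space[OF u s] and \<phi>c = borel_sobolev_crit_space[OF \<phi> s]
  note [measurable] = borel_sobolevD(1)[OF u] borel_sobolevD(1)[OF \<phi>]
  let ?z = "\<lambda>x::'a. 0 :: real"
  have zc: "?z \<in> crit_space (2 + 4 * s / real DIM('a))" by (simp add: crit_space_def)
  define b where "b = (\<integral>x. u x * \<phi> x \<partial>lborel) / a\<^sup>2"
  define d where "d = (\<integral>x. (\<phi> x)\<^sup>2 \<partial>lborel) / a\<^sup>2"
  \<comment> \<open>n h is the squared L^2 norm of u + h \<phi> divided by a^2, so (n h)^(-1/2) is
    the factor that returns the curve to the sphere.\<close>
  define n where "n h = 1 + 2 * h * b + h\<^sup>2 * d" for h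
  define Q0 where "Q0 = \<kappa> * seminorm s u + (\<integral>x. V x * (u x)\<^sup>2 \<partial>lborel)"
  define Q1 where "Q1 = \<kappa> * integral\<^sup>L (lborel \<Otimes>\<^sub>M lborel) (gagliardo_quotient s u \<phi>) + (\<integral>x. V x * u x * \<phi> x \<partial>lborel)"
  define Q2 where "Q2 = \<kappa> * seminorm s \<phi> + (\<integral>x. V x * (\<phi> x)\<^sup>2 \<partial>lborel)"
  define U where "U h = (\<lambda>x. u x + h * \<phi> x)" for h
  define Dp where "Dp h = kernel_form (riesz_kernel \<alpha>) p (U h) (U h)" for h
  define Dr where "Dr h = kernel_form (riesz_kernel \<alpha>) r (U h) v" for h
  have i1: "integrable lborel (\<lambda>x. u x * \<phi> x)"
    using integrable_mult_of_squares[of u lborel \<phi> "\<lambda>_. 1"] borel_sobolevD(2)[OF u] borel_sobolevD(2)[OF \<phi>] by simp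
  have iV: "integrable lborel (\<lambda>x. V x * u x * \<phi> x)"
    by (rule integrable_mult_of_squares) (use borel_sobolevD(4)[OF u] borel_sobolevD(4)[OF \<phi>] V0 in auto)
  have Us: "U h \<in> borel_sobolev s V" for h
    unfolding U_def by (intro borel_sobolev_add borel_sobolev_scale u \<phi> V V0)
  have Um: "(\<integral>x. (U h x)\<^sup>2 \<partial>lborel) = a\<^sup>2 * n h" for h
    using weighted_square_expand[of lborel "\<lambda>_. 1" u \<phi> h] i1 borel_sobolevD(2)[OF u] borel_sobolevD(2)[OF \<phi>] a
    by (simp add: U_def mass n_def b_def d_def field_simps)
  have UQ: "\<kappa> * seminorm s (U h) + (\<integral>x. V x * (U h x)\<^sup>2 \<partial>lborel) = Q0 + 2 * h * Q1 + h\<^sup>2 * Q2" for h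
    using weighted_square_expand[OF borel_sobolevD(4)[OF u] iV borel_sobolevD(4)[OF \<phi>], of h] seminorm_expand[OF u \<phi>, of h]
    by (simp add: U_def Q0_def Q1_def Q2_def algebra_simps)
  have Dp': "(Dp has_real_derivative 2 * p * choquard_form \<alpha> p u u \<phi>) (at 0)"
    using P.riesz_form_has_derivative[OF uc uc \<phi>c \<phi>c] unfolding Dp_def U_def by (simp add: algebra_simps)
  have Dr': "(Dr has_real_derivative r * choquard_form \<alpha> r v u \<phi>) (at 0)"
  proof -
    have "choquard_form \<alpha> r u v ?z = 0" by (simp add: choquard_form_def case_prod_beta')
    then show ?thesis using R.riesz_form_has_derivative[OF uc v \<phi>c zc] unfolding Dr_def U_def by simp
  qed
  \<comment> \<open>Homogeneity of the energy terms: the quadratic part has degree 2, the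
    self-interaction degree 2p, the coupling degree r in its first argument. The factor (n h)^(-1/2)
    thus appears as 1 / n h, (n h)^(-p) and (n h)^(-r/2).\<close>
  define F where "F h = (Q0 + 2 * h * Q1 + h\<^sup>2 * Q2) / n h / 2 - \<mu> / (2 * p) * (Dp h * n h powr (- p)) - \<beta> / r * (Dr h * n h powr (- r / 2))" for h
  have sq: "(t powr (- 1 / 2))\<^sup>2 = 1 / t" if "0 < t" for t :: real
  proof -
    have "(t powr (- 1 / 2))\<^sup>2 = t powr (- 1 / 2 + - 1 / 2)" unfolding power2_eq_square powr_add ..
    then show ?thesis using that by (simp add: powr_minus_divide)
  qed
  have FJ: "F h = partial_energy \<kappa> s \<alpha> V \<mu> p \<beta> r v (\<lambda>x. n h powr (- 1 / 2) * U h x)" if n: "0 < n h" for h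
  proof -
    have kf1: "kernel_form (riesz_kernel \<alpha>) p (\<lambda>x. n h powr (- 1 / 2) * U h x) (\<lambda>x. n h powr (- 1 / 2) * U h x) = n h powr (- p) * Dp h"
      unfolding kernel_form_scale Dp_def by (simp add: powr_powr flip: powr_add)
    have kf2: "kernel_form (riesz_kernel \<alpha>) r (\<lambda>x. n h powr (- 1 / 2) * U h x) v = n h powr (- r / 2) * Dr h"
      using kernel_form_scale[of "riesz_kernel \<alpha>" r "n h powr (- 1 / 2)" "U h" 1 v] unfolding Dr_def by (simp add: powr_powr)
    show ?thesis
      unfolding F_def partial_energy_def kf1 kf2 borel_sobolev_scale(2,3)[OF Us] sq[OF n] UQ[symmetric]
      by (simp add: algebra_simps add_divide_distrib)
  qed
  have F0: "F 0 = partial_energy \<kappa> s \<alpha> V \<mu> p \<beta> r v u"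
    using FJ[of 0] by (simp add: n_def U_def)
  have "isCont n 0" unfolding n_def by (intro continuous_intros)
  then have "(n \<longlongrightarrow> n 0) (nhds 0)" by (simp only: isCont_def tendsto_at_iff_tendsto_nhds)
  then have "\<forall>\<^sub>F h in nhds 0. 0 < n h"
    by (rule order_tendstoD(1)) (simp add: n_def)
  \<comment> \<open>Only where n h is positive is F h the energy of a function on the sphere; a
    local minimum at 0 is all that the derivative test asks for.\<close>
  then obtain \<delta> where \<delta>: "0 < \<delta>" "\<And>h. \<bar>h\<bar> < \<delta> \<Longrightarrow> 0 < n h"
    unfolding eventually_nhds_metric by (auto simp: dist_real_def)
  have loc: "F 0 \<le> F h" if "\<bar>0 - h\<bar> < \<delta>" for h
  proof -
    have n: "0 < n h" using \<delta>(2) that by simp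
    have "(\<integral>x. (n h powr (- 1 / 2) * U h x)\<^sup>2 \<partial>lborel) = (n h powr (- 1 / 2))\<^sup>2 * (a\<^sup>2 * n h)"
      by (simp add: power_mult_distrib Um)
    also have "\<dots> = a\<^sup>2" unfolding sq[OF n] using n by simp
    finally show ?thesis
      unfolding F0 FJ[OF n] by (intro min borel_sobolev_scale(1)[OF Us])
  qed
  have n': "(n has_real_derivative 2 * b) (at 0)"
    unfolding n_def by (auto intro!: derivative_eq_intros)
  have n0: "n 0 = 1" by (simp add: n_def)
  have npowr: "((\<lambda>h. n h powr e) has_real_derivative e * (2 * b)) (at 0)" for e
    using DERIV_powr[OF n' _ DERIV_const[of e]] n0 by (simp add: mult_ac)
  have "(F has_real_derivative (2 * Q1 - Q0 * (2 * b)) / 2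
      - \<mu> / (2 * p) * (2 * p * choquard_form \<alpha> p u u \<phi> + (- p) * (2 * b) * Dp 0)
      - \<beta> / r * (r * choquard_form \<alpha> r v u \<phi> + (- r / 2) * (2 * b) * Dr 0)) (at 0)"
  proof -
    have q: "((\<lambda>h. Q0 + 2 * h * Q1 + h\<^sup>2 * Q2) has_real_derivative 2 * Q1) (at 0)"
      by (auto intro!: derivative_eq_intros)
    have "((\<lambda>h. (Q0 + 2 * h * Q1 + h\<^sup>2 * Q2) / n h) has_real_derivative 2 * Q1 - Q0 * (2 * b)) (at 0)"
      using DERIV_divide[OF q n'] n0 by simp
    moreover have "((\<lambda>h. Dp h * n h powr (- p)) has_real_derivative 2 * p * choquard_form \<alpha> p u u \<phi> + (- p) * (2 * b) * Dp 0) (at 0)"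
      using DERIV_mult[OF Dp' npowr[of "- p"]] n0 by simp
    moreover have "((\<lambda>h. Dr h * n h powr (- r / 2)) has_real_derivative r * choquard_form \<alpha> r v u \<phi> + (- r / 2) * (2 * b) * Dr 0) (at 0)"
      using DERIV_mult[OF Dr' npowr[of "- r / 2"]] n0 by simp
    ultimately show ?thesis
      unfolding F_def by (intro DERIV_diff DERIV_cmult DERIV_cdivide)
  qed
  then have "(2 * Q1 - Q0 * (2 * b)) / 2
      - \<mu> / (2 * p) * (2 * p * choquard_form \<alpha> p u u \<phi> + (- p) * (2 * b) * Dp 0)
      - \<beta> / r * (r * choquard_form \<alpha> r v u \<phi> + (- r / 2) * (2 * b) * Dr 0) = 0"
    by (rule DERIV_local_min[OF _ \<delta>(1)]) (use loc in auto)
  moreover have "\<mu> / (2 * p) * (2 * p * X + (- p) * (2 * b) * Y) = \<mu> * (X - b * Y)" for X Y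
    using P.r_gt_1 by (simp add: field_simps)
  moreover have "\<beta> / r * (r * X + (- r / 2) * (2 * b) * Y) = \<beta> * (X - b * Y)" for X Y
    using R.r_gt_1 by (simp add: field_simps)
  ultimately have "(2 * Q1 - Q0 * (2 * b)) / 2 - \<mu> * (choquard_form \<alpha> p u u \<phi> - b * Dp 0)
      - \<beta> * (choquard_form \<alpha> r v u \<phi> - b * Dr 0) = 0"
    by (simp only:)
  \<comment> \<open>Every term with the factor b = \<integral> u \<phi> / a^2 comes from the
    normalisation. Their coefficients do not involve \<phi> and together form the
    multiplier.\<close>
  then have "Q1 - Q0 * b = \<mu> * (choquard_form \<alpha> p u u \<phi> - b * Dp 0) + \<beta> * (choquard_form \<alpha> r v u \<phi> - b * Dr 0)"
    by (simp add: diff_divide_distrib)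
  moreover have "Dp 0 = kernel_form (riesz_kernel \<alpha>) p u u" "Dr 0 = kernel_form (riesz_kernel \<alpha>) r u v"
    by (simp_all add: Dp_def Dr_def U_def)
  ultimately show ?thesis
    unfolding Q1_def[symmetric] Q0_def[symmetric] by (simp add: b_def algebra_simps diff_divide_distrib add_divide_distrib)
qed

subsection \<open>Existence of minimisers\<close>

text \<open>A rescaled tent function works: it is Lipschitz, bounded and supported in the unit ball,
  where V is essentially bounded.\<close>

lemma borel_sobolev_sphere_nonempty:
  fixes V :: "'a::euclidean_space \<Rightarrow> real"
  assumes s: "0 < s" "s < 1" and V[measurable]: "V \<in> borel_measurable borel" and V0: "\<And>x. 0 \<le> V x"
    and loc: "\<And>R. \<exists>C. AE x in lborel. norm x \<le> R \<longrightarrow> V x \<le> C"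
  shows "\<exists>w \<in> borel_sobolev s V. (\<integral>x. (w x)\<^sup>2 \<partial>lborel) = a\<^sup>2"
proof -
  let ?n = "real DIM('a)"
  define w0 :: "'a \<Rightarrow> real" where "w0 x = max 0 (1 - norm x)" for x
  define f :: "'a \<Rightarrow> real" where "f = indicator (ball 0 1)"
  \<comment> \<open>Near 0 the Lipschitz bound leaves |z|^(2-n-2s), integrable because s < 1; away
    from 0 the bound 1 leaves |z|^(-n-2s), integrable because s > 0. The factor f x + f y used later
    records that the difference vanishes when both points lie outside the unit ball.\<close>
  define H :: "'a \<Rightarrow> real" where "H z = indicator (ball 0 1) z * norm z powr (- (?n + 2 * s - 2)) + indicator (- ball 0 1) z * norm z powr (- (?n + 2 * s))" for z
  have [measurable]: "w0 \<in> borel_measurable borel" unfolding w0_def by measurable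
  have f: "integrable lborel f" "0 \<le> f x" for x
    using emeasure_lborel_ball_finite[of "0::'a" 1] unfolding f_def by (auto intro!: integrable_real_indicator)
  have H0: "0 \<le> H z" for z by (simp add: H_def)
  have "integrable lborel (\<lambda>z::'a. indicator (ball 0 1) z * norm z powr (- (?n + 2 * s - 2)))"
    using nn_integral_norm_powr_ball[where 'a='a, of "?n + 2 * s - 2"] s
    by (intro integrableI_nonneg) (auto intro!: borel_measurable_times borel_measurable_indicator)
  moreover have "integrable lborel (\<lambda>z::'a. indicator (- ball 0 1) z * norm z powr (- (?n + 2 * s)))"
    using nn_integral_norm_powr_outside_ball[where 'a='a, of "?n + 2 * s"] s
    by (intro integrableI_nonneg) (auto intro!: borel_measurable_times borel_measurable_indicator)
  ultimately have H: "integrable lborel H" unfolding H_def by (rule Bochner_Integration.integrable_add)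
  have w0f: "0 \<le> w0 x" "w0 x \<le> f x" "w0 x \<le> 1" for x
    by (auto simp: w0_def f_def indicator_def)
  have sq: "(w0 x)\<^sup>2 \<le> f x" for x
  proof -
    have "(w0 x)\<^sup>2 \<le> w0 x * 1" unfolding power2_eq_square using w0f by (intro mult_left_mono)
    then show ?thesis using w0f(2)[of x] by linarith
  qed
  have i1: "integrable lborel (\<lambda>x. (w0 x)\<^sup>2)"
    by (rule Bochner_Integration.integrable_bound[OF f(1)]) (use sq f(2) in auto)
  obtain C where C: "AE x in lborel. norm x \<le> 1 \<longrightarrow> V x \<le> C" using loc by blast
  have i2: "integrable lborel (\<lambda>x. V x * (w0 x)\<^sup>2)"
  proof (rule Bochner_Integration.integrable_bound)
    show "integrable lborel (\<lambda>x. C * (w0 x)\<^sup>2)" using i1 by simp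
    show "AE x in lborel. norm (V x * (w0 x)\<^sup>2) \<le> norm (C * (w0 x)\<^sup>2)"
      using C
    proof eventually_elim
      case (elim x)
      show ?case
      proof (cases "norm x \<le> 1")
        case True
        then show ?thesis using elim V0[of x] by (simp add: abs_mult mult_right_mono)
      qed (simp add: w0_def)
    qed
  qed measurable
  have i3: "integrable (lborel \<Otimes>\<^sub>M lborel) (gagliardo_quotient s w0 w0)"
  proof (rule Bochner_Integration.integrable_bound[OF young_majorant_integral(1)[OF f f H H0]])
    show "AE z in lborel \<Otimes>\<^sub>M lborel. norm (gagliardo_quotient s w0 w0 z) \<le> norm (case z of (x, y) \<Rightarrow> f x * f y + H (x - y) * (f x + f y))"
    proof (rule AE_I2, clarify)
      fix x y :: 'a
      define t where "t = norm (x - y)"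
      have d1: "\<bar>w0 x - w0 y\<bar> \<le> t" unfolding w0_def t_def
        using norm_triangle_ineq3[of x y] by (auto simp: max_def)
      have d2: "\<bar>w0 x - w0 y\<bar> \<le> f x + f y"
        using w0f(1)[of x] w0f(1)[of y] w0f(2)[of x] w0f(2)[of y] by linarith
      have d3: "\<bar>w0 x - w0 y\<bar> \<le> 1"
        using w0f(1)[of x] w0f(1)[of y] w0f(3)[of x] w0f(3)[of y] by linarith
      have "(w0 x - w0 y)\<^sup>2 / t powr (?n + 2 * s) \<le> H (x - y) * (f x + f y)"
      proof (cases "f x + f y = 0")
        case True
        then show ?thesis using d2 H0 by simp
      next
        case False
        then have f1: "1 \<le> f x + f y" by (auto simp: f_def indicator_def split: if_splits)
        have "(w0 x - w0 y)\<^sup>2 / t powr (?n + 2 * s) \<le> H (x - y)"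
        proof (cases "t < 1")
          case True
          show ?thesis
          proof (cases "t = 0")
            case False
            then have t: "0 < t" by (simp add: t_def)
            have "(w0 x - w0 y)\<^sup>2 \<le> t\<^sup>2" using d1 by (simp add: abs_le_square_iff[symmetric])
            then have "(w0 x - w0 y)\<^sup>2 / t powr (?n + 2 * s) \<le> t\<^sup>2 / t powr (?n + 2 * s)"
              by (intro divide_right_mono) auto
            also have "\<dots> = t powr (2 - (?n + 2 * s))" using t by (simp add: powr_diff)
            also have "\<dots> = H (x - y)" using True by (simp add: H_def t_def algebra_simps)
            finally show ?thesis .
          qed (use H0 in simp)
        next
          case F: False
          have "(w0 x - w0 y)\<^sup>2 \<le> 1" using d3 by (simp add: abs_square_le_1)
          then have "(w0 x - w0 y)\<^sup>2 / t powr (?n + 2 * s) \<le> 1 / t powr (?n + 2 * s)"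
            by (intro divide_right_mono) auto
          also have "\<dots> = t powr (- (?n + 2 * s))" by (simp only: powr_minus_divide)
          also have "\<dots> = H (x - y)" using F by (simp add: H_def t_def)
          finally show ?thesis .
        qed
        also have "\<dots> \<le> H (x - y) * (f x + f y)" using f1 H0[of "x - y"] by (simp add: mult_le_cancel_left1)
        finally show ?thesis .
      qed
      moreover have "gagliardo_quotient s w0 w0 (x, y) = (w0 x - w0 y)\<^sup>2 / t powr (?n + 2 * s)"
        by (simp add: gagliardo_quotient_def t_def power2_eq_square)
      moreover have "0 \<le> f x * f y" using f(2) by simp
      ultimately show "norm (gagliardo_quotient s w0 w0 (x, y)) \<le> norm (f x * f y + H (x - y) * (f x + f y))"
        using gagliardo_quotient_nonneg[of s w0 "(x, y)"] by simp
    qed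
  qed measurable
  have w0: "w0 \<in> borel_sobolev s V" using i1 i2 i3 by (simp add: borel_sobolev_def)
  have pos: "0 < (\<integral>x. (w0 x)\<^sup>2 \<partial>lborel)"
  proof -
    have "0 < measure lborel (ball (0::'a) (1/2)) / 4" by (simp add: content_ball)
    also have "measure lborel (ball (0::'a) (1/2)) / 4 = (\<integral>x. indicator (ball (0::'a) (1/2)) x / 4 \<partial>lborel)"
      by simp
    also have "\<dots> \<le> (\<integral>x. (w0 x)\<^sup>2 \<partial>lborel)"
    proof (rule integral_mono[OF _ i1])
      show "integrable lborel (\<lambda>x::'a. indicator (ball 0 (1/2)) x / 4 :: real)"
        using emeasure_lborel_ball_finite[of "0::'a" "1/2"] by (intro integrable_divide integrable_real_indicator) auto
      fix x :: 'a
      show "indicator (ball 0 (1/2)) x / 4 \<le> (w0 x)\<^sup>2"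
      proof (cases "x \<in> ball 0 (1/2)")
        case True
        then have "1/2 \<le> w0 x" by (simp add: w0_def)
        then have "(1/2)\<^sup>2 \<le> (w0 x)\<^sup>2" by (intro power_mono) auto
        then show ?thesis using True by (simp add: power2_eq_square)
      qed simp
    qed
    finally show ?thesis .
  qed
  define c where "c = a / sqrt (\<integral>x. (w0 x)\<^sup>2 \<partial>lborel)"
  have "(\<integral>x. (c * w0 x)\<^sup>2 \<partial>lborel) = a\<^sup>2"
    using pos by (simp add: power_mult_distrib c_def power_divide)
  then show ?thesis using borel_sobolev_scale(1)[OF w0, of c]
    by (intro bexI[of _ "\<lambda>x. c * w0 x"])
qed

lemma kernel_form_riesz_commute:
  assumes [measurable]: "u \<in> borel_measurable borel" "v \<in> borel_measurable borel"
  shows "kernel_form (riesz_kernel \<alpha>) r u v = kernel_form (riesz_kernel \<alpha>) r v u"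
  unfolding kernel_form_def by (rule integral_riesz_swap) measurable

lemma kernel_form_abs: "kernel_form k r (\<lambda>x. \<bar>u x\<bar>) (\<lambda>x. \<bar>v x\<bar>) = kernel_form k r u v"
  by (simp add: kernel_form_def)

lemma borel_sobolev_abs:
  assumes u: "u \<in> borel_sobolev s V" and V: "V \<in> borel_measurable borel" "\<And>x. 0 \<le> V x"
  shows "(\<lambda>x. \<bar>u x\<bar>) \<in> borel_sobolev s V" "seminorm s (\<lambda>x. \<bar>u x\<bar>) \<le> seminorm s u"
proof -
  have m: "(\<lambda>x. \<bar>u x\<bar>) \<in> borel_measurable borel" using borel_sobolevD(1)[OF u] by simp
  note b = borel_sobolev_bound[OF u m V(1) _ abs_triangle_ineq3 V(2)]
  show 1: "(\<lambda>x. \<bar>u x\<bar>) \<in> borel_sobolev s V" by (rule b(1)) simp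
  show "seminorm s (\<lambda>x. \<bar>u x\<bar>) \<le> seminorm s u"
    by (rule integral_mono[OF borel_sobolevD(3)[OF 1] borel_sobolevD(3)[OF u] b(2)]) simp
qed

text \<open>The joint energy \<open>J\<close> attains its infimum. The conclusion keeps only
  minimality in each component with the other frozen, which is the form in which the Euler-Lagrange
  equations use it.\<close>

theorem choquard_minimiser:
  fixes V1 V2 :: "'a::euclidean_space \<Rightarrow> real"
  assumes \<alpha>: "0 < \<alpha>" "\<alpha> < real DIM('a)" and s: "0 < s" "s < 1"
    and p: "1 + \<alpha> / real DIM('a) < p" "p < 1 + (\<alpha> + 2 * s) / real DIM('a)"
    and q: "1 + \<alpha> / real DIM('a) < q" "q < 1 + (\<alpha> + 2 * s) / real DIM('a)"
    and r: "1 + \<alpha> / real DIM('a) < r" "r < 1 + (\<alpha> + 2 * s) / real DIM('a)"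
    and V1: "V1 \<in> borel_measurable borel" "\<And>x. 0 \<le> V1 x" "\<And>R. \<exists>C. AE x in lborel. norm x \<le> R \<longrightarrow> V1 x \<le> C"
      "\<And>L. \<exists>R. AE x in lborel. R \<le> norm x \<longrightarrow> L \<le> V1 x"
    and V2: "V2 \<in> borel_measurable borel" "\<And>x. 0 \<le> V2 x" "\<And>R. \<exists>C. AE x in lborel. norm x \<le> R \<longrightarrow> V2 x \<le> C"
      "\<And>L. \<exists>R. AE x in lborel. R \<le> norm x \<longrightarrow> L \<le> V2 x"
    and pos: "0 < \<kappa>" "0 < \<mu>1" "0 < \<mu>2" "0 < \<beta>" "0 < a" "0 < b"
  obtains u v where "u \<in> borel_sobolev s V1" "v \<in> borel_sobolev s V2" "\<And>x. 0 \<le> u x" "\<And>x. 0 \<le> v x"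
    "(\<integral>x. (u x)\<^sup>2 \<partial>lborel) = a\<^sup>2" "(\<integral>x. (v x)\<^sup>2 \<partial>lborel) = b\<^sup>2"
    "\<And>w. w \<in> borel_sobolev s V1 \<Longrightarrow> (\<integral>x. (w x)\<^sup>2 \<partial>lborel) = a\<^sup>2 \<Longrightarrow>
       partial_energy \<kappa> s \<alpha> V1 \<mu>1 p \<beta> r v u \<le> partial_energy \<kappa> s \<alpha> V1 \<mu>1 p \<beta> r v w"
    "\<And>w. w \<in> borel_sobolev s V2 \<Longrightarrow> (\<integral>x. (w x)\<^sup>2 \<partial>lborel) = b\<^sup>2 \<Longrightarrow>
       partial_energy \<kappa> s \<alpha> V2 \<mu>2 q \<beta> r u v \<le> partial_energy \<kappa> s \<alpha> V2 \<mu>2 q \<beta> r u w"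
proof -
  interpret P: riesz_exponent "TYPE('a)" \<alpha> s p by unfold_locales fact+
  interpret Q: riesz_exponent "TYPE('a)" \<alpha> s q by unfold_locales fact+
  interpret R: riesz_exponent "TYPE('a)" \<alpha> s r by unfold_locales fact+
  let ?M = "2 + 4 * s / real DIM('a)"
  let ?D = "kernel_form (riesz_kernel \<alpha>)"
  define T1 where "T1 u = (\<integral>x. V1 x * (u x)\<^sup>2 \<partial>lborel)" for u
  define T2 where "T2 u = (\<integral>x. V2 x * (u x)\<^sup>2 \<partial>lborel)" for u
  define J where "J u v = (\<kappa> * seminorm s u + T1 u) / 2 + (\<kappa> * seminorm s v + T2 v) / 2
    - \<mu>1 / (2 * p) * ?D p u u - \<mu>2 / (2 * q) * ?D q v v - \<beta> / r * ?D r u v" for u v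
  define A1 where "A1 = {u \<in> borel_sobolev s V1. (\<integral>x. (u x)\<^sup>2 \<partial>lborel) = a\<^sup>2}"
  define A2 where "A2 = {v \<in> borel_sobolev s V2. (\<integral>x. (v x)\<^sup>2 \<partial>lborel) = b\<^sup>2}"
  have T0: "0 \<le> T1 u" "0 \<le> T2 u" for u
    using V1(2) V2(2) by (simp_all add: T1_def T2_def integral_nonneg_AE)
  define m where "m = \<mu>1 / (2 * p) + \<mu>2 / (2 * q) + \<beta> / r"
  have co: "0 < \<mu>1 / (2 * p)" "0 < \<mu>2 / (2 * q)" "0 < \<beta> / r"
    using pos P.r_gt_1 Q.r_gt_1 R.r_gt_1 by simp_all
  have m0: "0 < m" using co by (simp add: m_def)
  define G where "G c = 4 / unit_ball_vol (real DIM('a)) * (4 * c / unit_ball_vol (real DIM('a))) powr (2 * s / real DIM('a))" for c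
  \<comment> \<open>One constant above both masses and both Gagliardo-Nirenberg factors, as the
    sublinear bounds take a single \<open>c\<close> for all of them.\<close>
  define c where "c = a\<^sup>2 + b\<^sup>2 + G (a\<^sup>2) + G (b\<^sup>2)"
  have G0: "0 \<le> G t" for t by (simp add: G_def)
  have c0: "0 < c" using pos G0[of "a\<^sup>2"] G0[of "b\<^sup>2"] by (simp add: c_def add_pos_nonneg)
  \<comment> \<open>With this choice the three D terms together cost m \<epsilon> E = \<kappa> E /
    4, half of the available \<kappa> E / 2.\<close>
  define \<epsilon> where "\<epsilon> = \<kappa> / (4 * m)"
  have \<epsilon>: "0 < \<epsilon>" using pos m0 by (simp add: \<epsilon>_def)
  obtain Cp where Cp: "\<And>w z E. \<lbrakk>w \<in> crit_space ?M; z \<in> crit_space ?M; 0 \<le> E; (\<integral>x. (w x)\<^sup>2 \<partial>lborel) \<le> c; (\<integral>x. (z x)\<^sup>2 \<partial>lborel) \<le> c;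
     (\<integral>x. \<bar>w x\<bar> powr ?M \<partial>lborel) \<le> c * E; (\<integral>x. \<bar>z x :: real\<bar> powr ?M \<partial>lborel) \<le> c * E\<rbrakk> \<Longrightarrow> ?D p w (z :: 'a \<Rightarrow> real) \<le> \<epsilon> * E + Cp"
    using P.riesz_form_sublinear[OF c0 \<epsilon>] by blast
  obtain Cq where Cq: "\<And>w z E. \<lbrakk>w \<in> crit_space ?M; z \<in> crit_space ?M; 0 \<le> E; (\<integral>x. (w x)\<^sup>2 \<partial>lborel) \<le> c; (\<integral>x. (z x)\<^sup>2 \<partial>lborel) \<le> c;
     (\<integral>x. \<bar>w x\<bar> powr ?M \<partial>lborel) \<le> c * E; (\<integral>x. \<bar>z x :: real\<bar> powr ?M \<partial>lborel) \<le> c * E\<rbrakk> \<Longrightarrow> ?D q w (z :: 'a \<Rightarrow> real) \<le> \<epsilon> * E + Cq"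
    using Q.riesz_form_sublinear[OF c0 \<epsilon>] by blast
  obtain Cr where Cr: "\<And>w z E. \<lbrakk>w \<in> crit_space ?M; z \<in> crit_space ?M; 0 \<le> E; (\<integral>x. (w x)\<^sup>2 \<partial>lborel) \<le> c; (\<integral>x. (z x)\<^sup>2 \<partial>lborel) \<le> c;
     (\<integral>x. \<bar>w x\<bar> powr ?M \<partial>lborel) \<le> c * E; (\<integral>x. \<bar>z x :: real\<bar> powr ?M \<partial>lborel) \<le> c * E\<rbrakk> \<Longrightarrow> ?D r w (z :: 'a \<Rightarrow> real) \<le> \<epsilon> * E + Cr"
    using R.riesz_form_sublinear[OF c0 \<epsilon>] by blast
  define K where "K = \<mu>1 / (2 * p) * Cp + \<mu>2 / (2 * q) * Cq + \<beta> / r * Cr"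
  have coercive: "\<kappa> / 4 * (seminorm s u + seminorm s v) + (T1 u + T2 v) / 2 - K \<le> J u v" if uA: "u \<in> A1" and vA: "v \<in> A2" for u v
  proof -
    define E where "E = seminorm s u + seminorm s v"
    have u: "u \<in> borel_sobolev s V1" "(\<integral>x. (u x)\<^sup>2 \<partial>lborel) = a\<^sup>2" using uA by (auto simp: A1_def)
    have v: "v \<in> borel_sobolev s V2" "(\<integral>x. (v x)\<^sup>2 \<partial>lborel) = b\<^sup>2" using vA by (auto simp: A2_def)
    have E: "0 \<le> E" "seminorm s u \<le> E" "seminorm s v \<le> E"
      using seminorm_nonneg[of s u] seminorm_nonneg[of s v] by (auto simp: E_def)
    have um: "(\<integral>x. (u x)\<^sup>2 \<partial>lborel) \<le> c" and vm: "(\<integral>x. (v x)\<^sup>2 \<partial>lborel) \<le> c"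
      using u v G0[of "a\<^sup>2"] G0[of "b\<^sup>2"] by (simp_all add: c_def)
    have uM: "(\<integral>x. \<bar>u x\<bar> powr ?M \<partial>lborel) \<le> c * E"
    proof -
      have "(\<integral>x. \<bar>u x\<bar> powr ?M \<partial>lborel) \<le> G (a\<^sup>2) * seminorm s u"
        unfolding G_def by (rule borel_sobolev_critical_bound(2)[OF u(1) s(1)]) (use u(2) pos in auto)
      also have "\<dots> \<le> c * E"
        using E G0 c0 seminorm_nonneg[of s u] by (intro mult_mono) (auto simp: c_def add_nonneg_nonneg)
      finally show ?thesis .
    qed
    have vM: "(\<integral>x. \<bar>v x\<bar> powr ?M \<partial>lborel) \<le> c * E"
    proof -
      have "(\<integral>x. \<bar>v x\<bar> powr ?M \<partial>lborel) \<le> G (b\<^sup>2) * seminorm s v"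
        unfolding G_def by (rule borel_sobolev_critical_bound(2)[OF v(1) s(1)]) (use v(2) pos in auto)
      also have "\<dots> \<le> c * E"
        using E G0 c0 seminorm_nonneg[of s v] by (intro mult_mono) (auto simp: c_def add_nonneg_nonneg)
      finally show ?thesis .
    qed
    note uc = borel_sobolev_crit_space[OF u(1) s(1)] and vc = borel_sobolev_crit_space[OF v(1) s(1)]
    have "\<mu>1 / (2 * p) * ?D p u u \<le> \<mu>1 / (2 * p) * (\<epsilon> * E + Cp)"
      using co by (intro mult_left_mono Cp uc um uM E) auto
    moreover have "\<mu>2 / (2 * q) * ?D q v v \<le> \<mu>2 / (2 * q) * (\<epsilon> * E + Cq)"
      using co by (intro mult_left_mono Cq vc vm vM E) auto
    moreover have "\<beta> / r * ?D r u v \<le> \<beta> / r * (\<epsilon> * E + Cr)"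
      using co by (intro mult_left_mono Cr uc um uM vc vm vM E) auto
    moreover have "\<mu>1 / (2 * p) * (\<epsilon> * E + Cp) + \<mu>2 / (2 * q) * (\<epsilon> * E + Cq) + \<beta> / r * (\<epsilon> * E + Cr) = m * \<epsilon> * E + K"
      unfolding m_def K_def by algebra
    moreover have "m * \<epsilon> * E = \<kappa> / 4 * E" using m0 by (simp add: \<epsilon>_def)
    moreover have "J u v = \<kappa> * E / 2 + (T1 u + T2 v) / 2 - \<mu>1 / (2 * p) * ?D p u u - \<mu>2 / (2 * q) * ?D q v v - \<beta> / r * ?D r u v"
      unfolding J_def E_def by (simp add: field_simps)
    ultimately have "\<kappa> * E / 2 + (T1 u + T2 v) / 2 - (\<kappa> / 4 * E + K) \<le> J u v" by linarith
    then show ?thesis unfolding E_def[symmetric] by (simp add: mult.commute)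
  qed
  have lower: "- K \<le> J u v" if "u \<in> A1" "v \<in> A2" for u v
  proof -
    define X where "X = \<kappa> / 4 * (seminorm s u + seminorm s v)"
    have "0 \<le> X"
      using pos seminorm_nonneg[of s u] seminorm_nonneg[of s v] by (simp add: X_def)
    then show ?thesis using coercive[OF that, folded X_def] T0(1)[of u] T0(2)[of v] by (simp add: field_simps)
  qed
  define S where "S = {J u v | u v. u \<in> A1 \<and> v \<in> A2}"
  define I where "I = Inf S"
  have Sne: "S \<noteq> {}"
    using borel_sobolev_sphere_nonempty[OF s V1(1-3), of a] borel_sobolev_sphere_nonempty[OF s V2(1-3), of b]
    unfolding S_def A1_def A2_def by blast
  have Sbdd: "bdd_below S" unfolding S_def using lower by (intro bdd_belowI[of _ "- K"]) auto
  have I_le: "I \<le> J u v" if "u \<in> A1" "v \<in> A2" for u v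
    unfolding I_def by (rule cInf_lower[OF _ Sbdd]) (use that in \<open>auto simp: S_def\<close>)
  have "\<exists>u v. u \<in> A1 \<and> v \<in> A2 \<and> (\<forall>x. 0 \<le> u x) \<and> (\<forall>x. 0 \<le> v x) \<and> J u v < I + 1 / (real i + 1)" for i :: nat
  proof -
    have "Inf S < I + 1 / (real i + 1)" by (simp add: I_def)
    from cInf_lessD[OF Sne this] obtain u v where uv: "u \<in> A1" "v \<in> A2" "J u v < I + 1 / (real i + 1)"
      unfolding S_def by blast
    have au: "(\<lambda>x. \<bar>u x\<bar>) \<in> A1" "seminorm s (\<lambda>x. \<bar>u x\<bar>) \<le> seminorm s u"
      using uv borel_sobolev_abs[OF _ V1(1,2), of u s] by (auto simp: A1_def)
    have av: "(\<lambda>x. \<bar>v x\<bar>) \<in> A2" "seminorm s (\<lambda>x. \<bar>v x\<bar>) \<le> seminorm s v"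
      using uv borel_sobolev_abs[OF _ V2(1,2), of v s] by (auto simp: A2_def)
    have "\<kappa> * seminorm s (\<lambda>x. \<bar>u x\<bar>) \<le> \<kappa> * seminorm s u" "\<kappa> * seminorm s (\<lambda>x. \<bar>v x\<bar>) \<le> \<kappa> * seminorm s v"
      using au(2) av(2) pos by simp_all
    moreover have "T1 (\<lambda>x. \<bar>u x\<bar>) = T1 u" "T2 (\<lambda>x. \<bar>v x\<bar>) = T2 v" by (simp_all add: T1_def T2_def)
    ultimately have "J (\<lambda>x. \<bar>u x\<bar>) (\<lambda>x. \<bar>v x\<bar>) \<le> J u v"
      unfolding J_def kernel_form_abs by (intro diff_right_mono add_mono divide_right_mono) auto
    then show ?thesis using uv(3) au(1) av(1)
      by (intro exI[of _ "\<lambda>x. \<bar>u x\<bar>"] exI[of _ "\<lambda>x. \<bar>v x\<bar>"]) auto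
  qed
  then obtain U W where UW: "\<And>i. U i \<in> A1" "\<And>i. W i \<in> A2" "\<And>i x. 0 \<le> U i x" "\<And>i x. 0 \<le> W i x"
      "\<And>i. J (U i) (W i) < I + 1 / (real i + 1)"
    by metis
  have U: "U i \<in> borel_sobolev s V1" "(\<integral>x. (U i x)\<^sup>2 \<partial>lborel) = a\<^sup>2" for i using UW(1)[of i] by (auto simp: A1_def)
  have W: "W i \<in> borel_sobolev s V2" "(\<integral>x. (W i x)\<^sup>2 \<partial>lborel) = b\<^sup>2" for i using UW(2)[of i] by (auto simp: A2_def)
  \<comment> \<open>Coercivity and J < I + 1 + (rounding at most 0) give X + Y \<le> I + 1 + K for
    two nonnegative quantities; 4/\<kappa> and 2 undo their coefficients \<kappa>/4 and 1/2.\<close>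
  define B where "B = max (4 / \<kappa> * (I + 1 + K)) (2 * (I + 1 + K))"
  have bnds: "seminorm s (U i) \<le> B \<and> seminorm s (W i) \<le> B \<and> T1 (U i) \<le> B \<and> T2 (W i) \<le> B" for i
  proof -
    have "1 / (real i + 1) \<le> 1" by simp
    define X where "X = \<kappa> / 4 * (seminorm s (U i) + seminorm s (W i))"
    define Y where "Y = (T1 (U i) + T2 (W i)) / 2"
    have XY: "0 \<le> X" "0 \<le> Y"
      using pos seminorm_nonneg[of s "U i"] seminorm_nonneg[of s "W i"] T0(1)[of "U i"] T0(2)[of "W i"] by (simp_all add: X_def Y_def)
    have le: "X + Y \<le> I + 1 + K"
      using coercive[OF UW(1,2)[of i], folded X_def Y_def] UW(5)[of i] \<open>1 / (real i + 1) \<le> 1\<close> by linarith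
    have "\<kappa> / 4 * (seminorm s (U i) + seminorm s (W i)) \<le> I + 1 + K"
      using le XY unfolding X_def[symmetric] by linarith
    then have "seminorm s (U i) + seminorm s (W i) \<le> 4 / \<kappa> * (I + 1 + K)"
      using pos by (simp add: field_simps)
    moreover have "T1 (U i) + T2 (W i) \<le> 2 * (I + 1 + K)" 
    proof -
      have "Y \<le> I + 1 + K" using le XY by linarith
      then show ?thesis by (simp add: Y_def field_simps)
    qed
    ultimately show ?thesis
      using T0(1)[of "U i"] T0(2)[of "W i"] seminorm_nonneg[of s "U i"] seminorm_nonneg[of s "W i"] unfolding B_def by linarith
  qed
  have b1: "\<And>i. seminorm s (U i) \<le> B" "\<And>i. (\<integral>x. V1 x * (U i x)\<^sup>2 \<partial>lborel) \<le> B"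
    and b2: "\<And>i. seminorm s (W i) \<le> B" "\<And>i. (\<integral>x. V2 x * (W i x)\<^sup>2 \<partial>lborel) \<le> B"
    using bnds unfolding T1_def T2_def by auto
  obtain r1 u e1 e2 where r1: "strict_mono (r1 :: nat \<Rightarrow> nat)" and u: "u \<in> borel_sobolev s V1" "\<And>x. 0 \<le> u x" "(\<integral>x. (u x)\<^sup>2 \<partial>lborel) = a\<^sup>2"
    and uae: "AE x in lborel. (\<lambda>i. U (r1 i) x) \<longlonglongrightarrow> u x"
    and ul: "\<And>t. 2 \<le> t \<Longrightarrow> t < ?M \<Longrightarrow> (\<lambda>i. \<integral>x. \<bar>U (r1 i) x\<bar> powr t \<partial>lborel) \<longlonglongrightarrow> (\<integral>x. \<bar>u x\<bar> powr t \<partial>lborel)"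
    and ue0: "(\<lambda>i. seminorm s (U (r1 i))) \<longlonglongrightarrow> e1" "seminorm s u \<le> e1"
      "(\<lambda>i. \<integral>x. V1 x * (U (r1 i) x)\<^sup>2 \<partial>lborel) \<longlonglongrightarrow> e2" "(\<integral>x. V1 x * (u x)\<^sup>2 \<partial>lborel) \<le> e2"
    by (rule borel_sobolev_compact_embedding[of V1 s U "a\<^sup>2" B, OF V1(1,2,4) s(1) U(1) U(2) UW(3) b1]) (rule that)
  note ue = ue0[folded T1_def]
  \<comment> \<open>The second extraction runs inside the first; the limits found for the first
    component are then carried over to the common subsequence \<rho>.\<close>
  obtain r2 v d1 d2 where r2: "strict_mono (r2 :: nat \<Rightarrow> nat)" and v: "v \<in> borel_sobolev s V2" "\<And>x. 0 \<le> v x" "(\<integral>x. (v x)\<^sup>2 \<partial>lborel) = b\<^sup>2"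
    and vae: "AE x in lborel. (\<lambda>i. W (r1 (r2 i)) x) \<longlonglongrightarrow> v x"
    and vl: "\<And>t. 2 \<le> t \<Longrightarrow> t < ?M \<Longrightarrow> (\<lambda>i. \<integral>x. \<bar>W (r1 (r2 i)) x\<bar> powr t \<partial>lborel) \<longlonglongrightarrow> (\<integral>x. \<bar>v x\<bar> powr t \<partial>lborel)"
    and ve0: "(\<lambda>i. seminorm s (W (r1 (r2 i)))) \<longlonglongrightarrow> d1" "seminorm s v \<le> d1"
      "(\<lambda>i. \<integral>x. V2 x * (W (r1 (r2 i)) x)\<^sup>2 \<partial>lborel) \<longlonglongrightarrow> d2" "(\<integral>x. V2 x * (v x)\<^sup>2 \<partial>lborel) \<le> d2"
    by (rule borel_sobolev_compact_embedding[of V2 s "\<lambda>i. W (r1 i)" "b\<^sup>2" B, OF V2(1,2,4) s(1) W(1) W(2) UW(4) b2]) (rule that)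
  note ve = ve0[folded T2_def]
  define \<rho> where "\<rho> i = r1 (r2 i)" for i
  have \<rho>: "strict_mono \<rho>" using r1 r2 by (simp add: \<rho>_def strict_mono_def)
  have uae': "AE x in lborel. (\<lambda>i. U (\<rho> i) x) \<longlonglongrightarrow> u x"
    using uae by eventually_elim (use LIMSEQ_subseq_LIMSEQ[OF _ r2] in \<open>auto simp: o_def \<rho>_def\<close>)
  have ul': "(\<lambda>i. \<integral>x. \<bar>U (\<rho> i) x\<bar> powr t \<partial>lborel) \<longlonglongrightarrow> (\<integral>x. \<bar>u x\<bar> powr t \<partial>lborel)" if "2 \<le> t" "t < ?M" for t
    using LIMSEQ_subseq_LIMSEQ[OF ul[OF that] r2] by (simp add: o_def \<rho>_def)
  have ue': "(\<lambda>i. seminorm s (U (\<rho> i))) \<longlonglongrightarrow> e1" "(\<lambda>i. T1 (U (\<rho> i))) \<longlonglongrightarrow> e2"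
    using LIMSEQ_subseq_LIMSEQ[OF ue(1) r2] LIMSEQ_subseq_LIMSEQ[OF ue(3) r2] by (simp_all add: o_def \<rho>_def)
  note vae' = vae[folded \<rho>_def] and vl' = vl[folded \<rho>_def] and ve' = ve(1,3)[folded \<rho>_def]
  note Uc = borel_sobolev_crit_space[OF U(1) s(1)] and Wc = borel_sobolev_crit_space[OF W(1) s(1)]
    and uc = borel_sobolev_crit_space[OF u(1) s(1)] and vc = borel_sobolev_crit_space[OF v(1) s(1)]
  have Dp: "(\<lambda>i. ?D p (U (\<rho> i)) (U (\<rho> i))) \<longlonglongrightarrow> ?D p u u"
    by (rule P.riesz_form_tendsto[OF Uc uc Uc uc ul' ul' uae' uae'])
  have Dq: "(\<lambda>i. ?D q (W (\<rho> i)) (W (\<rho> i))) \<longlonglongrightarrow> ?D q v v"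
    by (rule Q.riesz_form_tendsto[OF Wc vc Wc vc vl' vl' vae' vae'])
  have Dr: "(\<lambda>i. ?D r (U (\<rho> i)) (W (\<rho> i))) \<longlonglongrightarrow> ?D r u v"
    by (rule R.riesz_form_tendsto[OF Uc uc Wc vc ul' vl' uae' vae'])
  have JL: "(\<lambda>i. J (U (\<rho> i)) (W (\<rho> i))) \<longlonglongrightarrow> (\<kappa> * e1 + e2) / 2 + (\<kappa> * d1 + d2) / 2
    - \<mu>1 / (2 * p) * ?D p u u - \<mu>2 / (2 * q) * ?D q v v - \<beta> / r * ?D r u v"
    unfolding J_def by (intro tendsto_intros ue' ve' Dp Dq Dr) auto
  have "(\<lambda>i. J (U i) (W i)) \<longlonglongrightarrow> I"
  proof (rule tendsto_sandwich[of "\<lambda>_. I" _ _ "\<lambda>i. I + 1 / (real i + 1)"])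
    show "(\<lambda>i. I + 1 / (real i + 1)) \<longlonglongrightarrow> I"
      using tendsto_add[OF tendsto_const[of I] LIMSEQ_Suc[OF lim_const_over_n[of "1::real"]]] by (simp add: add.commute)
    show "\<forall>\<^sub>F i in sequentially. J (U i) (W i) \<le> I + 1 / (real i + 1)"
      using UW(5) by (intro always_eventually allI less_imp_le)
    show "\<forall>\<^sub>F i in sequentially. I \<le> J (U i) (W i)"
      using I_le UW(1,2) by (intro always_eventually allI) auto
  qed simp
  from LIMSEQ_subseq_LIMSEQ[OF this \<rho>] have "(\<lambda>i. J (U (\<rho> i)) (W (\<rho> i))) \<longlonglongrightarrow> I" by (simp add: o_def)
  \<comment> \<open>The D terms have reached their values at (u, v), while \<open>e1\<close>,
    \<open>e2\<close>, \<open>d1\<close>, \<open>d2\<close> may exceed the quadratic energies of the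
    limits. The inequality J u v \<le> I that results is enough, as I is the infimum.\<close>
  then have I_eq: "I = (\<kappa> * e1 + e2) / 2 + (\<kappa> * d1 + d2) / 2
    - \<mu>1 / (2 * p) * ?D p u u - \<mu>2 / (2 * q) * ?D q v v - \<beta> / r * ?D r u v"
    using JL by (rule LIMSEQ_unique)
  have "\<kappa> * seminorm s u \<le> \<kappa> * e1" "\<kappa> * seminorm s v \<le> \<kappa> * d1" using ue(2) ve(2) pos by simp_all
  then have JI: "J u v \<le> I" unfolding I_eq J_def using ue(4) ve(4)
    by (intro diff_right_mono add_mono divide_right_mono) auto
  have uA: "u \<in> A1" and vA: "v \<in> A2" using u v by (auto simp: A1_def A2_def)
  \<comment> \<open>The bracket does not involve w, so comparing J for fixed z compares partial
    energies. In \<open>J2\<close> the varying component sits in the second slot of the coupling,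
    hence the symmetry of the kernel and the measurability conditions.\<close>
  have J1: "J w z = partial_energy \<kappa> s \<alpha> V1 \<mu>1 p \<beta> r z w + ((\<kappa> * seminorm s z + T2 z) / 2 - \<mu>2 / (2 * q) * ?D q z z)" for w z
    by (simp add: J_def partial_energy_def T1_def)
  have J2: "J w z = partial_energy \<kappa> s \<alpha> V2 \<mu>2 q \<beta> r w z + ((\<kappa> * seminorm s w + T1 w) / 2 - \<mu>1 / (2 * p) * ?D p w w)"
    if "w \<in> borel_measurable borel" "z \<in> borel_measurable borel" for w z
    using kernel_form_riesz_commute[OF that, of \<alpha> r] by (simp add: J_def partial_energy_def T2_def)
  show thesis
  proof (rule that[OF u(1) v(1) u(2) v(2) u(3) v(3)])
    fix w assume w: "w \<in> borel_sobolev s V1" "(\<integral>x. (w x)\<^sup>2 \<partial>lborel) = a\<^sup>2"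
    then have "J u v \<le> J w v" using JI I_le[of w v] vA by (auto simp: A1_def)
    then show "partial_energy \<kappa> s \<alpha> V1 \<mu>1 p \<beta> r v u \<le> partial_energy \<kappa> s \<alpha> V1 \<mu>1 p \<beta> r v w"
      unfolding J1 by simp
  next
    fix w assume w: "w \<in> borel_sobolev s V2" "(\<integral>x. (w x)\<^sup>2 \<partial>lborel) = b\<^sup>2"
    then have "J u v \<le> J u w" using JI I_le[of u w] uA by (auto simp: A2_def)
    then show "partial_energy \<kappa> s \<alpha> V2 \<mu>2 q \<beta> r u v \<le> partial_energy \<kappa> s \<alpha> V2 \<mu>2 q \<beta> r u w"
      unfolding J2[OF borel_sobolevD(1)[OF u(1)] borel_sobolevD(1)[OF v(1)]] J2[OF borel_sobolevD(1)[OF u(1)] borel_sobolevD(1)[OF w(1)]] by simp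
  qed
qed

subsection \<open>From Borel functions to Lebesgue measurable functions\<close>

text \<open>Completeness of Lebesgue measure makes f measurable as soon as it agrees almost
  everywhere with a Borel function; integrals then transfer through \<open>g\<close>.\<close>

lemma lebesgue_eq_AE_borel:
  fixes f g :: "'b::euclidean_space \<Rightarrow> real"
  assumes g: "g \<in> borel_measurable lborel" and ae: "AE x in lborel. f x = g x"
  shows "f \<in> borel_measurable lebesgue" "integrable lebesgue f \<longleftrightarrow> integrable lborel g"
    "integral\<^sup>L lebesgue f = integral\<^sup>L lborel g"
proof -
  have gm: "g \<in> borel_measurable lebesgue" using g by (simp add: measurable_completion)
  have ae': "AE x in lebesgue. f x = g x" using ae by (rule AE_completion)
  show fm: "f \<in> borel_measurable lebesgue"
  proof (rule measurableI)
    fix A :: "real set" assume A: "A \<in> sets borel"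
    show "f -` A \<inter> space lebesgue \<in> sets lebesgue"
    proof (rule completion.in_sets_AE)
      show "g -` A \<inter> space lebesgue \<in> sets lebesgue" using gm A by (rule measurable_sets)
      show "AE x in lebesgue. (x \<in> g -` A \<inter> space lebesgue) = (x \<in> f -` A \<inter> space lebesgue)"
        using ae' by eventually_elim simp
    qed simp
  qed simp
  show "integrable lebesgue f \<longleftrightarrow> integrable lborel g"
    using integrable_cong_AE[OF fm gm ae'] integrable_completion[OF g] by simp
  show "integral\<^sup>L lebesgue f = integral\<^sup>L lborel g"
    using integral_cong_AE[OF fm gm ae'] integral_completion[OF g] by simp
qed

text \<open>P is not assumed measurable, so the argument runs through a Borel null set N off which P
  holds; the set of pairs with a coordinate in N is null by Fubini.\<close>

lemma AE_lborel_pair: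
  assumes "AE x in lborel. P x"
  shows "AE z in lborel \<Otimes>\<^sub>M lborel. P (fst z) \<and> P (snd z)"
proof -
  obtain N where N: "\<And>x. x \<in> space lborel - N \<Longrightarrow> P x" "N \<in> null_sets lborel"
    using assms by (rule AE_E3) (rule that)
  have [measurable]: "N \<in> sets borel" using N(2) by auto
  have Nae: "AE x in lborel. x \<notin> N" using N(2) by (rule AE_not_in)
  have "AE z in lborel \<Otimes>\<^sub>M lborel. fst z \<notin> N \<and> snd z \<notin> N"
  proof (rule lborel_pair.AE_pair_measure)
    show "AE x in lborel. AE y in lborel. fst (x, y) \<notin> N \<and> snd (x, y) \<notin> N"
      using Nae by eventually_elim (use Nae in simp)
  qed measurable
  then show ?thesis by eventually_elim (use N(1) in auto)
qed

lemma gagliardo_quotient_AE_eq: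
  assumes "AE x in lborel. u x = u' x" "AE x in lborel. w x = w' x"
  shows "AE z in lborel. gagliardo_quotient s u w z = gagliardo_quotient s u' w' z"
  unfolding lborel_prod[symmetric]
  using AE_lborel_pair[OF assms(1)] AE_lborel_pair[OF assms(2)]
  by eventually_elim (simp add: gagliardo_quotient_def split_beta)

text \<open>Changing \<phi> on a null set changes the Gagliardo quotient on a null set of pairs, and
  \<open>lebesgue\<close> on pairs is the completion of
  \<open>lborel \<Otimes>\<^sub>M lborel\<close>, so all three integrals keep their values.\<close>

lemma frac_sobolev_pot_borel_representative:
  fixes \<phi> :: "'a::euclidean_space \<Rightarrow> real"
  assumes \<phi>: "\<phi> \<in> frac_sobolev_pot s V" and V'[measurable]: "V' \<in> borel_measurable borel"
    and V'0: "\<And>x. 0 \<le> V' x" and VV': "AE x in lborel. V x = V' x"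
  obtains \<phi>' where "\<phi>' \<in> borel_sobolev s V'" "AE x in lborel. \<phi> x = \<phi>' x"
proof -
  have m: "\<phi> \<in> borel_measurable lebesgue" and i: "integrable lebesgue (\<lambda>x. (\<phi> x)\<^sup>2)"
    and g: "(\<integral>\<^sup>+z. ennreal (gagliardo_quotient s \<phi> \<phi> z) \<partial>lebesgue) < \<infinity>"
    and p: "(\<integral>\<^sup>+x. ennreal (V x * (\<phi> x)\<^sup>2) \<partial>lebesgue) < \<infinity>"
    using \<phi> by (auto simp: frac_sobolev_pot_def frac_sobolev_def)
  obtain \<phi>' where m'[measurable]: "\<phi>' \<in> borel_measurable borel" and ae: "AE x in lborel. \<phi> x = \<phi>' x"
    using completion_ex_borel_measurable_real[OF m] by auto
  have "AE x in lborel. (\<phi> x)\<^sup>2 = (\<phi>' x)\<^sup>2" using ae by eventually_elim simp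
  then have i': "integrable lborel (\<lambda>x. (\<phi>' x)\<^sup>2)"
    using lebesgue_eq_AE_borel(2)[of "\<lambda>x. (\<phi>' x)\<^sup>2" "\<lambda>x. (\<phi> x)\<^sup>2"] i by simp
  have "(\<integral>\<^sup>+z. ennreal (gagliardo_quotient s \<phi>' \<phi>' z) \<partial>(lborel \<Otimes>\<^sub>M lborel)) = (\<integral>\<^sup>+z. ennreal (gagliardo_quotient s \<phi> \<phi> z) \<partial>lebesgue)"
    unfolding nn_integral_completion lborel_prod
    by (rule nn_integral_cong_AE) (use gagliardo_quotient_AE_eq[OF ae ae, of s] in eventually_elim, simp)
  then have g': "integrable (lborel \<Otimes>\<^sub>M lborel) (gagliardo_quotient s \<phi>' \<phi>')"
    using g by (intro integrableI_nonneg) (auto simp: gagliardo_quotient_nonneg)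
  have "(\<integral>\<^sup>+x. ennreal (V' x * (\<phi>' x)\<^sup>2) \<partial>lborel) = (\<integral>\<^sup>+x. ennreal (V x * (\<phi> x)\<^sup>2) \<partial>lebesgue)"
    unfolding nn_integral_completion
    by (rule nn_integral_cong_AE) (use ae VV' in eventually_elim, simp)
  then have p': "integrable lborel (\<lambda>x. V' x * (\<phi>' x)\<^sup>2)"
    using p V'0 by (intro integrableI_nonneg) auto
  show thesis
    by (rule that[OF _ ae]) (use i' g' p' in \<open>simp add: borel_sobolev_def\<close>)
qed

lemma borel_sobolev_imp_frac_sobolev_pot:
  fixes u :: "'a::euclidean_space \<Rightarrow> real"
  assumes u: "u \<in> borel_sobolev s V'" and V'0: "\<And>x. 0 \<le> V' x" and VV': "AE x in lborel. V x = V' x"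
  shows "u \<in> frac_sobolev_pot s V" "(\<integral>x. (u x)\<^sup>2 \<partial>lebesgue) = (\<integral>x. (u x)\<^sup>2 \<partial>lborel)"
proof -
  note [measurable] = borel_sobolevD(1)[OF u]
  have "u \<in> borel_measurable lebesgue" by (simp add: measurable_completion)
  moreover have "integrable lebesgue (\<lambda>x. (u x)\<^sup>2)"
    using borel_sobolevD(2)[OF u] by (simp add: integrable_completion)
  moreover have "(\<integral>\<^sup>+z. ennreal (gagliardo_quotient s u u z) \<partial>lebesgue) < \<infinity>"
    using gagliardo_energy_eq[OF u] unfolding gagliardo_energy_def nn_integral_completion lborel_prod by simp
  moreover have "(\<integral>\<^sup>+x. ennreal (V x * (u x)\<^sup>2) \<partial>lebesgue) < \<infinity>"
  proof -
    have "(\<integral>\<^sup>+x. ennreal (V x * (u x)\<^sup>2) \<partial>lebesgue) = (\<integral>\<^sup>+x. ennreal (V' x * (u x)\<^sup>2) \<partial>lborel)"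
      unfolding nn_integral_completion by (rule nn_integral_cong_AE) (use VV' in eventually_elim, simp)
    also have "\<dots> = ennreal (\<integral>x. V' x * (u x)\<^sup>2 \<partial>lborel)"
      by (rule nn_integral_eq_integral[OF borel_sobolevD(4)[OF u]]) (simp add: V'0)
    finally show ?thesis by simp
  qed
  ultimately show "u \<in> frac_sobolev_pot s V" by (simp add: frac_sobolev_pot_def frac_sobolev_def)
  show "(\<integral>x. (u x)\<^sup>2 \<partial>lebesgue) = (\<integral>x. (u x)\<^sup>2 \<partial>lborel)" by (rule integral_completion) simp
qed

lemma trapping_potential_borel_representative:
  fixes V :: "'a::euclidean_space \<Rightarrow> real"
  assumes "trapping_potential V"
  obtains V' where "V' \<in> borel_measurable borel" "\<And>x. 0 \<le> V' x" "AE x in lborel. V x = V' x"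
    "\<And>R. \<exists>C. AE x in lborel. norm x \<le> R \<longrightarrow> V' x \<le> C"
    "\<And>L. \<exists>R. AE x in lborel. R \<le> norm x \<longrightarrow> L \<le> V' x"
proof -
  have V0: "\<And>x. 0 \<le> V x" and m: "V \<in> borel_measurable lebesgue" and lim: "filterlim V at_top at_infinity"
    and loc: "\<And>K. compact K \<Longrightarrow> \<exists>C. AE x in lebesgue. x \<in> K \<longrightarrow> \<bar>V x\<bar> \<le> C"
    using assms by (auto simp: trapping_potential_def locally_ess_bounded_def)
  obtain V'' where m''[measurable]: "V'' \<in> borel_measurable borel" and ae'': "AE x in lborel. V x = V'' x"
    using completion_ex_borel_measurable_real[OF m] by auto
  \<comment> \<open>Cutting off at 0 makes nonnegativity hold at every point. Agreement with V, and
    with it the local bounds and the growth, are statements up to null sets.\<close>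
  define V' where "V' x = max 0 (V'' x)" for x
  have ae: "AE x in lborel. V x = V' x"
    using ae'' by eventually_elim (use V0 in \<open>simp add: V'_def max_def\<close>, metis order_antisym)
  show thesis
  proof (rule that[OF _ _ ae])
    show "V' \<in> borel_measurable borel" unfolding V'_def by measurable
    show "0 \<le> V' x" for x by (simp add: V'_def)
    fix R :: real
    obtain C where "AE x in lborel. x \<in> cball 0 R \<longrightarrow> \<bar>V x\<bar> \<le> C"
      using loc[OF compact_cball, of 0 R] unfolding AE_completion_iff by blast
    then have "AE x in lborel. norm x \<le> R \<longrightarrow> V' x \<le> C" using ae by eventually_elim auto
    then show "\<exists>C. AE x in lborel. norm x \<le> R \<longrightarrow> V' x \<le> C" by blast
  next
    fix L :: real
    have "\<forall>\<^sub>F x in at_infinity. L \<le> V x" using lim by (simp add: filterlim_at_top)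
    then obtain R where R: "\<And>x. R \<le> norm x \<Longrightarrow> L \<le> V x" unfolding eventually_at_infinity by blast
    have "AE x in lborel. R \<le> norm x \<longrightarrow> L \<le> V' x" using ae by eventually_elim (use R in metis)
    then show "\<exists>R. AE x in lborel. R \<le> norm x \<longrightarrow> L \<le> V' x" by blast
  qed
qed

section \<open>The Riesz convolution and the nonlinear terms\<close>

lemma convolution_lborel:
  fixes w :: "'a::euclidean_space \<Rightarrow> real"
  assumes [measurable]: "w \<in> borel_measurable borel"
  shows "convolution (riesz_kernel \<alpha>) (\<lambda>y. \<bar>w y\<bar> powr r) x = (\<integral>y. riesz_kernel \<alpha> (x - y) * \<bar>w y\<bar> powr r \<partial>lborel)"
  unfolding convolution_def by (rule integral_completion) measurable

text \<open>An auxiliary function that vanishes nowhere: the bound 1 makes its powers with exponent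
  at least 1 integrable, so it belongs to the critical space.\<close>

lemma bounded_positive_integrable_function:
  obtains h :: "'a::euclidean_space \<Rightarrow> real" where "h \<in> borel_measurable borel" "\<And>x. 0 < h x" "\<And>x. h x \<le> 1" "integrable lborel h"
proof -
  obtain h :: "'a \<Rightarrow> ennreal" where hm[measurable]: "h \<in> borel_measurable borel" and h: "integral\<^sup>N lborel h \<noteq> \<infinity>" "\<And>x. 0 < h x \<and> h x < \<infinity>"
    using sigma_finite_measure.Ex_finite_integrable_function[OF sigma_finite_lborel] by auto
  define g where "g x = min 1 (enn2real (h x))" for x
  have [measurable]: "g \<in> borel_measurable borel" unfolding g_def by measurable
  have g: "0 < g x" "g x \<le> 1" "ennreal (g x) \<le> h x" for x
  proof -
    have "ennreal (enn2real (h x)) = h x" using h(2)[of x] by simp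
    moreover have "0 < enn2real (h x)" using h(2)[of x] by (simp add: enn2real_positive_iff)
    ultimately show "0 < g x" "g x \<le> 1" "ennreal (g x) \<le> h x"
      by (auto simp: g_def) (metis ennreal_leI min.cobounded2)
  qed
  have "(\<integral>\<^sup>+x. ennreal (g x) \<partial>lborel) \<le> (\<integral>\<^sup>+x. h x \<partial>lborel)" by (intro nn_integral_mono g)
  also have "\<dots> < \<infinity>" using h(1) by (simp add: less_top)
  finally have "integrable lborel g" using g(1) by (intro integrableI_nonneg) (auto intro: less_imp_le)
  then show thesis using that[of g] g by simp
qed

context riesz_exponent
begin

text \<open>Finiteness of D_r(h, w) for a positive h and Fubini give, for almost every x,
  convergence of the inner integral multiplied by (h x)^r. This factor is positive and can be
  divided out.\<close>

lemma riesz_convolution_converges: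
  fixes w :: "'a \<Rightarrow> real"
  assumes w: "w \<in> crit_space (2 + 4 * s / real DIM('a))"
  shows "convolution_ae_converges (riesz_kernel \<alpha>) (\<lambda>y. \<bar>w y\<bar> powr r)"
proof -
  note [measurable] = crit_spaceD(1)[OF w]
  obtain h :: "'a \<Rightarrow> real" where h: "h \<in> borel_measurable borel" "\<And>x. 0 < h x" "\<And>x. h x \<le> 1" "integrable lborel h"
    by (rule bounded_positive_integrable_function) (rule that)
  note [measurable] = h(1)
  have hc: "h \<in> crit_space (2 + 4 * s / real DIM('a))"
  proof -
    have le: "h x powr e \<le> h x" if "1 \<le> e" for e x
      using powr_mono'[of 1 e "h x"] h(2,3)[of x] that by simp
    have "integrable lborel (\<lambda>x. h x powr e)" if "1 \<le> e" for e
      by (rule Bochner_Integration.integrable_bound[OF h(4)]) (use le[OF that] h(2) in \<open>auto intro!: AE_I2 simp: abs_of_pos\<close>)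
    from this[of 2] this[of "2 + 4 * s / real DIM('a)"] show ?thesis
      using h(2) s by (simp add: crit_space_def abs_of_pos less_imp_le)
  qed
  have "AE x in lborel. integrable lborel (\<lambda>y. riesz_kernel \<alpha> (x - y) * \<bar>h x\<bar> powr r * \<bar>w y\<bar> powr r)"
    using lborel_pair.AE_integrable_fst'[OF integrable_riesz[OF hc w]] by simp
  then have "AE x in lborel. integrable lborel (\<lambda>y. riesz_kernel \<alpha> (x - y) * \<bar>w y\<bar> powr r)"
  proof eventually_elim
    case (elim x)
    have "0 < \<bar>h x\<bar> powr r" using h(2)[of x] by simp
    then show ?case using integrable_mult_right[OF elim, of "1 / \<bar>h x\<bar> powr r"] by simp
  qed
  then have "AE x in lebesgue. integrable lebesgue (\<lambda>y. riesz_kernel \<alpha> (x - y) * \<bar>w y\<bar> powr r)"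
    unfolding AE_completion_iff by eventually_elim (simp add: integrable_completion)
  then show ?thesis by (simp add: convolution_ae_converges_def)
qed

text \<open>Fubini: for fixed x the integral over y is the convolution times the factors that depend
  on x. Replacing \<phi>' by \<phi> changes the integrand only on a null set.\<close>

lemma choquard_term_integral:
  fixes w u \<phi> \<phi>' :: "'a \<Rightarrow> real"
  assumes w: "w \<in> crit_space (2 + 4 * s / real DIM('a))" and u: "u \<in> crit_space (2 + 4 * s / real DIM('a))"
    and \<phi>': "\<phi>' \<in> crit_space (2 + 4 * s / real DIM('a))" and ae: "AE x in lborel. \<phi> x = \<phi>' x"
  shows "integrable lebesgue (\<lambda>x. choquard_term \<alpha> r w u x * \<phi> x)"
    "(\<integral>x. choquard_term \<alpha> r w u x * \<phi> x \<partial>lebesgue) = choquard_form \<alpha> r w u \<phi>'"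
proof -
  note [measurable] = crit_spaceD(1)[OF w] crit_spaceD(1)[OF u] crit_spaceD(1)[OF \<phi>']
  define g where "g = (\<lambda>x. \<integral>y. riesz_kernel \<alpha> (x - y) * (\<bar>u x\<bar> powr (r - 2) * u x * \<phi>' x) * \<bar>w y\<bar> powr r \<partial>lborel)"
  have g_eq: "g x = choquard_term \<alpha> r w u x * \<phi>' x" for x
  proof -
    have "g x = (\<integral>y. (\<bar>u x\<bar> powr (r - 2) * u x * \<phi>' x) * (riesz_kernel \<alpha> (x - y) * \<bar>w y\<bar> powr r) \<partial>lborel)"
      unfolding g_def by (simp add: mult_ac)
    also have "\<dots> = (\<bar>u x\<bar> powr (r - 2) * u x * \<phi>' x) * (\<integral>y. riesz_kernel \<alpha> (x - y) * \<bar>w y\<bar> powr r \<partial>lborel)"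
      by simp
    finally show ?thesis by (simp add: choquard_term_def convolution_lborel)
  qed
  have gi: "integrable lborel g" "integral\<^sup>L lborel g = choquard_form \<alpha> r w u \<phi>'"
    using lborel_pair.integrable_fst'[OF choquard_form_integrable[OF w u \<phi>']]
      lborel_pair.integral_fst'[OF choquard_form_integrable[OF w u \<phi>']]
    by (simp_all add: g_def choquard_form_def)
  have "AE x in lborel. choquard_term \<alpha> r w u x * \<phi> x = g x"
    using ae by eventually_elim (simp add: g_eq)
  note t = lebesgue_eq_AE_borel[OF borel_measurable_integrable[OF gi(1)] this]
  show "integrable lebesgue (\<lambda>x. choquard_term \<alpha> r w u x * \<phi> x)" using t(2) gi(1) by simp
  show "(\<integral>x. choquard_term \<alpha> r w u x * \<phi> x \<partial>lebesgue) = choquard_form \<alpha> r w u \<phi>'" using t(3) gi(2) by simp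
qed

end

text \<open>\<open>Gamma\<close> takes the value 0 exactly at the nonpositive integers, by
  convention at its poles, and -s lies strictly between -1 and 0.\<close>

lemma frac_laplace_const_pos:
  assumes "0 < s" "s < 1"
  shows "0 < frac_laplace_const n s"
proof -
  have "- s \<notin> \<int>\<^sub>\<le>\<^sub>0"
  proof
    assume "- s \<in> \<int>\<^sub>\<le>\<^sub>0"
    then obtain k where "- s = - real k" by (auto elim!: nonpos_Ints_cases')
    then have "0 < real k" "real k < 1" using assms by auto
    then show False by simp
  qed
  then have "Gamma (- s) \<noteq> 0" by (simp add: Gamma_eq_zero_iff)
  moreover have "0 < Gamma (real n / 2 + s)" using assms by (intro Gamma_real_pos) (simp add: add_nonneg_pos)
  ultimately show ?thesis by (simp add: frac_laplace_const_def)
qed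

text \<open>The multiplier is explicit and does not depend on the test function; it is the value
  that testing the equation with u itself forces.\<close>

lemma weak_choquard_eqI:
  fixes u v V V' :: "'a::euclidean_space \<Rightarrow> real"
  assumes \<alpha>: "0 < \<alpha>" "\<alpha> < real DIM('a)" and s: "0 < s"
    and p: "1 + \<alpha> / real DIM('a) < p" "p < 1 + (\<alpha> + 2 * s) / real DIM('a)"
    and r: "1 + \<alpha> / real DIM('a) < r" "r < 1 + (\<alpha> + 2 * s) / real DIM('a)"
    and V'[measurable]: "V' \<in> borel_measurable borel" and V'0: "\<And>x. 0 \<le> V' x" and VV': "AE x in lborel. V x = V' x"
    and u: "u \<in> borel_sobolev s V'" and v: "v \<in> crit_space (2 + 4 * s / real DIM('a))"
    and a: "0 < a" and mass: "(\<integral>x. (u x)\<^sup>2 \<partial>lborel) = a\<^sup>2"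
    and min: "\<And>w. w \<in> borel_sobolev s V' \<Longrightarrow> (\<integral>x. (w x)\<^sup>2 \<partial>lborel) = a\<^sup>2 \<Longrightarrow>
       partial_energy (frac_laplace_const DIM('a) s / 2) s \<alpha> V' \<mu> p \<beta> r v u
       \<le> partial_energy (frac_laplace_const DIM('a) s / 2) s \<alpha> V' \<mu> p \<beta> r v w"
  shows "\<exists>lam. weak_choquard_eq s \<alpha> V lam \<mu> p \<beta> r u v"
proof -
  interpret P: riesz_exponent "TYPE('a)" \<alpha> s p by unfold_locales fact+
  interpret R: riesz_exponent "TYPE('a)" \<alpha> s r by unfold_locales fact+
  note uc = borel_sobolev_crit_space[OF u s]
  note [measurable] = borel_sobolevD(1)[OF u]
  define lam where "lam = (\<mu> * kernel_form (riesz_kernel \<alpha>) p u u + \<beta> * kernel_form (riesz_kernel \<alpha>) r u v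
         - (frac_laplace_const DIM('a) s / 2 * seminorm s u + (\<integral>x. V' x * (u x)\<^sup>2 \<partial>lborel))) / a\<^sup>2"
  have "weak_choquard_eq s \<alpha> V lam \<mu> p \<beta> r u v"
    unfolding weak_choquard_eq_def
  proof (intro conjI ballI)
    show "convolution_ae_converges (riesz_kernel \<alpha>) (\<lambda>y. \<bar>u y\<bar> powr p)" by (rule P.riesz_convolution_converges[OF uc])
    show "convolution_ae_converges (riesz_kernel \<alpha>) (\<lambda>y. \<bar>v y\<bar> powr r)" by (rule R.riesz_convolution_converges[OF v])
    fix \<phi> assume "\<phi> \<in> frac_sobolev_pot s V"
    then obtain \<phi>' where \<phi>': "\<phi>' \<in> borel_sobolev s V'" and ae: "AE x in lborel. \<phi> x = \<phi>' x"
      using frac_sobolev_pot_borel_representative[OF _ V' V'0 VV'] by metis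
    note [measurable] = borel_sobolevD(1)[OF \<phi>']
    note \<phi>c = borel_sobolev_crit_space[OF \<phi>' s]
    note tp = P.choquard_term_integral[OF uc uc \<phi>c ae] and tr = R.choquard_term_integral[OF v uc \<phi>c ae]
    show "integrable lebesgue (\<lambda>x. choquard_term \<alpha> p u u x * \<phi> x)" by (rule tp(1))
    show "integrable lebesgue (\<lambda>x. choquard_term \<alpha> r v u x * \<phi> x)" by (rule tr(1))
    have gm: "gagliardo_quotient s u \<phi>' \<in> borel_measurable lborel"
      unfolding lborel_prod[symmetric] by measurable
    have e1: "frac_laplace_form s u \<phi> = frac_laplace_const DIM('a) s / 2 * integral\<^sup>L (lborel \<Otimes>\<^sub>M lborel) (gagliardo_quotient s u \<phi>')"
      unfolding frac_laplace_form_def lborel_prod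
      using lebesgue_eq_AE_borel(3)[OF gm gagliardo_quotient_AE_eq[OF _ ae, of u u]] by simp
    have "AE x in lborel. V x * u x * \<phi> x = V' x * u x * \<phi>' x" using ae VV' by eventually_elim simp
    from lebesgue_eq_AE_borel(3)[OF _ this]
    have e2: "(\<integral>x. V x * u x * \<phi> x \<partial>lebesgue) = (\<integral>x. V' x * u x * \<phi>' x \<partial>lborel)" by simp
    have "AE x in lborel. u x * \<phi> x = u x * \<phi>' x" using ae by eventually_elim simp
    from lebesgue_eq_AE_borel(3)[OF _ this]
    have e3: "(\<integral>x. u x * \<phi> x \<partial>lebesgue) = (\<integral>x. u x * \<phi>' x \<partial>lborel)" by simp
    show "frac_laplace_form s u \<phi> + (\<integral>x. V x * u x * \<phi> x \<partial>lebesgue) + lam * (\<integral>x. u x * \<phi> x \<partial>lebesgue)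
        = \<mu> * (\<integral>x. choquard_term \<alpha> p u u x * \<phi> x \<partial>lebesgue) + \<beta> * (\<integral>x. choquard_term \<alpha> r v u x * \<phi> x \<partial>lebesgue)"
      unfolding e1 e2 e3 tp(2) tr(2) lam_def
      by (rule euler_lagrange[OF \<alpha> s p r V' V'0 u v \<phi>' a mass min])
  qed
  then show ?thesis by blast
qed

theorem theorem1p2:
  fixes s \<alpha> p q r \<mu>1 \<mu>2 \<beta> a b :: real
    and V1 V2 :: "real ^ 'n \<Rightarrow> real"
  assumes "0 < s" and "s < 1"
    and "3 \<le> CARD('n)"
    and "0 < \<alpha>" and "\<alpha> < real CARD('n)"
    and "p \<in> {1 + \<alpha> / real CARD('n) <..< 1 + (\<alpha> + 2 * s) / real CARD('n)}"
    and "q \<in> {1 + \<alpha> / real CARD('n) <..< 1 + (\<alpha> + 2 * s) / real CARD('n)}"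
    and "r \<in> {1 + \<alpha> / real CARD('n) <..< 1 + (\<alpha> + 2 * s) / real CARD('n)}"
    and "trapping_potential V1" and "trapping_potential V2"
    and "0 < \<mu>1" and "0 < \<mu>2" and "0 < \<beta>" and "0 < a" and "0 < b"
  shows "\<exists>u v lam1 lam2.
           choquard_system_solution s \<alpha> V1 V2 \<mu>1 \<mu>2 \<beta> p q r u v lam1 lam2 \<and>
           u \<in> mass_sphere s a \<and> v \<in> mass_sphere s b \<and>
           (AE x in lebesgue. 0 \<le> u x) \<and> (AE x in lebesgue. 0 \<le> v x)"
proof -
  have \<alpha>: "0 < \<alpha>" "\<alpha> < real DIM(real ^ 'n)" using assms by simp_all
  have p: "1 + \<alpha> / real DIM(real ^ 'n) < p" "p < 1 + (\<alpha> + 2 * s) / real DIM(real ^ 'n)"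
    and q: "1 + \<alpha> / real DIM(real ^ 'n) < q" "q < 1 + (\<alpha> + 2 * s) / real DIM(real ^ 'n)"
    and r: "1 + \<alpha> / real DIM(real ^ 'n) < r" "r < 1 + (\<alpha> + 2 * s) / real DIM(real ^ 'n)"
    using assms by simp_all
  obtain V1' where V1': "V1' \<in> borel_measurable borel" "\<And>x. 0 \<le> V1' x" "AE x in lborel. V1 x = V1' x"
    "\<And>R. \<exists>C. AE x in lborel. norm x \<le> R \<longrightarrow> V1' x \<le> C"
    "\<And>L. \<exists>R. AE x in lborel. R \<le> norm x \<longrightarrow> L \<le> V1' x"
    using trapping_potential_borel_representative[OF \<open>trapping_potential V1\<close>] by blast
  obtain V2' where V2': "V2' \<in> borel_measurable borel" "\<And>x. 0 \<le> V2' x" "AE x in lborel. V2 x = V2' x"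
    "\<And>R. \<exists>C. AE x in lborel. norm x \<le> R \<longrightarrow> V2' x \<le> C"
    "\<And>L. \<exists>R. AE x in lborel. R \<le> norm x \<longrightarrow> L \<le> V2' x"
    using trapping_potential_borel_representative[OF \<open>trapping_potential V2\<close>] by blast
  \<comment> \<open>Half the constant, so that \<kappa> times the bilinear Gagliardo integral is
    \<open>frac_laplace_form\<close>; the further factor 1/2 in the energy is undone by
    differentiating the square.\<close>
  have \<kappa>: "0 < frac_laplace_const DIM(real ^ 'n) s / 2" using frac_laplace_const_pos[OF assms(1,2)] by simp
  obtain u v where u: "u \<in> borel_sobolev s V1'" and v: "v \<in> borel_sobolev s V2'" and u0: "\<And>x. 0 \<le> u x" and v0: "\<And>x. 0 \<le> v x"
    and um: "(\<integral>x. (u x)\<^sup>2 \<partial>lborel) = a\<^sup>2" and vm: "(\<integral>x. (v x)\<^sup>2 \<partial>lborel) = b\<^sup>2"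
    and umin: "\<And>w. w \<in> borel_sobolev s V1' \<Longrightarrow> (\<integral>x. (w x)\<^sup>2 \<partial>lborel) = a\<^sup>2 \<Longrightarrow>
       partial_energy (frac_laplace_const DIM(real ^ 'n) s / 2) s \<alpha> V1' \<mu>1 p \<beta> r v u \<le> partial_energy (frac_laplace_const DIM(real ^ 'n) s / 2) s \<alpha> V1' \<mu>1 p \<beta> r v w"
    and vmin: "\<And>w. w \<in> borel_sobolev s V2' \<Longrightarrow> (\<integral>x. (w x)\<^sup>2 \<partial>lborel) = b\<^sup>2 \<Longrightarrow>
       partial_energy (frac_laplace_const DIM(real ^ 'n) s / 2) s \<alpha> V2' \<mu>2 q \<beta> r u v \<le> partial_energy (frac_laplace_const DIM(real ^ 'n) s / 2) s \<alpha> V2' \<mu>2 q \<beta> r u w"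
    by (rule choquard_minimiser[OF \<alpha> assms(1,2) p q r V1'(1,2,4,5) V2'(1,2,4,5) \<kappa> assms(11-15)]) (rule that)
  note uc = borel_sobolev_crit_space[OF u assms(1)] and vc = borel_sobolev_crit_space[OF v assms(1)]
  obtain lam1 where lam1: "weak_choquard_eq s \<alpha> V1 lam1 \<mu>1 p \<beta> r u v"
    using weak_choquard_eqI[OF \<alpha> assms(1) p r V1'(1,2,3) u vc assms(14) um umin] by blast
  obtain lam2 where lam2: "weak_choquard_eq s \<alpha> V2 lam2 \<mu>2 q \<beta> r v u"
    using weak_choquard_eqI[OF \<alpha> assms(1) q r V2'(1,2,3) v uc assms(15) vm vmin] by blast
  note us = borel_sobolev_imp_frac_sobolev_pot[OF u V1'(2,3)] and vs = borel_sobolev_imp_frac_sobolev_pot[OF v V2'(2,3)]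
  have "choquard_system_solution s \<alpha> V1 V2 \<mu>1 \<mu>2 \<beta> p q r u v lam1 lam2"
    using us(1) vs(1) lam1 lam2 by (simp add: choquard_system_solution_def)
  moreover have "u \<in> mass_sphere s a" "v \<in> mass_sphere s b"
    using us vs um vm by (simp_all add: mass_sphere_def frac_sobolev_pot_def)
  ultimately show ?thesis using u0 v0 by blast
qed

end
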